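(* Let $R$ be a Noetherian ring of (finite) Krull dimension $d$, let $n\ge 1$, and let $R[Z_1,\dots,Z_n]$ be the polynomial ring in $n$ variables over $R$. Then every residual coordinate in $R[Z_1,\dots,Z_n]$ is a $(2^d-1)n$-stable coordinate in $R[Z_1,\dots,Z_n]$.
   Context: All rings are commutative with unity. For a ring $R$ and a polynomial ring $A=R[X_1,\dots,X_n]$ in $n$ variables, an element $F\in A$ is called a coordinate in $A$ (over $R$) if there exist $F_2,\dots,F_n\in A$ such that $A=R[F,F_2,\dots,F_n]$. For $m\ge 0$, $F\in A$ is called an $m$-stable coordinate in $A$ if $F$ is a coordinate (over $R$) in the polynomial ring $A[T_1,\dots,T_m]=R[X_1,\dots,X_n,T_1,\dots,T_m]$ in $m$ further variables. $F\in A$ is called a residual coordinate in $A$ if for each prime ideal $\mathfrak p$ of $R$, with residue field $k(\mathfrak p)=R_{\mathfrak p}/\mathfrak pR_{\mathfrak p}$, the ring $A\otimes_R k(\mathfrak p)$ is a polynomial ring in $n-1$ variables over $k(\mathfrak p)[\overline F]$, where $\overline F$ is the image of $F$ in $A\otimes_R k(\mathfrak p)$; that is, $\overline F$ is a coordinate in $k(\mathfrak p)[X_1,\dots,X_n]$ over $k(\mathfrak p)$. *)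

theory Defs
  imports "HOL-Algebra.Algebra"
begin

section \<open>Krull dimension\<close>

definition prime_chain :: "('a, 'b) ring_scheme \<Rightarrow> nat \<Rightarrow> (nat \<Rightarrow> 'a set) \<Rightarrow> bool" where
  "prime_chain R l P \<longleftrightarrow> (\<forall>i\<le>l. primeideal (P i) R) \<and> (\<forall>i<l. P i \<subset> P (Suc i))"

text \<open>The dimension is the largest length (number of strict inclusions) of a chain of prime
  ideals.  The zero ring has no prime ideals, hence no dimension in this sense.\<close>

definition has_krull_dim :: "('a, 'b) ring_scheme \<Rightarrow> nat \<Rightarrow> bool" where
  "has_krull_dim R d \<longleftrightarrow> (\<exists>P. prime_chain R d P) \<and> (\<forall>l P. prime_chain R l P \<longrightarrow> l \<le> d)"


section \<open>Rings of fractions and residue fields\<close>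

definition frac_rel :: "('a, 'b) ring_scheme \<Rightarrow> 'a set \<Rightarrow> (('a \<times> 'a) \<times> ('a \<times> 'a)) set" where
  "frac_rel R S = {((a, s), (b, t)). a \<in> carrier R \<and> s \<in> S \<and> b \<in> carrier R \<and> t \<in> S \<and>
     (\<exists>u\<in>S. u \<otimes>\<^bsub>R\<^esub> (a \<otimes>\<^bsub>R\<^esub> t \<ominus>\<^bsub>R\<^esub> b \<otimes>\<^bsub>R\<^esub> s) = \<zero>\<^bsub>R\<^esub>)}"

definition frac_class :: "('a, 'b) ring_scheme \<Rightarrow> 'a set \<Rightarrow> 'a \<Rightarrow> 'a \<Rightarrow> ('a \<times> 'a) set" where
  "frac_class R S a s = frac_rel R S `` {(a, s)}"

text \<open>Sum and product are the union over all representatives of the class of the result; these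
  classes all coincide when \<open>S\<close> is a multiplicative subset of a commutative ring \<open>R\<close>.\<close>

definition frac_ring :: "('a, 'b) ring_scheme \<Rightarrow> 'a set \<Rightarrow> ('a \<times> 'a) set ring" where
  "frac_ring R S =
    \<lparr>carrier = (carrier R \<times> S) // frac_rel R S,
     monoid.mult = (\<lambda>A B. \<Union>x\<in>A. \<Union>y\<in>B.
             frac_class R S (fst x \<otimes>\<^bsub>R\<^esub> fst y) (snd x \<otimes>\<^bsub>R\<^esub> snd y)),
     one = frac_class R S \<one>\<^bsub>R\<^esub> \<one>\<^bsub>R\<^esub>,
     ring.zero = frac_class R S \<zero>\<^bsub>R\<^esub> \<one>\<^bsub>R\<^esub>,
     add = (\<lambda>A B. \<Union>x\<in>A. \<Union>y\<in>B.
             frac_class R S (fst x \<otimes>\<^bsub>R\<^esub> snd y \<oplus>\<^bsub>R\<^esub> fst y \<otimes>\<^bsub>R\<^esub> snd x) (snd x \<otimes>\<^bsub>R\<^esub> snd y))\<rparr>"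

definition localization_at :: "('a, 'b) ring_scheme \<Rightarrow> 'a set \<Rightarrow> ('a \<times> 'a) set ring" where
  "localization_at R \<pp> = frac_ring R (carrier R - \<pp>)"

definition to_localization :: "('a, 'b) ring_scheme \<Rightarrow> 'a set \<Rightarrow> 'a \<Rightarrow> ('a \<times> 'a) set" where
  "to_localization R \<pp> a = frac_class R (carrier R - \<pp>) a \<one>\<^bsub>R\<^esub>"

definition extended_prime :: "('a, 'b) ring_scheme \<Rightarrow> 'a set \<Rightarrow> ('a \<times> 'a) set set" where
  "extended_prime R \<pp> = Idl\<^bsub>localization_at R \<pp>\<^esub> (to_localization R \<pp> ` \<pp>)"

definition residue_field :: "('a, 'b) ring_scheme \<Rightarrow> 'a set \<Rightarrow> ('a \<times> 'a) set set ring" where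
  "residue_field R \<pp> = localization_at R \<pp> Quot extended_prime R \<pp>"

definition to_residue_field :: "('a, 'b) ring_scheme \<Rightarrow> 'a set \<Rightarrow> 'a \<Rightarrow> ('a \<times> 'a) set set" where
  "to_residue_field R \<pp> a =
     extended_prime R \<pp> +>\<^bsub>localization_at R \<pp>\<^esub> to_localization R \<pp> a"


section \<open>Polynomial rings in several variables\<close>

text \<open>Polynomials are represented as in \<^theory>\<open>HOL-Algebra.Indexed_Polynomials\<close>, by their
  coefficient function on monomials, a monomial being a multiset of variables.  That theory only
  multiplies by a single variable; the product here is the convolution.\<close>

definition mpoly_ring :: "('a, 'b) ring_scheme \<Rightarrow> 'c set \<Rightarrow> ('c multiset \<Rightarrow> 'a) ring" where
  "mpoly_ring R I =
    \<lparr>carrier = ring.indexed_pset R I (carrier R),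
     monoid.mult = (\<lambda>P Q m. \<Oplus>\<^bsub>R\<^esub>k\<in>{k. k \<subseteq># m}. P k \<otimes>\<^bsub>R\<^esub> Q (m - k)),
     one = ring.indexed_const R \<one>\<^bsub>R\<^esub>,
     ring.zero = ring.indexed_const R \<zero>\<^bsub>R\<^esub>,
     add = ring.indexed_padd R\<rparr>"

text \<open>The polynomial ring in \<open>n\<close> variables, indexed by \<open>0, \<dots>, n - 1\<close>.\<close>

abbreviation poly_ring_n :: "('a, 'b) ring_scheme \<Rightarrow> nat \<Rightarrow> (nat multiset \<Rightarrow> 'a) ring" where
  "poly_ring_n R n \<equiv> mpoly_ring R {..<n}"


section \<open>Coordinates\<close>

text \<open>\<open>R[F, F\<^sub>2, \<dots>, F\<^sub>n]\<close> is the subring generated by the constants and \<open>F, F\<^sub>2, \<dots>, F\<^sub>n\<close>.\<close>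

definition coordinate :: "('a, 'b) ring_scheme \<Rightarrow> nat \<Rightarrow> (nat multiset \<Rightarrow> 'a) \<Rightarrow> bool" where
  "coordinate R n F \<longleftrightarrow>
     (\<exists>Fs. length (F # Fs) = n \<and> set (F # Fs) \<subseteq> carrier (poly_ring_n R n) \<and>
        carrier (poly_ring_n R n) =
          generate_ring (poly_ring_n R n) (ring.indexed_const R ` carrier R \<union> set (F # Fs)))"

text \<open>The further variables are numbered \<open>n, \<dots>, n + m - 1\<close>, so that an element of the
  polynomial ring in \<open>n\<close> variables literally is an element of the one in \<open>n + m\<close> variables.\<close>

definition stable_coordinate ::
    "('a, 'b) ring_scheme \<Rightarrow> nat \<Rightarrow> nat \<Rightarrow> (nat multiset \<Rightarrow> 'a) \<Rightarrow> bool" where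
  "stable_coordinate R n m F \<longleftrightarrow> F \<in> carrier (poly_ring_n R n) \<and> coordinate R (n + m) F"

text \<open>The base change of the polynomial ring over \<open>R\<close> to the residue field is the polynomial ring
  over the residue field; the image of \<open>F\<close> is obtained by mapping the coefficients.\<close>

definition residual_coordinate ::
    "('a, 'b) ring_scheme \<Rightarrow> nat \<Rightarrow> (nat multiset \<Rightarrow> 'a) \<Rightarrow> bool" where
  "residual_coordinate R n F \<longleftrightarrow>
     F \<in> carrier (poly_ring_n R n) \<and>
     (\<forall>\<pp>. primeideal \<pp> R \<longrightarrow>
        coordinate (residue_field R \<pp>) n (to_residue_field R \<pp> \<circ> F))"

end

theory Submission
  imports Defs "Jordan_Normal_Form.Determinant"
begin

text \<open>One shows by induction on \<open>d\<close> that \<open>F\<close> becomes a coordinate modulo the extension of \<open>I\<close>, in \<open>2\<^sup>d n\<close>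
  variables, for every ideal \<open>I\<close> over which all chains of primes have length at most \<open>d\<close>.

  Let \<open>J\<close> be the radical of \<open>I\<close>.  Gluing the coordinate systems over the residue fields of the
  finitely many minimal primes gives some \<open>c\<close>, a nonzerodivisor modulo \<open>J\<close>, such that \<open>F\<close> is a
  coordinate over \<open>(R/J)[1/c]\<close>; the induction hypothesis applies to \<open>J + cR\<close>.  If \<open>F\<close> is a coordinate in
  \<open>N\<close> variables both after inverting \<open>c\<close> and modulo \<open>c\<close>, then it is one in \<open>2N\<close> variables modulo \<open>J\<close>:
  the inverse of the coordinate system modulo \<open>c\<close> is corrected, by means of the one over
  \<open>(R/J)[1/c]\<close>, to a map \<open>\<alpha>\<close> with \<open>F \<circ> \<alpha>\<close> equal to the first variable, and the affine modification of the
  doubled polynomial ring along the graph of \<open>\<alpha>\<close> yields the generators.  Finally, a system that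
  generates modulo all primes containing \<open>I\<close> generates modulo \<open>I\<close>, by Noetherian induction.\<close>

section \<open>Free commutative rings\<close>

text \<open>The generic system \<sigma> and the system \<beta> modulo c have only the component F in
  common, so no transition map glues them; this is what the new variables are for. Of the N new
  ones, N - 1 turn the other components of \<beta> into independent ones
  \<open>\<beta> i + c * Z i\<close>. The last one, T, compensates the single constraint that F
  imposes on the displacement from \<alpha>(Y) to X.

  The system \<sigma> is inverted only with a denominator, P(\<sigma>) = c X, so whatever is pulled
  back through P has to come out divisible by c. Hence \<alpha> is corrected, in the coordinates
  \<sigma>, by multiples of c^2 only, and displacements that are mere multiples of c are combined by
  a second difference, whose error is a multiple of c^2. The remainders of these Taylor expansions
  are kept inside explicit subalgebras, because in the end each of them must be a polynomial in the
  new generators.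

  The passage from I to its radical and back costs no variables, and each step in d doubles their
  number; this is the origin of n + (2^d - 1) n = 2^d n.\<close>

datatype 'v ring_term =
  TVar 'v | TZero | TOne | TNeg "'v ring_term"
  | TAdd "'v ring_term" "'v ring_term" | TMult "'v ring_term" "'v ring_term"

inductive ring_term_eq :: "'v ring_term \<Rightarrow> 'v ring_term \<Rightarrow> bool" where
  refl: "ring_term_eq s s"
| sym: "ring_term_eq s t \<Longrightarrow> ring_term_eq t s"
| trans: "ring_term_eq s t \<Longrightarrow> ring_term_eq t u \<Longrightarrow> ring_term_eq s u"
| neg: "ring_term_eq s t \<Longrightarrow> ring_term_eq (TNeg s) (TNeg t)"
| add: "ring_term_eq s t \<Longrightarrow> ring_term_eq s' t' \<Longrightarrow> ring_term_eq (TAdd s s') (TAdd t t')"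
| mult: "ring_term_eq s t \<Longrightarrow> ring_term_eq s' t' \<Longrightarrow> ring_term_eq (TMult s s') (TMult t t')"
| add_assoc: "ring_term_eq (TAdd (TAdd s t) u) (TAdd s (TAdd t u))"
| add_comm: "ring_term_eq (TAdd s t) (TAdd t s)"
| add_zero: "ring_term_eq (TAdd TZero s) s"
| add_neg: "ring_term_eq (TAdd (TNeg s) s) TZero"
| mult_assoc: "ring_term_eq (TMult (TMult s t) u) (TMult s (TMult t u))"
| mult_comm: "ring_term_eq (TMult s t) (TMult t s)"
| mult_one: "ring_term_eq (TMult TOne s) s"
| distrib: "ring_term_eq (TMult (TAdd s t) u) (TAdd (TMult s u) (TMult t u))"

quotient_type 'v free_ring = "'v ring_term" / ring_term_eq
  by (intro equivpI reflpI sympI transpI) (auto intro: ring_term_eq.intros)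

primrec term_eval :: "('v \<Rightarrow> 'w::comm_ring_1) \<Rightarrow> 'v ring_term \<Rightarrow> 'w" where
  "term_eval f (TVar v) = f v"
| "term_eval f TZero = 0"
| "term_eval f TOne = 1"
| "term_eval f (TNeg s) = - term_eval f s"
| "term_eval f (TAdd s t) = term_eval f s + term_eval f t"
| "term_eval f (TMult s t) = term_eval f s * term_eval f t"

lemma term_eval_cong: "ring_term_eq s t \<Longrightarrow> term_eval f s = term_eval f t"
  by (induction rule: ring_term_eq.induct) (auto simp: algebra_simps)

lift_definition fvar :: "'v \<Rightarrow> 'v free_ring" is TVar .

lift_definition feval :: "('v \<Rightarrow> 'w::comm_ring_1) \<Rightarrow> 'v free_ring \<Rightarrow> 'w" is term_eval
  by (rule term_eval_cong)

instantiation free_ring :: (type) comm_ring_1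
begin

lift_definition zero_free_ring :: "'a free_ring" is TZero .
lift_definition one_free_ring :: "'a free_ring" is TOne .
lift_definition uminus_free_ring :: "'a free_ring \<Rightarrow> 'a free_ring" is TNeg
  by (rule ring_term_eq.neg)
lift_definition plus_free_ring :: "'a free_ring \<Rightarrow> 'a free_ring \<Rightarrow> 'a free_ring" is TAdd
  by (rule ring_term_eq.add)
lift_definition times_free_ring :: "'a free_ring \<Rightarrow> 'a free_ring \<Rightarrow> 'a free_ring" is TMult
  by (rule ring_term_eq.mult)
definition minus_free_ring :: "'a free_ring \<Rightarrow> 'a free_ring \<Rightarrow> 'a free_ring" where
  "minus_free_ring p q = p + - q"

instance
proof
  fix a b c :: "'a free_ring"
  show "a + b + c = a + (b + c)" by transfer (rule ring_term_eq.add_assoc)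
  show "a + b = b + a" by transfer (rule ring_term_eq.add_comm)
  show "0 + a = a" by transfer (rule ring_term_eq.add_zero)
  show "- a + a = 0" by transfer (rule ring_term_eq.add_neg)
  show "a - b = a + - b" by (rule minus_free_ring_def)
  show "a * b * c = a * (b * c)" by transfer (rule ring_term_eq.mult_assoc)
  show "a * b = b * a" by transfer (rule ring_term_eq.mult_comm)
  show "1 * a = a" by transfer (rule ring_term_eq.mult_one)
  show "(a + b) * c = a * c + b * c" by transfer (rule ring_term_eq.distrib)
  show "(0 :: 'a free_ring) \<noteq> 1"
  proof (transfer, rule notI)
    assume "ring_term_eq (TZero :: 'a ring_term) TOne"
    from term_eval_cong[OF this, of "\<lambda>_. 0 :: int"] show False by simp
  qed
qed

end

lemma feval_simps [simp]:
  "feval f (fvar v) = f v" "feval f 0 = 0" "feval f 1 = 1" "feval f (- p) = - feval f p"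
  "feval f (p + q) = feval f p + feval f q" "feval f (p * q) = feval f p * feval f q"
  by (transfer; simp)+

lemma feval_diff [simp]: "feval f (p - q) = feval f p - feval f q"
  using feval_simps(5)[of f p "- q"] by simp

lemma feval_power [simp]: "feval f (p ^ n) = feval f p ^ n"
  by (induction n) auto

lemma feval_sum [simp]: "feval f (sum g A) = (\<Sum>x\<in>A. feval f (g x))"
  by (induction A rule: infinite_finite_induct) auto

lemma free_ring_induct [case_names var zero one neg add mult]:
  assumes "\<And>v. P (fvar v)" "P 0" "P 1" "\<And>p. P p \<Longrightarrow> P (- p)"
    "\<And>p q. P p \<Longrightarrow> P q \<Longrightarrow> P (p + q)" "\<And>p q. P p \<Longrightarrow> P q \<Longrightarrow> P (p * q)"
  shows "P p"
proof -
  have "P (abs_free_ring t)" for t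
  proof (induction t)
    case (TVar v) show ?case using assms(1)[of v] by (simp add: fvar.abs_eq)
  next
    case TZero show ?case using assms(2) by (simp add: zero_free_ring.abs_eq)
  next
    case TOne show ?case using assms(3) by (simp add: one_free_ring.abs_eq)
  next
    case (TNeg t) show ?case using assms(4)[OF TNeg] by (simp add: uminus_free_ring.abs_eq)
  next
    case (TAdd s t) show ?case using assms(5)[OF TAdd] by (simp add: plus_free_ring.abs_eq)
  next
    case (TMult s t) show ?case using assms(6)[OF TMult] by (simp add: times_free_ring.abs_eq)
  qed
  thus ?thesis by (induction p rule: free_ring.abs_induct)
qed


section \<open>Polynomial expressions and substitution\<close>

text \<open>A polynomial with coefficients in a ring with elements of type \<open>'a\<close> is handled through an
  expression for it, that is, an element of the free commutative ring on symbols for the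
  coefficients and for the variables.  Identities in a polynomial ring then become congruences
  modulo an ideal of a ring that is a type.\<close>

type_synonym 'a pexp = "('a + nat) free_ring"

text \<open>Only a symbol: \<open>cst (a \<oplus> b)\<close> and \<open>cst a + cst b\<close> are
  different expressions and agree only modulo the ideals \<open>ext I\<close> introduced below. No
  ring structure on \<open>'a\<close> is involved yet.\<close>

definition cst :: "'a \<Rightarrow> 'a pexp" where "cst a = fvar (Inl a)"

definition pX :: "nat \<Rightarrow> 'a pexp" where "pX i = fvar (Inr i)"

text \<open>To be read as the value p(x). For a family \<open>P\<close>, the \<open>i\<close>-th
  component of the composite "P after \<sigma>" is \<open>subst \<sigma> (P i)\<close>, so
  composites appear in reverse order.\<close>

definition subst :: "(nat \<Rightarrow> 'a pexp) \<Rightarrow> 'a pexp \<Rightarrow> 'a pexp" where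
  "subst x = feval (case_sum cst x)"

lemma subst_simps [simp]:
  "subst x (cst a) = cst a" "subst x (pX i) = x i" "subst x 0 = 0" "subst x 1 = 1"
  "subst x (- p) = - subst x p" "subst x (p + q) = subst x p + subst x q"
  "subst x (p * q) = subst x p * subst x q" "subst x (p - q) = subst x p - subst x q"
  "subst x (p ^ n) = subst x p ^ n" "subst x (sum g A) = (\<Sum>k\<in>A. subst x (g k))"
  by (auto simp: subst_def cst_def pX_def)

lemma pexp_induct [case_names cst pX zero one neg add mult]:
  assumes "\<And>a. P (cst a)" "\<And>i. P (pX i)" "P 0" "P 1" "\<And>p. P p \<Longrightarrow> P (- p)"
    "\<And>p q. P p \<Longrightarrow> P q \<Longrightarrow> P (p + q)" "\<And>p q. P p \<Longrightarrow> P q \<Longrightarrow> P (p * q)"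
  shows "P p"
proof (induction p rule: free_ring_induct)
  case (var v)
  thus ?case using assms(1,2) by (cases v) (auto simp: cst_def pX_def)
qed (use assms in auto)

lemma subst_subst: "subst y (subst x p) = subst (\<lambda>i. subst y (x i)) p"
  by (induction p rule: pexp_induct) auto

lemma subst_X [simp]: "subst pX p = p"
  by (induction p rule: pexp_induct) auto

section \<open>Subalgebras of expressions, and Taylor expansions with remainders confined to
  them\<close>

definition subalg :: "'a pexp set \<Rightarrow> bool" where
  "subalg S \<longleftrightarrow> range cst \<subseteq> S \<and> 0 \<in> S \<and> 1 \<in> S \<and> (\<forall>p\<in>S. - p \<in> S) \<and>
     (\<forall>p\<in>S. \<forall>q\<in>S. p + q \<in> S \<and> p * q \<in> S)"

lemma subalgD:
  assumes "subalg S"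
  shows "cst a \<in> S" "0 \<in> S" "1 \<in> S" "p \<in> S \<Longrightarrow> - p \<in> S" "p \<in> S \<Longrightarrow> q \<in> S \<Longrightarrow> p + q \<in> S"
    "p \<in> S \<Longrightarrow> q \<in> S \<Longrightarrow> p * q \<in> S" "p \<in> S \<Longrightarrow> q \<in> S \<Longrightarrow> p - q \<in> S"
  using assms unfolding subalg_def by (auto simp: image_subset_iff) (metis add_uminus_conv_diff)

lemma subst_in_subalg:
  assumes "subalg S" "range x \<subseteq> S"
  shows "subst x p \<in> S"
  by (induction p rule: pexp_induct) (use assms subalgD[OF assms(1)] in auto)

definition alg_gen :: "'a pexp set \<Rightarrow> 'a pexp set" where
  "alg_gen A = \<Inter>{S. subalg S \<and> A \<subseteq> S}"

lemma subalg_alg_gen [simp]: "subalg (alg_gen A)"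
  unfolding alg_gen_def subalg_def by auto

lemma alg_gen_subset: "subalg S \<Longrightarrow> A \<subseteq> S \<Longrightarrow> alg_gen A \<subseteq> S"
  unfolding alg_gen_def by auto

lemma alg_gen_incl: "p \<in> A \<Longrightarrow> p \<in> alg_gen A"
  unfolding alg_gen_def by auto

lemma alg_gen_mono: "A \<subseteq> B \<Longrightarrow> p \<in> alg_gen A \<Longrightarrow> p \<in> alg_gen B"
  unfolding alg_gen_def by auto

lemmas alg_gen_closed = subalgD[OF subalg_alg_gen]

lemma subst_in_alg_gen: "range x \<subseteq> A \<Longrightarrow> subst x p \<in> alg_gen A"
  by (rule subst_in_subalg) (auto intro: alg_gen_incl)

text \<open>Everything in p(s + c t) beyond p(s) carries a factor c, and the cofactor arises from s,
  t, c by ring operations. The membership is what later shows such a remainder to be a polynomial in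
  given generators.\<close>

lemma subst_difference:
  "\<exists>d \<in> alg_gen (range s \<union> range t \<union> {c}). subst (\<lambda>i. s i + c * t i) p = subst s p + c * d"
    (is "\<exists>d \<in> ?G. _ d")
proof (induction p rule: pexp_induct)
  case (pX i)
  show ?case by (rule bexI[of _ "t i"]) (auto intro: alg_gen_incl)
next
  case (neg p)
  then obtain d where "d \<in> ?G" "subst (\<lambda>i. s i + c * t i) p = subst s p + c * d" by blast
  thus ?case by (intro bexI[of _ "- d"]) (auto simp: alg_gen_closed)
next
  case (add p q)
  then obtain d e where "d \<in> ?G" "subst (\<lambda>i. s i + c * t i) p = subst s p + c * d"
    "e \<in> ?G" "subst (\<lambda>i. s i + c * t i) q = subst s q + c * e" by blast
  thus ?case by (intro bexI[of _ "d + e"]) (auto simp: alg_gen_closed algebra_simps)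
next
  case (mult p q)
  then obtain d e where de: "d \<in> ?G" "subst (\<lambda>i. s i + c * t i) p = subst s p + c * d"
    "e \<in> ?G" "subst (\<lambda>i. s i + c * t i) q = subst s q + c * e" by blast
  have "c \<in> ?G" "subst s p \<in> ?G" "subst s q \<in> ?G"
    by (auto intro: alg_gen_incl subst_in_alg_gen)
  hence "subst s p * e + d * subst s q + c * d * e \<in> ?G"
    using de(1,3) by (intro alg_gen_closed(5,6))
  thus ?case
    by (rule bexI[rotated]) (unfold subst_simps de(2,4), simp add: algebra_simps)
qed (rule bexI[of _ 0]; simp add: alg_gen_closed)+

definition sdiff :: "(nat \<Rightarrow> 'a pexp) \<Rightarrow> (nat \<Rightarrow> 'a pexp) \<Rightarrow> 'a pexp \<Rightarrow> 'a pexp \<Rightarrow> 'a pexp" where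
  "sdiff s t c p = (SOME d. d \<in> alg_gen (range s \<union> range t \<union> {c}) \<and>
     subst (\<lambda>i. s i + c * t i) p = subst s p + c * d)"

lemma sdiff_mem: "sdiff s t c p \<in> alg_gen (range s \<union> range t \<union> {c})"
  and subst_sdiff: "subst (\<lambda>i. s i + c * t i) p = subst s p + c * sdiff s t c p"
  using someI_ex[OF subst_difference[of s t c p, unfolded Bex_def]] unfolding sdiff_def by auto

text \<open>Terms that involve only one of t and u cancel in this combination, and every mixed term
  carries two factors c. The square matters: after division by c, which P(\<sigma>) = c X calls for,
  the error is still a multiple of c.\<close>

lemma subst_second_difference:
  "\<exists>d \<in> alg_gen (range s \<union> range t \<union> range u \<union> {c}).
     subst (\<lambda>i. s i + c * t i + c * u i) p =
       subst (\<lambda>i. s i + c * t i) p + subst (\<lambda>i. s i + c * u i) p - subst s p + c\<^sup>2 * d"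
    (is "\<exists>d \<in> ?G. _ d")
proof (induction p rule: pexp_induct)
  case (neg p)
  then obtain d where "d \<in> ?G" "subst (\<lambda>i. s i + c * t i + c * u i) p =
       subst (\<lambda>i. s i + c * t i) p + subst (\<lambda>i. s i + c * u i) p - subst s p + c\<^sup>2 * d" by blast
  thus ?case by (intro bexI[of _ "- d"]) (auto simp: alg_gen_closed)
next
  case (add p q)
  then obtain d e where d: "d \<in> ?G" "subst (\<lambda>i. s i + c * t i + c * u i) p =
       subst (\<lambda>i. s i + c * t i) p + subst (\<lambda>i. s i + c * u i) p - subst s p + c\<^sup>2 * d"
     and e: "e \<in> ?G" "subst (\<lambda>i. s i + c * t i + c * u i) q =
       subst (\<lambda>i. s i + c * t i) q + subst (\<lambda>i. s i + c * u i) q - subst s q + c\<^sup>2 * e" by blast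
  have "d + e \<in> ?G" using d(1) e(1) by (rule alg_gen_closed(5))
  thus ?case
    by (rule bexI[rotated]) (unfold subst_simps d(2) e(2), simp add: algebra_simps)
next
  case (mult p q)
  then obtain d e where
     d: "d \<in> ?G" "subst (\<lambda>i. s i + c * t i + c * u i) p =
       subst (\<lambda>i. s i + c * t i) p + subst (\<lambda>i. s i + c * u i) p - subst s p + c\<^sup>2 * d" and
     e: "e \<in> ?G" "subst (\<lambda>i. s i + c * t i + c * u i) q =
       subst (\<lambda>i. s i + c * t i) q + subst (\<lambda>i. s i + c * u i) q - subst s q + c\<^sup>2 * e" by blast
  have sub: "alg_gen (range s \<union> range t \<union> {c}) \<subseteq> ?G" "alg_gen (range s \<union> range u \<union> {c}) \<subseteq> ?G"
    by (rule subsetI, erule alg_gen_mono[rotated], blast)+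
  obtain a where a: "a \<in> ?G" "subst (\<lambda>i. s i + c * t i) p = subst s p + c * a"
    using subst_difference[of s t c p] sub by blast
  obtain b where b: "b \<in> ?G" "subst (\<lambda>i. s i + c * u i) p = subst s p + c * b"
    using subst_difference[of s u c p] sub by blast
  obtain a' where a': "a' \<in> ?G" "subst (\<lambda>i. s i + c * t i) q = subst s q + c * a'"
    using subst_difference[of s t c q] sub by blast
  obtain b' where b': "b' \<in> ?G" "subst (\<lambda>i. s i + c * u i) q = subst s q + c * b'"
    using subst_difference[of s u c q] sub by blast
  have "c \<in> ?G" "subst s p \<in> ?G" "subst s q \<in> ?G"
    by (auto intro: alg_gen_incl subst_in_alg_gen)
  \<comment> \<open>The cofactor of c^2 in the product of both expansions: the pure t-part and the
    pure u-part are already accounted for by the values at s + c t and s + c u.\<close>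
  hence "subst s p * e + subst s q * d + a * b' + b * a' + c * (a * e + b * e + d * a' + d * b')
    + c * c * d * e \<in> ?G"
    using a(1) b(1) a'(1) b'(1) d(1) e(1) by (intro alg_gen_closed(5,6))
  thus ?case
    by (rule bexI[rotated]) (unfold subst_simps d(2) e(2) a(2) b(2) a'(2) b'(2),
        simp add: algebra_simps power2_eq_square)
qed (rule bexI[of _ 0]; simp add: alg_gen_closed)+

definition sdiff2 :: "(nat \<Rightarrow> 'a pexp) \<Rightarrow> (nat \<Rightarrow> 'a pexp) \<Rightarrow> (nat \<Rightarrow> 'a pexp) \<Rightarrow> 'a pexp \<Rightarrow> 'a pexp \<Rightarrow> 'a pexp"
  where "sdiff2 s t u c p = (SOME d. d \<in> alg_gen (range s \<union> range t \<union> range u \<union> {c}) \<and>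
     subst (\<lambda>i. s i + c * t i + c * u i) p =
       subst (\<lambda>i. s i + c * t i) p + subst (\<lambda>i. s i + c * u i) p - subst s p + c\<^sup>2 * d)"

lemma sdiff2_mem: "sdiff2 s t u c p \<in> alg_gen (range s \<union> range t \<union> range u \<union> {c})"
  and subst_sdiff2: "subst (\<lambda>i. s i + c * t i + c * u i) p =
       subst (\<lambda>i. s i + c * t i) p + subst (\<lambda>i. s i + c * u i) p - subst s p + c\<^sup>2 * sdiff2 s t u c p"
  using someI_ex[OF subst_second_difference[of s t u c p, unfolded Bex_def]]
  unfolding sdiff2_def by auto

text \<open>The \<open>d k\<close> are partial derivatives, characterised by the first-order
  expansion; one choice serves all s, t and c. Only the variables below \<open>N\<close> move, which
  keeps the sum finite although there are infinitely many variables.\<close>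

definition is_gradient :: "nat \<Rightarrow> 'a pexp \<Rightarrow> (nat \<Rightarrow> 'a pexp) \<Rightarrow> bool" where
  "is_gradient N p d \<longleftrightarrow> (\<forall>s t c. (\<forall>k\<ge>N. t k = 0) \<longrightarrow>
     (\<exists>w. subst (\<lambda>i. s i + c * t i) p = subst s p + c * (\<Sum>k<N. subst s (d k) * t k) + c\<^sup>2 * w))"

lemma is_gradientD:
  assumes "is_gradient N p d" "\<And>k. N \<le> k \<Longrightarrow> t k = 0"
  obtains w where
    "subst (\<lambda>i. s i + c * t i) p = subst s p + c * (\<Sum>k<N. subst s (d k) * t k) + c\<^sup>2 * w"
  using assms unfolding is_gradient_def by blast

lemma exists_gradient: "\<exists>d. is_gradient N p d"
proof (induction p rule: pexp_induct)
  case (pX i)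
  have *: "(\<Sum>k<N. subst s (if k = i then 1 else 0) * t k) = t i"
    if "\<forall>k\<ge>N. t k = 0" for s and t :: "nat \<Rightarrow> 'a pexp"
  proof -
    have "(\<Sum>k<N. subst s (if k = i then 1 else 0) * t k) = (\<Sum>k<N. if i = k then t k else 0)"
      by (rule sum.cong) auto
    thus ?thesis using that by auto
  qed
  show ?case unfolding is_gradient_def
    by (rule exI[of _ "\<lambda>k. if k = i then 1 else 0"], intro allI impI exI[of _ 0]) (subst *, auto)
next
  case (neg p)
  then obtain d where d: "is_gradient N p d" by blast
  show ?case unfolding is_gradient_def
  proof (rule exI[of _ "\<lambda>k. - d k"], intro allI impI)
    fix s t :: "nat \<Rightarrow> 'a pexp" and c assume "\<forall>k\<ge>N. t k = 0"
    then obtain w where "subst (\<lambda>i. s i + c * t i) p =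
      subst s p + c * (\<Sum>k<N. subst s (d k) * t k) + c\<^sup>2 * w" using is_gradientD[OF d] by blast
    thus "\<exists>w. subst (\<lambda>i. s i + c * t i) (- p) =
      subst s (- p) + c * (\<Sum>k<N. subst s (- d k) * t k) + c\<^sup>2 * w"
      by (intro exI[of _ "- w"]) (simp add: sum_negf algebra_simps)
  qed
next
  case (add p q)
  then obtain d e where d: "is_gradient N p d" and e: "is_gradient N q e" by blast
  show ?case unfolding is_gradient_def
  proof (rule exI[of _ "\<lambda>k. d k + e k"], intro allI impI)
    fix s t :: "nat \<Rightarrow> 'a pexp" and c assume t: "\<forall>k\<ge>N. t k = 0"
    obtain w where w: "subst (\<lambda>i. s i + c * t i) p =
      subst s p + c * (\<Sum>k<N. subst s (d k) * t k) + c\<^sup>2 * w" using is_gradientD[OF d] t by blast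
    obtain v where v: "subst (\<lambda>i. s i + c * t i) q =
      subst s q + c * (\<Sum>k<N. subst s (e k) * t k) + c\<^sup>2 * v" using is_gradientD[OF e] t by blast
    show "\<exists>w. subst (\<lambda>i. s i + c * t i) (p + q) =
      subst s (p + q) + c * (\<Sum>k<N. subst s (d k + e k) * t k) + c\<^sup>2 * w"
      by (intro exI[of _ "w + v"]) (simp add: v w sum.distrib ring_distribs algebra_simps)
  qed
next
  case (mult p q)
  then obtain d e where d: "is_gradient N p d" and e: "is_gradient N q e" by blast
  show ?case unfolding is_gradient_def
  proof (rule exI[of _ "\<lambda>k. p * e k + q * d k"], intro allI impI)
    fix s t :: "nat \<Rightarrow> 'a pexp" and c assume t: "\<forall>k\<ge>N. t k = 0"
    define D where "D = (\<Sum>k<N. subst s (d k) * t k)"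
    define E where "E = (\<Sum>k<N. subst s (e k) * t k)"
    obtain w where w: "subst (\<lambda>i. s i + c * t i) p = subst s p + c * D + c\<^sup>2 * w"
      unfolding D_def using is_gradientD[OF d] t by blast
    obtain v where v: "subst (\<lambda>i. s i + c * t i) q = subst s q + c * E + c\<^sup>2 * v"
      unfolding E_def using is_gradientD[OF e] t by blast
    have DE: "(\<Sum>k<N. subst s (p * e k + q * d k) * t k) = subst s p * E + subst s q * D"
      unfolding D_def E_def
      by (simp add: sum_distrib_left ring_distribs sum.distrib mult.assoc)
    show "\<exists>w. subst (\<lambda>i. s i + c * t i) (p * q) =
      subst s (p * q) + c * (\<Sum>k<N. subst s (p * e k + q * d k) * t k) + c\<^sup>2 * w"
      unfolding DE
      by (intro exI[of _ "subst s p * v + subst s q * w + D * E + c * (D * v + E * w) + c * c * v * w"])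
        (simp add: v w algebra_simps power2_eq_square)
  qed
qed (unfold is_gradient_def, (rule exI[of _ "\<lambda>_. 0"], intro allI impI exI[of _ 0], simp)+)

text \<open>\<open>D\<close> is at least the degree in the variables other than the zeroth: a
  monomial of degree k in these absorbs c^k, and the surplus goes into \<open>q\<close>. The zeroth
  variable is not scaled because its value will be \<open>f\<close>, which has to be kept.\<close>

lemma subst_homogenize:
  "\<exists>D q. \<forall>x. cst c ^ D * subst x p = subst (\<lambda>i. if i = 0 then x 0 else cst c * x i) q"
proof (induction p rule: pexp_induct)
  case (cst a)
  show ?case by (rule exI[of _ 0], rule exI[of _ "cst a"]) auto
next
  case (pX i)
  show ?case
  proof (cases "i = 0")
    case True thus ?thesis by (intro exI[of _ 0] exI[of _ "pX 0"]) auto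
  next
    case False thus ?thesis by (intro exI[of _ 1] exI[of _ "pX i"]) auto
  qed
next
  case zero
  show ?case by (rule exI[of _ 0], rule exI[of _ 0]) auto
next
  case one
  show ?case by (rule exI[of _ 0], rule exI[of _ 1]) auto
next
  case (neg p)
  then obtain D q where "\<forall>x. cst c ^ D * subst x p = subst (\<lambda>i. if i = 0 then x 0 else cst c * x i) q"
    by blast
  thus ?case by (intro exI[of _ D] exI[of _ "- q"]) auto
next
  case (add p p')
  then obtain D q D' q' where
    q: "\<forall>x. cst c ^ D * subst x p = subst (\<lambda>i. if i = 0 then x 0 else cst c * x i) q" and
    q': "\<forall>x. cst c ^ D' * subst x p' = subst (\<lambda>i. if i = 0 then x 0 else cst c * x i) q'"
    by blast
  show ?case
    by (intro exI[of _ "D + D'"] exI[of _ "cst c ^ D' * q + cst c ^ D * q'"])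
      (simp add: q[rule_format, symmetric] q'[rule_format, symmetric] power_add algebra_simps)
next
  case (mult p p')
  then obtain D q D' q' where
    q: "\<forall>x. cst c ^ D * subst x p = subst (\<lambda>i. if i = 0 then x 0 else cst c * x i) q" and
    q': "\<forall>x. cst c ^ D' * subst x p' = subst (\<lambda>i. if i = 0 then x 0 else cst c * x i) q'"
    by blast
  show ?case
    by (intro exI[of _ "D + D'"] exI[of _ "q * q'"])
      (simp add: q[rule_format, symmetric] q'[rule_format, symmetric] power_add algebra_simps)
qed

section \<open>Congruences modulo an ideal\<close>

locale mod_ideal =
  fixes J :: "'r::comm_ring_1 set"
  assumes zero_mem: "0 \<in> J"
    and add_mem: "p \<in> J \<Longrightarrow> q \<in> J \<Longrightarrow> p + q \<in> J"
    and mult_mem: "p \<in> J \<Longrightarrow> q * p \<in> J"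
begin

definition cong :: "'r \<Rightarrow> 'r \<Rightarrow> bool" (infix "\<asymp>" 50) where
  "p \<asymp> q \<longleftrightarrow> p - q \<in> J"

lemma uminus_mem: "p \<in> J \<Longrightarrow> - p \<in> J"
  using mult_mem[of p "- 1"] by simp

lemma diff_mem: "p \<in> J \<Longrightarrow> q \<in> J \<Longrightarrow> p - q \<in> J"
  using add_mem[of p "- q"] uminus_mem[of q] by simp

lemma mult_mem': "p \<in> J \<Longrightarrow> p * q \<in> J"
  using mult_mem[of p q] by (simp add: mult.commute)

lemma cong_0_iff: "p \<asymp> 0 \<longleftrightarrow> p \<in> J"
  by (simp add: cong_def)

lemma cong_refl [simp, intro]: "p \<asymp> p"
  by (simp add: cong_def zero_mem)

lemma cong_sym: "p \<asymp> q \<Longrightarrow> q \<asymp> p"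
  using uminus_mem[of "p - q"] by (simp add: cong_def)

lemma cong_trans [trans]: "p \<asymp> q \<Longrightarrow> q \<asymp> r \<Longrightarrow> p \<asymp> r"
  using add_mem[of "p - q" "q - r"] by (simp add: cong_def)

lemma cong_add: "p \<asymp> q \<Longrightarrow> p' \<asymp> q' \<Longrightarrow> p + p' \<asymp> q + q'"
  using add_mem[of "p - q" "p' - q'"] by (simp add: cong_def algebra_simps)

lemma cong_uminus: "p \<asymp> q \<Longrightarrow> - p \<asymp> - q"
  using uminus_mem[of "p - q"] by (simp add: cong_def algebra_simps)

lemma cong_diff: "p \<asymp> q \<Longrightarrow> p' \<asymp> q' \<Longrightarrow> p - p' \<asymp> q - q'"
  using diff_mem[of "p - q" "p' - q'"] by (simp add: cong_def algebra_simps)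

lemma cong_mult_left: "p \<asymp> q \<Longrightarrow> r * p \<asymp> r * q"
  using mult_mem[of "p - q" r] by (simp add: cong_def algebra_simps)

lemma cong_mult: "p \<asymp> q \<Longrightarrow> p' \<asymp> q' \<Longrightarrow> p * p' \<asymp> q * q'"
  using cong_trans[OF cong_mult_left[of p' q' p], of "q' * q"] cong_mult_left[of p q q']
  by (simp add: mult.commute)

lemma cong_sum: "(\<And>x. x \<in> A \<Longrightarrow> f x \<asymp> g x) \<Longrightarrow> sum f A \<asymp> sum g A"
  by (induction A rule: infinite_finite_induct) (auto intro: cong_add)

lemma cong_prod: "(\<And>x. x \<in> A \<Longrightarrow> f x \<asymp> g x) \<Longrightarrow> prod f A \<asymp> prod g A"
  by (induction A rule: infinite_finite_induct) (auto intro: cong_mult)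

lemma det_cong:
  assumes "A \<in> carrier_mat N N" "B \<in> carrier_mat N N"
    and "\<And>i j. i < N \<Longrightarrow> j < N \<Longrightarrow> A $$ (i, j) \<asymp> B $$ (i, j)"
  shows "det A \<asymp> det B"
  unfolding det_def'[OF assms(1)] det_def'[OF assms(2)]
proof (rule cong_sum, rule cong_mult_left, rule cong_prod)
  fix p i assume "p \<in> {p. p permutes {0..<N}}" "i \<in> {0..<N}"
  thus "A $$ (i, p i) \<asymp> B $$ (i, p i)"
    using permutes_in_image[of p "{0..<N}" i] by (intro assms(3)) auto
qed

text \<open>A B = c yields det A det B = c^N, so det B times the adjugate of A is a left inverse of
  A up to c^N.\<close>

lemma left_inverse_of_right_inverse:
  fixes A B :: "nat \<Rightarrow> nat \<Rightarrow> 'r"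
  assumes AB: "\<And>i j. i < N \<Longrightarrow> j < N \<Longrightarrow> (\<Sum>k<N. A i k * B k j) \<asymp> (if i = j then c else 0)"
  shows "\<exists>L. \<forall>i<N. \<forall>j<N. (\<Sum>k<N. L i k * A k j) \<asymp> (if i = j then c ^ N else 0)"
proof -
  define MA where "MA = mat N N (\<lambda>(i, j). A i j)"
  define MB where "MB = mat N N (\<lambda>(i, j). B i j)"
  have car [simp]: "MA \<in> carrier_mat N N" "MB \<in> carrier_mat N N"
    by (auto simp: MA_def MB_def)
  have "det (MA * MB) \<asymp> det (c \<cdot>\<^sub>m 1\<^sub>m N)"
  proof (rule det_cong)
    fix i j assume ij: "i < N" "j < N"
    have "(MA * MB) $$ (i, j) = (\<Sum>k<N. A i k * B k j)"
      using ij by (simp add: MA_def MB_def scalar_prod_def lessThan_atLeast0)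
    also have "\<dots> \<asymp> (if i = j then c else 0)" using AB ij by blast
    also have "(if i = j then c else 0) = (c \<cdot>\<^sub>m 1\<^sub>m N) $$ (i, j)" using ij by simp
    finally show "(MA * MB) $$ (i, j) \<asymp> (c \<cdot>\<^sub>m 1\<^sub>m N) $$ (i, j)" .
  qed (auto simp: MA_def MB_def)
  hence det: "det MB * det MA \<asymp> c ^ N"
    by (simp add: det_mult[of MA N MB] mult.commute)
  have dims: "dim_row (adj_mat MA) = N" "dim_col (adj_mat MA) = N" "dim_row MA = N" "dim_col MA = N"
    using adj_mat(1)[OF car(1)] car(1) by (blast dest: carrier_matD)+
  define L where "L i k = det MB * adj_mat MA $$ (i, k)" for i k
  have "(\<Sum>k<N. L i k * A k j) \<asymp> (if i = j then c ^ N else 0)" if ij: "i < N" "j < N" for i j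
  proof -
    have "(\<Sum>k<N. L i k * A k j) = det MB * (\<Sum>k<N. adj_mat MA $$ (i, k) * MA $$ (k, j))"
    proof (unfold sum_distrib_left, rule sum.cong)
      fix k assume "k \<in> {..<N}"
      hence "MA $$ (k, j) = A k j" using ij by (simp add: MA_def)
      thus "L i k * A k j = det MB * (adj_mat MA $$ (i, k) * MA $$ (k, j))"
        by (simp add: L_def mult.assoc)
    qed simp
    also have "(\<Sum>k<N. adj_mat MA $$ (i, k) * MA $$ (k, j)) = (adj_mat MA * MA) $$ (i, j)"
      using ij by (simp add: dims scalar_prod_def lessThan_atLeast0)
    also have "\<dots> = (if i = j then det MA else 0)"
      unfolding adj_mat(3)[OF car(1)] using ij by simp
    finally have "(\<Sum>k<N. L i k * A k j) = (if i = j then det MB * det MA else 0)" by simp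
    thus ?thesis using det by simp
  qed
  thus ?thesis by blast
qed

end


section \<open>Polynomial ideals and injectivity\<close>

text \<open>The last two properties hold since membership in the ideals that we use, the extensions of
  ideals of the coefficient ring, is decided by the coefficients.\<close>

locale poly_ideal = mod_ideal J for J :: "'a pexp set" +
  assumes subst_mem: "p \<in> J \<Longrightarrow> subst x p \<in> J"
    and var_cancel: "pX l * p \<in> J \<Longrightarrow> p \<in> J"
    and var_separated: "(\<And>r. \<exists>w. p - pX l ^ r * w \<in> J) \<Longrightarrow> p \<in> J"
begin

lemma cong_subst: "p \<asymp> q \<Longrightarrow> subst x p \<asymp> subst x q"
  using subst_mem[of "p - q" x] by (simp add: cong_def)

lemma subst_cong_mod: "(\<And>i. x i \<asymp> y i) \<Longrightarrow> subst x p \<asymp> subst y p"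
  by (induction p rule: pexp_induct) (auto intro: cong_add cong_mult cong_uminus)

lemma var_power_cancel: "pX l ^ r * p \<in> J \<Longrightarrow> p \<in> J"
  by (induction r) (auto dest: var_cancel simp: mult.assoc)

end

text \<open>Families are infinite so that substitution is total; padding with zeros makes them
  \<open>N\<close>-tuples. In particular, \<open>subst (vcut N pX) p = p\<close> expresses that
  \<open>p\<close> involves only variables below \<open>N\<close>.\<close>

definition vcut :: "nat \<Rightarrow> (nat \<Rightarrow> 'a pexp) \<Rightarrow> nat \<Rightarrow> 'a pexp" where
  "vcut N v i = (if i < N then v i else 0)"

lemma vcut_simps [simp]: "i < N \<Longrightarrow> vcut N v i = v i" "N \<le> i \<Longrightarrow> vcut N v i = 0"
  by (auto simp: vcut_def)

lemma vcut_id: "(\<And>i. N \<le> i \<Longrightarrow> v i = 0) \<Longrightarrow> vcut N v = v"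
  by (auto simp: vcut_def fun_eq_iff)

lemma subst_vcut: "subst (vcut N v) p = subst v (subst (vcut N pX) p)"
proof -
  have "vcut N v = (\<lambda>i. subst v (vcut N pX i))" by (auto simp: vcut_def)
  thus ?thesis by (simp add: subst_subst)
qed

lemma subst_vcut_fixed: "subst (vcut N pX) p = p \<Longrightarrow> subst (vcut N v) p = subst v p"
  using subst_vcut[of N v p] by simp

lemma subst_vcut_idem:
  fixes p :: "'a pexp"
  shows "subst (vcut N pX) (subst (vcut N pX) p) = subst (vcut N pX) p"
proof -
  have "(\<lambda>i. subst (vcut N pX) (vcut N pX i)) = (vcut N pX :: nat \<Rightarrow> 'a pexp)"
    by (auto simp: vcut_def)
  thus ?thesis by (simp only: subst_subst)
qed

text \<open>Taylor expansion at X_l = 0 in the direction of X_l, with the variable itself as the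
  increment.\<close>

lemma split_var:
  fixes p :: "'a pexp"
  shows "\<exists>q. p = subst (\<lambda>i. if i = l then 0 else pX i) p + pX l * q"
proof -
  have "(\<lambda>i. (if i = l then 0 else pX i) + pX l * (if i = l then 1 else 0)) = (pX :: nat \<Rightarrow> 'a pexp)" by auto
  hence "subst (\<lambda>i. (if i = l then 0 else pX i) + pX l * (if i = l then 1 else 0)) p = p"
    by (simp only: subst_X)
  thus ?thesis
    using subst_difference[of "\<lambda>i. if i = l then 0 else pX i" "\<lambda>i. if i = l then 1 else 0" "pX l" p]
    by auto
qed

context poly_ideal
begin

text \<open>If \<open>P \<circ> \<sigma> = c\<close>, then \<open>\<sigma> \<circ> (P / c)\<close> is the identity.  The Jacobian matrix of \<open>P\<close> along
  \<open>\<sigma>\<close> has a right inverse up to the denominator \<open>c\<close>, hence also a left inverse; scaling the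
  argument by a variable \<open>\<lambda>\<close> shows that the error term is divisible by every power of \<open>\<lambda>\<close>.\<close>

lemma right_inverse_of_left_inverse:
  assumes c_subst: "\<And>x. subst x c = c"
    and c_cancel: "\<And>p. c * p \<in> J \<Longrightarrow> p \<in> J"
    and \<sigma>_0: "\<And>i. N \<le> i \<Longrightarrow> \<sigma> i = 0"
    and \<sigma>_vcut: "\<And>i. subst (vcut N pX) (\<sigma> i) = \<sigma> i"
    and P\<sigma>: "\<And>i. i < N \<Longrightarrow> subst \<sigma> (P i) \<asymp> c * pX i"
    and x_0: "\<And>i. N \<le> i \<Longrightarrow> x i = 0"
    and z_0: "\<And>i. N \<le> i \<Longrightarrow> z i = 0"
    and t_0: "\<And>i. N \<le> i \<Longrightarrow> t i = 0"
    and hyp: "\<And>i. i < N \<Longrightarrow> subst (\<lambda>i. subst z (\<sigma> i) + c * t i) (P i) \<asymp> c * x i"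
    and "i < N"
  shows "subst x (\<sigma> i) \<asymp> subst z (\<sigma> i) + c * t i"
proof -
  \<comment> \<open>The variables below N serve as a generic point z, those from N to 2N - 1 (in
    \<open>tt\<close>) as a generic displacement t, and the one numbered 2N as the scaling factor,
    which \<open>rho\<close> sets to 0.\<close>
  define lam :: "'a pexp" where "lam = pX (2 * N)"
  define rho :: "nat \<Rightarrow> 'a pexp" where "rho = (\<lambda>i. if i = 2 * N then 0 else pX i)"
  have rho_lam [simp]: "subst rho lam = 0" by (simp add: rho_def lam_def)
  have split: "\<exists>q. p = subst rho p + lam * q" for p
    unfolding rho_def lam_def by (rule split_var)
  have lam_cancel: "p \<in> J" if "lam ^ r * p \<in> J" for p r
    using that var_power_cancel unfolding lam_def by blast
  have c_pow_cancel: "p \<in> J" if "c ^ r * p \<in> J" for p r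
    using that by (induction r) (auto dest: c_cancel simp: mult.assoc)
  define tt where "tt i = (if i < N then pX (N + i) else 0 :: 'a pexp)" for i
  define d where "d i = sdiff \<sigma> tt (c * lam) (P i)" for i
  have d: "subst (\<lambda>i. \<sigma> i + (c * lam) * tt i) (P i) = subst \<sigma> (P i) + (c * lam) * d i" for i
    unfolding d_def by (rule subst_sdiff)
  \<comment> \<open>This is P(y) / c: the expansion of P(y) at \<sigma> is c X + c lam d, so the
    division is explicit.\<close>
  define xl where "xl i = (if i < N then pX i + lam * d i else 0)" for i
  define y where "y i = \<sigma> i + (c * lam) * tt i" for i
  have Py: "subst y (P i) \<asymp> c * xl i" if "i < N" for i
  proof -
    have "subst y (P i) = subst \<sigma> (P i) + (c * lam) * d i" using d[of i] by (simp add: y_def[abs_def])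
    also have "\<dots> \<asymp> c * pX i + (c * lam) * d i" using P\<sigma>[OF that] by (intro cong_add) auto
    finally show ?thesis using that by (simp add: xl_def algebra_simps)
  qed
  define e where "e i = subst xl (\<sigma> i) - y i" for i
  have e_0: "e i = 0" if "N \<le> i" for i using that \<sigma>_0 by (simp add: e_def y_def tt_def)

  have "\<forall>k. \<exists>d. is_gradient N (P k) d" by (intro allI exists_gradient)
  from choice[OF this] obtain dP where dP: "\<And>k. is_gradient N (P k) (dP k)" by blast
  \<comment> \<open>The Jacobian matrix of P along \<sigma>. \<open>rho\<close> is applied because
    nothing prevents P, and hence its gradient, from containing \<open>lam\<close>.\<close>
  define A where "A k m = subst rho (subst \<sigma> (dP k m))" for k m
  define u where "u j m = sdiff pX (\<lambda>i. if i = j then 1 else 0) lam (\<sigma> m)" for j m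
  have u: "subst (\<lambda>i. pX i + lam * (if i = j then 1 else 0)) (\<sigma> m) = \<sigma> m + lam * u j m" for j m
    unfolding u_def by (simp only: subst_sdiff subst_X)
  define u' where "u' j m = (if m < N then u j m else 0)" for j m
  have u': "subst (\<lambda>i. pX i + lam * (if i = j then 1 else 0)) (\<sigma> m) = \<sigma> m + lam * u' j m" for j m
  proof (cases "m < N")
    case True thus ?thesis by (simp add: u u'_def)
  next
    case False thus ?thesis using \<sigma>_0[of m] by (simp add: u'_def)
  qed
  \<comment> \<open>The chain rule for P(\<sigma>) = c X in the direction X_j, with
    \<open>lam\<close> as the increment: divide by \<open>lam\<close>, then set it to 0. The second
    factor is the derivative of \<sigma>.\<close>
  have AB: "(\<Sum>m<N. A k m * subst rho (u' j m)) \<asymp> (if k = j then c else 0)" if kj: "k < N" "j < N" for k j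
  proof -
    have "subst (\<lambda>i. pX i + lam * (if i = j then 1 else 0)) (subst \<sigma> (P k))
        \<asymp> c * (pX k + lam * (if k = j then 1 else 0))"
      using cong_subst[OF P\<sigma>[OF kj(1)], of "\<lambda>i. pX i + lam * (if i = j then 1 else 0)"]
      by (simp add: c_subst)
    hence 1: "subst (\<lambda>m. \<sigma> m + lam * u' j m) (P k) \<asymp> c * (pX k + lam * (if k = j then 1 else 0))"
      unfolding subst_subst u' .
    obtain w where w: "subst (\<lambda>m. \<sigma> m + lam * u' j m) (P k) =
        subst \<sigma> (P k) + lam * (\<Sum>m<N. subst \<sigma> (dP k m) * u' j m) + lam\<^sup>2 * w"
      by (rule is_gradientD[OF dP, of "u' j"]) (simp add: u'_def)
    have "subst \<sigma> (P k) + lam * (\<Sum>m<N. subst \<sigma> (dP k m) * u' j m) + lam\<^sup>2 * w - subst \<sigma> (P k)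
        \<asymp> c * (pX k + lam * (if k = j then 1 else 0)) - c * pX k"
      using cong_diff[OF 1[unfolded w] P\<sigma>[OF kj(1)]] .
    hence "lam ^ 1 * ((\<Sum>m<N. subst \<sigma> (dP k m) * u' j m) + lam * w - (if k = j then c else 0)) \<in> J"
      unfolding cong_def by (simp add: algebra_simps power2_eq_square split: if_splits)
    hence "(\<Sum>m<N. subst \<sigma> (dP k m) * u' j m) + lam * w - (if k = j then c else 0) \<in> J"
      by (rule lam_cancel)
    from subst_mem[OF this, of rho] show ?thesis
      by (cases "k = j") (simp_all add: cong_def A_def c_subst)
  qed
  obtain L where L: "\<And>i j. i < N \<Longrightarrow> j < N \<Longrightarrow> (\<Sum>k<N. L i k * A k j) \<asymp> (if i = j then c ^ N else 0)"
    using left_inverse_of_right_inverse[of N A "\<lambda>m j. subst rho (u' j m)" c] AB by blast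

  \<comment> \<open>At \<open>lam\<close> = 0 both \<sigma>(xl) and y reduce to \<sigma>, which
    gives the first factor. Thereafter P takes the same value c xl at y and at y + e = \<sigma>(xl),
    so the Jacobian annihilates the quotient w modulo \<open>lam\<close>.\<close>
  have "\<exists>w. (\<forall>i\<ge>N. w i = 0) \<and> (\<forall>i. e i \<asymp> lam ^ Suc r * w i)" for r
  proof (induction r)
    case 0
    define d' where "d' i = sdiff (vcut N pX) (\<lambda>i. if i < N then d i else 0) lam (\<sigma> i)" for i
    have "subst xl (\<sigma> i) = \<sigma> i + lam * d' i" for i
    proof -
      have "xl = (\<lambda>i. vcut N pX i + lam * (if i < N then d i else 0))"
        by (auto simp: xl_def vcut_def)
      thus ?thesis unfolding d'_def by (simp only: subst_sdiff \<sigma>_vcut)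
    qed
    hence "e i = lam * (d' i - c * tt i)" for i by (simp add: e_def y_def algebra_simps)
    thus ?case using e_0 by (intro exI[of _ "\<lambda>i. if i < N then d' i - c * tt i else 0"]) auto
  next
    case (Suc r)
    then obtain w where w: "\<And>i. N \<le> i \<Longrightarrow> w i = 0" "\<And>i. e i \<asymp> lam ^ Suc r * w i" by blast
    have step: "\<exists>v. (\<Sum>m<N. A k m * w m) \<asymp> lam * v" if k: "k < N" for k
    proof -
      obtain v where v: "subst (\<lambda>i. y i + lam ^ Suc r * w i) (P k) =
          subst y (P k) + lam ^ Suc r * (\<Sum>m<N. subst y (dP k m) * w m) + (lam ^ Suc r)\<^sup>2 * v"
        by (rule is_gradientD[OF dP w(1)])
      have "subst (\<lambda>i. y i + lam ^ Suc r * w i) (P k) \<asymp> subst (\<lambda>i. y i + e i) (P k)"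
        by (intro subst_cong_mod cong_add cong_refl) (rule cong_sym[OF w(2)])
      also have "subst (\<lambda>i. y i + e i) (P k) = subst xl (subst \<sigma> (P k))"
        by (simp add: subst_subst e_def)
      also have "\<dots> \<asymp> c * xl k" using cong_subst[OF P\<sigma>[OF k], of xl] by (simp add: c_subst)
      also have "\<dots> \<asymp> subst y (P k)" by (rule cong_sym[OF Py[OF k]])
      finally have "lam ^ Suc r * ((\<Sum>m<N. subst y (dP k m) * w m) + lam ^ Suc r * v) \<in> J"
        unfolding v cong_def by (simp add: algebra_simps power2_eq_square)
      hence 1: "(\<Sum>m<N. subst y (dP k m) * w m) + lam ^ Suc r * v \<in> J" by (rule lam_cancel)
      have "\<exists>a. subst y (dP k m) = A k m + lam * a" for m
      proof -
        have "subst y (dP k m) = subst \<sigma> (dP k m) + (c * lam) * sdiff \<sigma> tt (c * lam) (dP k m)"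
          unfolding y_def[abs_def] by (rule subst_sdiff)
        moreover obtain b where "subst \<sigma> (dP k m) = A k m + lam * b"
          using split[of "subst \<sigma> (dP k m)"] unfolding A_def by blast
        ultimately have "subst y (dP k m) = A k m + lam * (b + c * sdiff \<sigma> tt (c * lam) (dP k m))"
          by (simp add: algebra_simps)
        thus ?thesis by (rule exI)
      qed
      hence "\<forall>m. \<exists>a. subst y (dP k m) = A k m + lam * a" ..
      from choice[OF this] obtain a where a: "\<And>m. subst y (dP k m) = A k m + lam * a m" by blast
      have "(\<Sum>m<N. subst y (dP k m) * w m) = (\<Sum>m<N. A k m * w m) + lam * (\<Sum>m<N. a m * w m)"
        by (simp add: a ring_distribs sum.distrib sum_distrib_left mult.assoc)
      hence "(\<Sum>m<N. A k m * w m) - lam * (- (\<Sum>m<N. a m * w m) - lam ^ r * v) \<in> J"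
        using 1 by (simp add: algebra_simps)
      thus ?thesis unfolding cong_def by blast
    qed
    hence "\<forall>k. \<exists>v. k < N \<longrightarrow> (\<Sum>m<N. A k m * w m) \<asymp> lam * v" by blast
    from choice[OF this] obtain v where v: "\<And>k. k < N \<Longrightarrow> (\<Sum>m<N. A k m * w m) \<asymp> lam * v k"
      by blast
    have "\<exists>q. w i \<asymp> lam * q" for i
    proof (cases "i < N")
      case False thus ?thesis using w(1) by (intro exI[of _ 0]) auto
    next
      case True
      \<comment> \<open>The left inverse of the Jacobian makes c^N w a multiple of
        \<open>lam\<close>. Setting \<open>lam\<close> to 0 leaves c^N times the constant part of w
        in J, where c can be cancelled.\<close>
      have "c ^ N * w i = (\<Sum>m<N. (if i = m then c ^ N else 0) * w m)"
        using True by (simp add: if_distrib[of "\<lambda>x. x * _"] cong: if_cong)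
      also have "\<dots> \<asymp> (\<Sum>m<N. (\<Sum>k<N. L i k * A k m) * w m)"
        by (intro cong_sum cong_mult cong_refl, rule cong_sym, rule L[OF True]) simp
      also have "(\<Sum>m<N. (\<Sum>k<N. L i k * A k m) * w m) = (\<Sum>k<N. L i k * (\<Sum>m<N. A k m * w m))"
        by (subst sum_distrib_right, subst sum.swap) (simp add: sum_distrib_left mult.assoc)
      also have "\<dots> \<asymp> (\<Sum>k<N. L i k * (lam * v k))"
        using v by (intro cong_sum cong_mult_left) auto
      finally have "c ^ N * w i - (\<Sum>k<N. L i k * (lam * v k)) \<in> J" by (simp add: cong_def)
      from subst_mem[OF this, of rho] have "c ^ N * subst rho (w i) \<in> J" by (simp add: c_subst)
      hence *: "subst rho (w i) \<in> J" by (rule c_pow_cancel)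
      obtain q where "w i = subst rho (w i) + lam * q" using split by blast
      hence "w i - lam * q = subst rho (w i)" by (simp add: algebra_simps)
      thus ?thesis using * unfolding cong_def by (intro exI[of _ q]) simp
    qed
    hence "\<forall>i. \<exists>q. w i \<asymp> lam * q" ..
    from choice[OF this] obtain q where q: "\<And>i. w i \<asymp> lam * q i" by blast
    have "e i \<asymp> lam ^ Suc (Suc r) * vcut N q i" for i
    proof (cases "i < N")
      case True
      have "e i \<asymp> lam ^ Suc r * w i" by (rule w(2))
      also have "\<dots> \<asymp> lam ^ Suc r * (lam * q i)" by (intro cong_mult_left q)
      finally show ?thesis using True by (simp add: mult_ac)
    qed (simp add: e_0)
    thus ?case by (intro exI[of _ "vcut N q"]) auto
  qed
  hence pow: "\<exists>w. e i - lam ^ Suc r * w \<in> J" for i r unfolding cong_def by blast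
  have e_J: "e i \<in> J" for i
  proof (rule var_separated[of _ "2 * N"])
    fix r
    show "\<exists>w. e i - pX (2 * N) ^ r * w \<in> J"
    proof (cases r)
      case 0 thus ?thesis by (intro exI[of _ "e i"]) (simp add: zero_mem)
    next
      case (Suc r') thus ?thesis using pow[of i r'] by (simp add: lam_def)
    qed
  qed
  \<comment> \<open>Specialisation of the generic identity: X to z, the second block to t, and
    \<open>lam\<close> to 1.\<close>
  define th where "th i = (if i < N then z i else if i < 2 * N then t (i - N) else 1)" for i
  have th_\<sigma>: "subst th (\<sigma> i) = subst z (\<sigma> i)" for i
  proof -
    have "vcut N th = vcut N z" by (auto simp: vcut_def th_def)
    thus ?thesis using subst_vcut_fixed[OF \<sigma>_vcut, of th i] subst_vcut_fixed[OF \<sigma>_vcut, of z i] by simp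
  qed
  have th_y: "subst th (y i) = subst z (\<sigma> i) + c * t i" for i
    using t_0[of i] by (auto simp: y_def th_\<sigma> c_subst lam_def tt_def th_def)
  have "subst th (xl i) \<asymp> x i" for i
  proof (cases "i < N")
    case True
    have "c * subst th (xl i) \<asymp> subst th (subst y (P i))"
      using cong_subst[OF cong_sym[OF Py[OF True]], of th] by (simp add: c_subst)
    also have "\<dots> = subst (\<lambda>i. subst z (\<sigma> i) + c * t i) (P i)" by (simp add: subst_subst th_y)
    also have "\<dots> \<asymp> c * x i" by (rule hyp[OF True])
    finally have "c * (subst th (xl i) - x i) \<in> J" by (simp add: cong_def algebra_simps)
    thus ?thesis unfolding cong_def by (rule c_cancel)
  qed (use x_0 in \<open>auto simp: xl_def\<close>)
  hence 1: "subst x (\<sigma> i) \<asymp> subst th (subst xl (\<sigma> i))"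
    unfolding subst_subst by (intro subst_cong_mod) (rule cong_sym)
  have "subst xl (\<sigma> i) \<asymp> y i" using e_J[of i] by (simp add: e_def cong_def)
  from cong_trans[OF 1 cong_subst[OF this]] show ?thesis unfolding th_y .
qed

end

section \<open>Generation by a given polynomial and further ones\<close>

text \<open>Being a coordinate as a surjectivity statement: the variables below \<open>N\<close> are
  polynomials in \<open>f\<close> and \<open>N\<close> - 1 further elements modulo \<open>J\<close>.
  These elements may involve variables from \<open>N\<close> on, which
  \<open>gen_coordinate_reduced\<close> removes.\<close>

definition gen_coordinate :: "'a pexp set \<Rightarrow> nat \<Rightarrow> 'a pexp \<Rightarrow> bool" where
  "gen_coordinate J N f \<longleftrightarrow> (\<exists>b. b 0 = f \<and> (\<forall>i<N. \<exists>p. pX i - subst (vcut N b) p \<in> J))"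

context poly_ideal
begin

text \<open>Putting 0 for the variables from \<open>N\<close> on changes neither \<open>f\<close>
  nor the variables to be generated, and \<open>J\<close> is stable under substitution.\<close>

lemma gen_coordinate_reduced:
  assumes "gen_coordinate J N f" "subst (vcut N pX) f = f" "N \<ge> 1"
  obtains b a where "b 0 = f" "\<And>i. subst (vcut N pX) (b i) = b i" "\<And>i. N \<le> i \<Longrightarrow> b i = 0"
    "\<And>i. i < N \<Longrightarrow> subst b (a i) \<asymp> pX i"
proof -
  obtain b where b: "b 0 = f" "\<forall>i. \<exists>p. i < N \<longrightarrow> pX i - subst (vcut N b) p \<in> J"
    using assms(1) unfolding gen_coordinate_def by blast
  from choice[OF b(2)] obtain a where a: "\<And>i. i < N \<Longrightarrow> pX i - subst (vcut N b) (a i) \<in> J"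
    by blast
  define b' where "b' = (\<lambda>i. subst (vcut N pX) (vcut N b i))"
  show ?thesis
  proof
    show "b' 0 = f" using assms(2,3) b(1) by (simp add: b'_def)
    show "subst (vcut N pX) (b' i) = b' i" for i
      unfolding b'_def by (rule subst_vcut_idem)
    show "b' i = 0" if "N \<le> i" for i using that by (simp add: b'_def)
    fix i assume i: "i < N"
    have "pX i - subst b' (a i) \<in> J"
      using subst_mem[OF a[OF i], of "vcut N pX"] i by (simp add: subst_subst b'_def)
    hence "pX i \<asymp> subst b' (a i)" by (simp add: cong_def)
    thus "subst b' (a i) \<asymp> pX i" by (rule cong_sym)
  qed
qed

text \<open>The map \<open>\<alpha>\<close> inverts \<open>\<beta>\<close> up to multiples of \<open>c\<close>, but is exactly compatible with \<open>f\<close>: the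
  inverse of \<open>\<beta>\<close> modulo \<open>c\<close> lifts to one modulo \<open>c\<^sup>2\<close> in which the component \<open>f\<close> can be
  corrected, since the inverse \<open>P / c\<close> of \<open>\<sigma>\<close> has denominator \<open>c\<close> only.\<close>

lemma exists_compatible_inverse:
  assumes c_subst: "\<And>x. subst x c = c"
    and c_cancel: "\<And>p. c * p \<in> J \<Longrightarrow> p \<in> J"
    and N: "N \<ge> 1"
    and J': "poly_ideal J'" "\<And>p. p \<in> J' \<longleftrightarrow> (\<exists>w. p - c * w \<in> J)"
    and \<sigma>: "\<sigma> 0 = f" "\<And>i. subst (vcut N pX) (\<sigma> i) = \<sigma> i" "\<And>i. N \<le> i \<Longrightarrow> \<sigma> i = 0"
    and P: "\<And>i. i < N \<Longrightarrow> subst \<sigma> (P i) \<asymp> c * pX i"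
    and \<beta>: "\<beta> 0 = f" "\<And>i. subst (vcut N pX) (\<beta> i) = \<beta> i" "\<And>i. N \<le> i \<Longrightarrow> \<beta> i = 0"
    and a: "\<And>i. i < N \<Longrightarrow> subst \<beta> (a i) - pX i \<in> J'"
  shows "\<exists>\<alpha>. (\<forall>i\<ge>N. \<alpha> i = 0) \<and> subst \<alpha> f \<asymp> pX 0 \<and>
    (\<forall>i<N. \<exists>w. subst \<alpha> (\<beta> i) \<asymp> pX i + c * w) \<and>
    (\<forall>i<N. \<exists>w. subst \<beta> (\<alpha> i) \<asymp> pX i + c * w)"
proof -
  interpret J': poly_ideal J' by (rule J')
  have J'_iff: "p \<in> J' \<longleftrightarrow> (\<exists>w. p \<asymp> c * w)" for p by (simp add: J'(2) cong_def)
  define a' where "a' = (\<lambda>i. subst (vcut N pX) (vcut N a i))"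
  have a'_0: "a' i = 0" if "N \<le> i" for i using that by (simp add: a'_def)
  have a'_vcut: "subst (vcut N pX) (a' i) = a' i" for i
    unfolding a'_def by (rule subst_vcut_idem)
  have \<beta>_vcut: "vcut N \<beta> = \<beta>" using \<beta>(3) by (rule vcut_id)
  have \<beta>a': "subst \<beta> (a' i) = subst \<beta> (a i)" if "i < N" for i
    using that subst_vcut[of N \<beta> "a i"] by (simp add: a'_def \<beta>_vcut)

  have "subst a' (\<beta> i) - pX i \<in> J'" if "i < N" for i
  proof -
    \<comment> \<open>The denominator is 1 here, the base point 0 and the displacement X -
      \<beta>(0); thus the point \<beta>(z) + c t of the lemma is X itself, and a one-sided inverse
      modulo c becomes two-sided.\<close>
    have "J'.cong (subst a' (\<beta> i)) (subst (\<lambda>_. 0) (\<beta> i) + 1 * (vcut N pX i - subst (\<lambda>_. 0) (\<beta> i)))"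
    proof (rule J'.right_inverse_of_left_inverse[where N = N and P = a])
      show "J'.cong (subst \<beta> (a i)) (1 * pX i)" if "i < N" for i
        using a[OF that] by (simp add: J'.cong_def)
      show "J'.cong (subst (\<lambda>i. subst (\<lambda>_. 0) (\<beta> i) + 1 * (vcut N pX i - subst (\<lambda>_. 0) (\<beta> i))) (a i)) (1 * a' i)"
        if "i < N" for i
        using that by (simp add: a'_def vcut_def[abs_def])
    qed (use \<beta> a'_0 that in auto)
    thus ?thesis using that by (simp add: J'.cong_def)
  qed
  hence "\<forall>i. \<exists>w. i < N \<longrightarrow> subst a' (\<beta> i) - pX i \<asymp> c * w" unfolding J'_iff by blast
  from choice[OF this] obtain e where e: "\<And>i. i < N \<Longrightarrow> subst a' (\<beta> i) - pX i \<asymp> c * e i"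
    by blast
  define \<epsilon> where "\<epsilon> i = subst (vcut N pX) (vcut N e i)" for i
  have \<epsilon>: "subst a' (\<beta> i) \<asymp> pX i + c * \<epsilon> i" if i: "i < N" for i
  proof -
    have *: "(\<lambda>i. subst (vcut N pX) (a' i)) = a'" using a'_vcut by auto
    have "subst (vcut N pX) (subst a' (\<beta> i)) - pX i \<asymp> c * \<epsilon> i"
      using cong_subst[OF e[OF i], of "vcut N pX"] i by (simp add: c_subst \<epsilon>_def)
    hence "subst a' (\<beta> i) - pX i \<asymp> c * \<epsilon> i" unfolding subst_subst * .
    thus ?thesis by (simp add: cong_def algebra_simps)
  qed
  \<comment> \<open>One Newton step: evaluating a' at X - c \<epsilon> instead of X improves the
    error of \<beta>(a') from c \<epsilon> to a multiple of c^2.\<close>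
  define \<tau> where "\<tau> i = vcut N pX i + c * (- \<epsilon> i)" for i
  have \<tau>_0: "\<tau> i = 0" if "N \<le> i" for i using that by (simp add: \<tau>_def \<epsilon>_def)
  define \<alpha>' where "\<alpha>' i = subst \<tau> (a' i)" for i
  have \<alpha>'_0: "\<alpha>' i = 0" if "N \<le> i" for i using that a'_0 by (simp add: \<alpha>'_def)
  define d where "d i = - sdiff (vcut N pX) (\<lambda>i. - \<epsilon> i) c (\<epsilon> i)" for i
  have \<beta>\<alpha>': "subst \<alpha>' (\<beta> i) \<asymp> pX i - c * (c * d i)" if i: "i < N" for i
  proof -
    have \<epsilon>_vcut: "subst (vcut N pX) (\<epsilon> i) = \<epsilon> i" unfolding \<epsilon>_def by (rule subst_vcut_idem)
    have "subst \<alpha>' (\<beta> i) = subst \<tau> (subst a' (\<beta> i))" by (simp add: \<alpha>'_def[abs_def] subst_subst)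
    also have "\<dots> \<asymp> subst \<tau> (pX i + c * \<epsilon> i)" by (intro cong_subst \<epsilon> i)
    also have "\<dots> = \<tau> i + c * subst \<tau> (\<epsilon> i)" by (simp add: c_subst)
    also have "subst \<tau> (\<epsilon> i) = \<epsilon> i - c * d i"
      unfolding \<tau>_def[abs_def] subst_sdiff \<epsilon>_vcut d_def by simp
    finally show ?thesis using i by (simp add: \<tau>_def algebra_simps)
  qed
  \<comment> \<open>f(\<alpha>') misses X_0 by c^2 d_0; \<open>t\<close> is this defect with one
    factor c taken out, and zero in the other components. As c t is a multiple of c^2,
    P(\<sigma>(\<alpha>') + c t) = c \<alpha>' + c^2 q, so division by c is possible and changes
    \<alpha>' only by a multiple of c.\<close>
  define t where "t i = (if i = 0 then c * d 0 else 0)" for i :: nat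
  define q where "q i = sdiff (\<lambda>i. subst \<alpha>' (\<sigma> i)) (\<lambda>i. if i = 0 then d 0 else 0) (c * c) (P i)" for i
  define \<alpha> where "\<alpha> i = (if i < N then \<alpha>' i + c * q i else 0)" for i
  have "subst (\<lambda>i. subst \<alpha>' (\<sigma> i) + c * t i) (P i) \<asymp> c * \<alpha> i" if i: "i < N" for i
  proof -
    have "(\<lambda>i. subst \<alpha>' (\<sigma> i) + c * t i) = (\<lambda>i. subst \<alpha>' (\<sigma> i) + (c * c) * (if i = 0 then d 0 else 0))"
      by (auto simp: t_def mult.assoc)
    hence "subst (\<lambda>i. subst \<alpha>' (\<sigma> i) + c * t i) (P i) = subst \<alpha>' (subst \<sigma> (P i)) + (c * c) * q i"
      unfolding q_def by (simp only: subst_sdiff subst_subst)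
    also have "\<dots> \<asymp> subst \<alpha>' (c * pX i) + (c * c) * q i"
      by (intro cong_add cong_subst P i cong_refl)
    finally show ?thesis using i by (simp add: c_subst \<alpha>_def algebra_simps)
  qed
  note P\<alpha> = this
  have \<sigma>\<alpha>: "subst \<alpha> (\<sigma> i) \<asymp> subst \<alpha>' (\<sigma> i) + c * t i" if "i < N" for i
  proof (rule right_inverse_of_left_inverse[where N = N and P = P, OF c_subst c_cancel \<sigma>(3,2) P])
    show "\<alpha> i = 0" if "N \<le> i" for i using that by (simp add: \<alpha>_def)
    show "t i = 0" if "N \<le> i" for i using that N by (simp add: t_def)
  qed (use that P\<alpha> \<alpha>'_0 in auto)
  show ?thesis
  proof (intro exI[of _ \<alpha>] conjI allI impI)
    show "\<alpha> i = 0" if "N \<le> i" for i using that by (simp add: \<alpha>_def)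
    show "subst \<alpha> f \<asymp> pX 0"
    proof -
      have "subst \<alpha> f \<asymp> subst \<alpha>' f + c * (c * d 0)" using \<sigma>\<alpha>[of 0] N by (simp add: \<sigma>(1) t_def)
      also have "\<dots> \<asymp> pX 0 - c * (c * d 0) + c * (c * d 0)"
        using \<beta>\<alpha>'[of 0] N by (intro cong_add) (auto simp: \<beta>(1))
      finally show ?thesis by simp
    qed
  next
    have \<alpha>_eq: "\<alpha> = (\<lambda>i. \<alpha>' i + c * (if i < N then q i else 0))" using \<alpha>'_0 by (auto simp: \<alpha>_def)
    fix i assume i: "i < N"
    show "\<exists>w. subst \<alpha> (\<beta> i) \<asymp> pX i + c * w"
    proof -
      have "subst \<alpha> (\<beta> i) = subst \<alpha>' (\<beta> i) + c * sdiff \<alpha>' (\<lambda>i. if i < N then q i else 0) c (\<beta> i)"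
        unfolding \<alpha>_eq by (rule subst_sdiff)
      also have "\<dots> \<asymp> (pX i - c * (c * d i)) + c * sdiff \<alpha>' (\<lambda>i. if i < N then q i else 0) c (\<beta> i)"
        by (intro cong_add \<beta>\<alpha>' i cong_refl)
      also have "\<dots> = pX i + c * (sdiff \<alpha>' (\<lambda>i. if i < N then q i else 0) c (\<beta> i) - c * d i)"
        by (simp add: algebra_simps)
      finally show ?thesis by (rule exI)
    qed
  next
    fix i assume i: "i < N"
    show "\<exists>w. subst \<beta> (\<alpha> i) \<asymp> pX i + c * w"
    proof -
      have "\<alpha>' i = a' i + c * sdiff (vcut N pX) (\<lambda>i. - \<epsilon> i) c (a' i)"
        unfolding \<alpha>'_def \<tau>_def[abs_def] subst_sdiff a'_vcut ..
      moreover obtain w where "subst \<beta> (a' i) - pX i \<asymp> c * w"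
        using a[OF i] unfolding J'_iff \<beta>a'[OF i] by blast
      hence "subst \<beta> (a' i) \<asymp> pX i + c * w" by (simp add: cong_def algebra_simps)
      hence "subst \<beta> (a' i) + c * subst \<beta> (sdiff (vcut N pX) (\<lambda>i. - \<epsilon> i) c (a' i) + q i)
          \<asymp> pX i + c * w + c * subst \<beta> (sdiff (vcut N pX) (\<lambda>i. - \<epsilon> i) c (a' i) + q i)"
        by (intro cong_add cong_refl)
      ultimately have "subst \<beta> (\<alpha> i) \<asymp> pX i + c * (w + subst \<beta> (sdiff (vcut N pX) (\<lambda>i. - \<epsilon> i) c (a' i) + q i))"
        using i by (simp add: \<alpha>_def c_subst algebra_simps)
      thus ?thesis by (rule exI)
    qed
  qed
qed

text \<open>With \<open>Y = \<beta> + c Z\<close> and \<open>A = \<alpha>(Y)\<close>, the relation \<open>X = A + c W\<close> defines coordinates \<open>W\<close> that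
  satisfy \<open>f(A + c W) = f(A)\<close>.  In the coordinates given by \<open>\<sigma>\<close> one adds to \<open>X\<close> the displacement
  from \<open>A\<close> to \<open>\<alpha>(Y\<^sub>0 + c T, Y\<^sub>1, \<dots>)\<close>, where \<open>T\<close> is the last new variable; the result
  \<open>A + c V\<close> is free of this constraint, and \<open>Y\<close>, \<open>V\<close> generate.\<close>

lemma gen_coordinate_patch:
  fixes r :: 'a
  defines "c \<equiv> cst r"
  assumes c_cancel: "\<And>p. c * p \<in> J \<Longrightarrow> p \<in> J"
    and N: "N \<ge> 1"
    and J': "poly_ideal J'" "\<And>p. p \<in> J' \<longleftrightarrow> (\<exists>w. p - c * w \<in> J)"
    and f: "subst (vcut N pX) f = f"
    and \<sigma>\<^sub>0: "\<sigma>\<^sub>0 0 = f" "\<And>i. i < N \<Longrightarrow> subst (vcut N \<sigma>\<^sub>0) (P i) \<asymp> c * pX i"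
    and gen: "gen_coordinate J' N f"
  shows "gen_coordinate J (2 * N) f"
proof -
  have c_subst: "subst x c = c" for x by (simp add: c_def)
  interpret J': poly_ideal J' by (rule J')
  obtain \<beta> a where \<beta>: "\<beta> 0 = f" "\<And>i. subst (vcut N pX) (\<beta> i) = \<beta> i" "\<And>i. N \<le> i \<Longrightarrow> \<beta> i = 0"
    and a: "\<And>i. i < N \<Longrightarrow> subst \<beta> (a i) - pX i \<in> J'"
    using J'.gen_coordinate_reduced[OF gen f N] unfolding J'.cong_def by blast
  define \<sigma> where "\<sigma> i = subst (vcut N pX) (vcut N \<sigma>\<^sub>0 i)" for i
  have \<sigma>: "\<sigma> 0 = f" "\<And>i. subst (vcut N pX) (\<sigma> i) = \<sigma> i" "\<And>i. N \<le> i \<Longrightarrow> \<sigma> i = 0"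
  proof -
    show "subst (vcut N pX) (\<sigma> i) = \<sigma> i" for i unfolding \<sigma>_def by (rule subst_vcut_idem)
  qed (use N f \<sigma>\<^sub>0(1) in \<open>simp_all add: \<sigma>_def\<close>)
  have P: "subst \<sigma> (P i) \<asymp> c * pX i" if i: "i < N" for i
    using cong_subst[OF \<sigma>\<^sub>0(2)[OF i], of "vcut N pX"] i
    by (simp add: subst_subst \<sigma>_def[abs_def] c_subst)
  have "\<exists>\<alpha>. (\<forall>i\<ge>N. \<alpha> i = 0) \<and> subst \<alpha> f \<asymp> pX 0 \<and>
    (\<forall>i<N. \<exists>w. subst \<alpha> (\<beta> i) \<asymp> pX i + c * w) \<and>
    (\<forall>i<N. \<exists>w. subst \<beta> (\<alpha> i) \<asymp> pX i + c * w)"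
    by (rule exists_compatible_inverse[OF c_subst c_cancel N J' \<sigma> P \<beta> a])
  then obtain \<alpha> where \<alpha>: "\<And>i. N \<le> i \<Longrightarrow> \<alpha> i = 0" "subst \<alpha> f \<asymp> pX 0"
    "\<And>i. i < N \<Longrightarrow> \<exists>w. subst \<alpha> (\<beta> i) \<asymp> pX i + c * w"
    "\<And>i. i < N \<Longrightarrow> \<exists>w. subst \<beta> (\<alpha> i) \<asymp> pX i + c * w"
    by blast
  \<comment> \<open>Index 0 is left out so that Y_0 remains f. The variable numbered N, which this
    frees, becomes \<open>T\<close>.\<close>
  define Z :: "nat \<Rightarrow> 'a pexp" where "Z i = (if 0 < i \<and> i < N then pX (N + i) else 0)" for i
  define Y where "Y i = \<beta> i + c * Z i" for i
  have Y_0: "Y 0 = f" by (simp add: Y_def Z_def \<beta>)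
  define A where "A i = subst Y (\<alpha> i)" for i
  have A_0: "A i = 0" if "N \<le> i" for i using that by (simp add: A_def \<alpha>)
  \<comment> \<open>Modulo c, Y agrees with \<beta>, so A = \<alpha>(Y) agrees with
    \<alpha>(\<beta>) and therefore with X.\<close>
  have "\<forall>i. \<exists>w. i < N \<longrightarrow> pX i \<asymp> A i + c * w"
  proof
    fix i
    show "\<exists>w. i < N \<longrightarrow> pX i \<asymp> A i + c * w"
    proof (cases "i < N")
      case True
      then obtain w where w: "subst \<beta> (\<alpha> i) \<asymp> pX i + c * w" using \<alpha>(4) by blast
      have "A i = subst \<beta> (\<alpha> i) + c * sdiff \<beta> Z c (\<alpha> i)"
        unfolding A_def Y_def[abs_def] by (rule subst_sdiff)
      also have "\<dots> \<asymp> (pX i + c * w) + c * sdiff \<beta> Z c (\<alpha> i)" by (intro cong_add w cong_refl)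
      finally have "A i - (pX i + c * w + c * sdiff \<beta> Z c (\<alpha> i)) \<in> J" by (simp add: cong_def)
      from uminus_mem[OF this] have "pX i \<asymp> A i + c * (- w - sdiff \<beta> Z c (\<alpha> i))"
        by (simp add: cong_def algebra_simps)
      thus ?thesis by blast
    qed blast
  qed
  from choice[OF this] obtain W' where W': "\<And>i. i < N \<Longrightarrow> pX i \<asymp> A i + c * W' i" by blast
  define W where "W = vcut N W'"
  have XW: "vcut N pX i \<asymp> A i + c * W i" for i
    using W'[of i] A_0[of i] by (cases "i < N") (simp_all add: W_def)
  have X_via_W: "p \<asymp> subst (\<lambda>i. A i + c * W i) p" if "subst (vcut N pX) p = p" for p
  proof -
    have "subst (vcut N pX) p \<asymp> subst (\<lambda>i. A i + c * W i) p" by (intro subst_cong_mod XW)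
    thus ?thesis using that by simp
  qed

  define T :: "'a pexp" where "T = pX N"
  define TE where "TE i = (if i = 0 then T else 0)" for i :: nat
  define D where "D = vcut N (\<lambda>i. sdiff Y TE c (\<alpha> i))"
  have AT: "subst (\<lambda>i. Y i + c * TE i) (\<alpha> i) = A i + c * D i" for i
  proof (cases "i < N")
    case True
    have "subst (\<lambda>i. Y i + c * TE i) (\<alpha> i) = subst Y (\<alpha> i) + c * sdiff Y TE c (\<alpha> i)"
      by (rule subst_sdiff)
    thus ?thesis using True by (simp add: A_def D_def)
  next
    case False
    thus ?thesis by (simp add: \<alpha>(1) A_0 D_def)
  qed
  \<comment> \<open>Here f(\<alpha>) = X_0 is needed exactly and not just modulo c: it gives f(A) =
    Y_0 = f(X), and makes c T the increment of f from A to A + c D.\<close>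
  have fA: "subst A f \<asymp> f"
  proof -
    have "subst A f = subst Y (subst \<alpha> f)" by (simp add: subst_subst A_def[abs_def])
    also have "\<dots> \<asymp> subst Y (pX 0)" by (intro cong_subst \<alpha>)
    finally show ?thesis by (simp add: Y_0)
  qed
  have fAT: "subst (\<lambda>i. A i + c * D i) f \<asymp> f + c * T"
  proof -
    have "subst (\<lambda>i. A i + c * D i) f = subst (\<lambda>i. Y i + c * TE i) (subst \<alpha> f)"
      unfolding subst_subst AT ..
    also have "\<dots> \<asymp> subst (\<lambda>i. Y i + c * TE i) (pX 0)" by (intro cong_subst \<alpha>)
    finally show ?thesis by (simp add: Y_0 TE_def)
  qed
  define s where "s i = subst A (\<sigma> i)" for i
  define t where "t = vcut N (\<lambda>i. sdiff A W c (\<sigma> i))"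
  define t' where "t' = vcut N (\<lambda>i. sdiff A D c (\<sigma> i))"
  have sdiff_\<sigma>: "subst (\<lambda>i. x i + c * y i) (\<sigma> i) =
      subst x (\<sigma> i) + c * vcut N (\<lambda>i. sdiff x y c (\<sigma> i)) i" for x y i
  proof (cases "i < N")
    case True thus ?thesis by (simp add: subst_sdiff)
  next
    case False thus ?thesis by (simp add: \<sigma>(3))
  qed
  have st: "subst (\<lambda>i. A i + c * W i) (\<sigma> i) = s i + c * t i" for i
    unfolding s_def t_def by (rule sdiff_\<sigma>)
  have st': "subst (\<lambda>i. A i + c * D i) (\<sigma> i) = s i + c * t' i" for i
    unfolding s_def t'_def by (rule sdiff_\<sigma>)
  define dd where "dd i = sdiff2 s t t' c (P i)" for i
  \<comment> \<open>In the coordinates \<sigma>, the displacements t (from A to X) and t' (from A to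
    A + c D) are added. P takes the sum to c (A + c W) + c (A + c D) - c A up to c^2 dd, and
    \<open>V\<close> is read off after division by c.\<close>
  define V where "V = vcut N (\<lambda>i. W i + D i + dd i)"
  have PV: "subst (\<lambda>i. subst A (\<sigma> i) + c * (t i + t' i)) (P i) \<asymp> c * (A i + c * V i)" if i: "i < N" for i
  proof -
    have P1: "subst (\<lambda>i. subst v (\<sigma> i)) (P i) \<asymp> c * v i" for v
      using cong_subst[OF P[OF i], of v] by (simp add: subst_subst c_subst)
    have "(\<lambda>i. subst A (\<sigma> i) + c * (t i + t' i)) = (\<lambda>i. s i + c * t i + c * t' i)"
      by (simp add: s_def algebra_simps)
    hence "subst (\<lambda>i. subst A (\<sigma> i) + c * (t i + t' i)) (P i) =
        subst (\<lambda>i. s i + c * t i) (P i) + subst (\<lambda>i. s i + c * t' i) (P i) - subst s (P i) + c\<^sup>2 * dd i"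
      unfolding dd_def by (simp only: subst_sdiff2)
    also have "\<dots> \<asymp> c * (A i + c * W i) + c * (A i + c * D i) - c * A i + c\<^sup>2 * dd i"
      using P1[of "\<lambda>i. A i + c * W i"] P1[of "\<lambda>i. A i + c * D i"] P1[of A]
      unfolding st st' s_def[symmetric] by (intro cong_add cong_diff cong_refl)
    also have "\<dots> = c * (A i + c * V i)" using i by (simp add: V_def algebra_simps power2_eq_square)
    finally show ?thesis .
  qed
  have \<sigma>V: "subst (\<lambda>i. A i + c * V i) (\<sigma> i) \<asymp> s i + c * (t i + t' i)" if "i < N" for i
    unfolding s_def
  proof (rule right_inverse_of_left_inverse[where N = N and P = P, OF c_subst c_cancel \<sigma>(3,2) P])
    show "A i + c * V i = 0" if "N \<le> i" for i using that by (simp add: A_0 V_def)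
    show "t i + t' i = 0" if "N \<le> i" for i using that by (simp add: t_def t'_def)
  qed (use that PV A_0 in auto)

  define b where "b i = (if i < N then Y i else V (i - N))" for i
  \<comment> \<open>The elements expressible through Y and V. Membership propagates along T, D, t',
    t, dd, W, X and finally Z, each being computed from its predecessors together with A, V and
    Y.\<close>
  define S where "S = {q. \<exists>p. q \<asymp> subst (vcut (2 * N) b) p}"
  have S_cong: "q \<in> S" if "q \<asymp> q'" "q' \<in> S" for q q'
    using that unfolding S_def by (blast intro: cong_trans)
  have S_subst: "subst (vcut (2 * N) b) p \<in> S" for p unfolding S_def by blast
  have S: "subalg S"
    unfolding subalg_def
  proof (intro conjI ballI)
    show "range cst \<subseteq> S" using S_subst[of "cst _"] by auto
    show "0 \<in> S" "1 \<in> S" using S_subst[of 0] S_subst[of 1] by auto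
  next
    fix p assume "p \<in> S"
    then obtain p' where p': "p \<asymp> subst (vcut (2 * N) b) p'" unfolding S_def by blast
    have "- p \<asymp> subst (vcut (2 * N) b) (- p')" using cong_uminus[OF p'] by simp
    thus "- p \<in> S" unfolding S_def by blast
    fix q assume "q \<in> S"
    then obtain q' where q': "q \<asymp> subst (vcut (2 * N) b) q'" unfolding S_def by blast
    have "p + q \<asymp> subst (vcut (2 * N) b) (p' + q')" using cong_add[OF p' q'] by simp
    thus "p + q \<in> S" unfolding S_def by blast
    have "p * q \<asymp> subst (vcut (2 * N) b) (p' * q')" using cong_mult[OF p' q'] by simp
    thus "p * q \<in> S" unfolding S_def by blast
  qed
  note S_closed = subalgD[OF S]
  have c_S: "c \<in> S" unfolding c_def by (rule S_closed)
  have Y_S: "Y i \<in> S" for i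
    using S_subst[of "pX i"] S_closed(2) by (cases "i < N") (simp_all add: b_def Y_def Z_def \<beta>)
  have V_S: "V i \<in> S" for i
    using S_subst[of "pX (N + i)"] S_closed(2) by (cases "i < N") (simp_all add: b_def V_def)
  have A_S: "A i \<in> S" for i
    unfolding A_def using Y_S by (intro subst_in_subalg[OF S]) auto
  have sdiff_S: "sdiff x y c p \<in> S" if "\<And>i. x i \<in> S" "\<And>i. y i \<in> S" for x y p
  proof -
    have "alg_gen (range x \<union> range y \<union> {c}) \<subseteq> S" using that c_S by (intro alg_gen_subset S) auto
    thus ?thesis using sdiff_mem[of x y c p] by blast
  qed
  have cancel: "p \<asymp> q" if "c * p \<asymp> c * q" for p q
    using that c_cancel[of "p - q"] by (simp add: cong_def algebra_simps)
  have s0: "s 0 \<asymp> f" using fA by (simp add: s_def \<sigma>(1))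
  \<comment> \<open>The zeroth component of \<sigma>(A + c V) = s + c (t + t'): since f(X) = f(A),
    the part c t_0 vanishes, and c t'_0 is c T. So T is the difference quotient of f between A and A
    + c V, both of which are expressible.\<close>
  have T_S: "T \<in> S"
  proof -
    have "f \<asymp> s 0 + c * t 0" using X_via_W[OF f] st[of 0] by (simp add: \<sigma>(1))
    hence t0: "f - s 0 \<asymp> c * t 0" by (simp add: cong_def algebra_simps)
    have "c * T = (f + c * T) - f" by simp
    also have "\<dots> \<asymp> (s 0 + c * t' 0) - f"
      using fAT st'[of 0] by (intro cong_diff cong_refl) (simp add: \<sigma>(1) cong_sym)
    also have "\<dots> = (s 0 + c * (t 0 + t' 0)) - f - c * t 0" by (simp add: algebra_simps)
    also have "\<dots> \<asymp> subst (\<lambda>i. A i + c * V i) (\<sigma> 0) - f - (f - s 0)"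
      using N by (intro cong_diff cong_refl cong_sym[OF \<sigma>V] cong_sym[OF t0]) simp
    also have "subst (\<lambda>i. A i + c * V i) (\<sigma> 0) = s 0 + c * sdiff A V c (\<sigma> 0)"
      unfolding s_def by (rule subst_sdiff)
    also have "s 0 + c * sdiff A V c (\<sigma> 0) - f - (f - s 0) \<asymp> s 0 + c * sdiff A V c (\<sigma> 0) - s 0 - (s 0 - s 0)"
      by (intro cong_diff cong_refl cong_sym[OF s0])
    finally have "c * T \<asymp> c * sdiff A V c (\<sigma> 0)" by simp
    from cancel[OF this] show ?thesis by (rule S_cong) (intro sdiff_S A_S V_S)
  qed
  have D_S: "D i \<in> S" for i
  proof (cases "i < N")
    case True
    have "TE i \<in> S" for i using T_S S_closed(2) by (simp add: TE_def)
    thus ?thesis using True by (simp add: D_def sdiff_S Y_S)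
  qed (simp add: D_def S_closed(2))
  have s_S: "s i \<in> S" for i
    unfolding s_def using A_S by (intro subst_in_subalg[OF S]) auto
  have t'_S: "t' i \<in> S" for i
    by (cases "i < N") (simp_all add: t'_def sdiff_S A_S D_S S_closed(2))
  have t_S: "t i \<in> S" for i
  proof (cases "i < N")
    case True
    have "s i + c * sdiff A V c (\<sigma> i) \<asymp> s i + c * (t i + t' i)"
      using \<sigma>V[OF True] unfolding subst_sdiff s_def .
    hence "c * (t i + t' i) \<asymp> c * sdiff A V c (\<sigma> i)"
      by (intro cong_sym[of "c * sdiff A V c (\<sigma> i)"]) (simp add: cong_def)
    from cong_diff[OF cancel[OF this] cong_refl[of "t' i"]]
    have "t i \<asymp> sdiff A V c (\<sigma> i) - t' i" by simp
    thus ?thesis by (rule S_cong) (intro S_closed(7) sdiff_S A_S V_S t'_S)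
  qed (simp add: t_def S_closed(2))
  have dd_S: "dd i \<in> S" for i
  proof -
    have "alg_gen (range s \<union> range t \<union> range t' \<union> {c}) \<subseteq> S"
      using s_S t_S t'_S c_S by (intro alg_gen_subset S) auto
    thus ?thesis using sdiff2_mem[of s t t' c "P i"] unfolding dd_def by blast
  qed
  have W_S: "W i \<in> S" for i
  proof (cases "i < N")
    case True
    hence "W i = V i - D i - dd i" by (simp add: V_def)
    thus ?thesis by (simp add: S_closed(7) V_S D_S dd_S)
  qed (simp add: W_def S_closed(2))
  have X_S: "pX i \<in> S" if "i < N" for i
    using XW[of i] that by (auto intro!: S_cong[of "pX i" "A i + c * W i"] S_closed(5,6) A_S W_S c_S)
  \<comment> \<open>Two values of \<open>\<beta> i\<close>: it is Y_i - c Z_i by definition, and at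
    X = A + c W it is \<beta>_i(\<alpha>(Y)) = Y_i + c w(Y) up to c times an element of S. Now c
    cancels.\<close>
  have Z_S: "pX (N + i) \<in> S" if i: "0 < i" "i < N" for i
  proof -
    obtain w where w: "subst \<alpha> (\<beta> i) \<asymp> pX i + c * w" using \<alpha>(3) i by blast
    have "\<beta> i \<asymp> subst (\<lambda>i. A i + c * W i) (\<beta> i)" by (rule X_via_W[OF \<beta>(2)])
    also have "\<dots> = subst A (\<beta> i) + c * sdiff A W c (\<beta> i)" by (rule subst_sdiff)
    also have "subst A (\<beta> i) = subst Y (subst \<alpha> (\<beta> i))" by (simp add: subst_subst A_def[abs_def])
    also have "\<dots> + c * sdiff A W c (\<beta> i) \<asymp> subst Y (pX i + c * w) + c * sdiff A W c (\<beta> i)"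
      by (intro cong_add cong_subst w cong_refl)
    finally have "\<beta> i - (Y i + c * subst Y w + c * sdiff A W c (\<beta> i)) \<in> J"
      by (simp add: cong_def c_subst)
    from uminus_mem[OF this] have "c * pX (N + i) \<asymp> c * (- subst Y w - sdiff A W c (\<beta> i))"
      using i by (simp add: cong_def Y_def Z_def algebra_simps)
    from cancel[OF this] show ?thesis
      by (rule S_cong) (intro S_closed(4,7) subst_in_subalg[OF S] sdiff_S A_S W_S, use Y_S in auto)
  qed
  have "pX i \<in> S" if "i < 2 * N" for i
  proof (cases "i < N")
    case False
    then obtain j where j: "i = N + j" using le_Suc_ex by (metis not_less)
    thus ?thesis using T_S Z_S[of j] that by (cases "j = 0") (auto simp: T_def)
  qed (rule X_S)
  moreover have "b 0 = f" using N by (simp add: b_def Y_0)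
  ultimately show ?thesis unfolding gen_coordinate_def S_def cong_def by blast
qed

end

section \<open>The polynomial ring is a commutative ring\<close>

lemma finite_sub_multisets: "finite {k. k \<subseteq># m}"
proof (rule finite_subset)
  show "{k. k \<subseteq># m} \<subseteq> mset ` {xs. set xs \<subseteq> set_mset m \<and> length xs \<le> size m}"
  proof
    fix k assume "k \<in> {k. k \<subseteq># m}"
    hence k: "k \<subseteq># m" by simp
    obtain xs where xs: "k = mset xs" using ex_mset[of k] by auto
    have "set xs \<subseteq> set_mset m" using set_mset_mono[OF k] by (simp add: xs)
    moreover have "length xs \<le> size m" using size_mset_mono[OF k] by (simp add: xs)
    ultimately show "k \<in> mset ` {xs. set xs \<subseteq> set_mset m \<and> length xs \<le> size m}"
      by (auto simp: xs)
  qed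
qed (auto intro: finite_lists_length_le)

context cring
begin

definition conv :: "('c multiset \<Rightarrow> 'a) \<Rightarrow> ('c multiset \<Rightarrow> 'a) \<Rightarrow> 'c multiset \<Rightarrow> 'a" where
  "conv P Q = (\<lambda>m. \<Oplus>k\<in>{k. k \<subseteq># m}. P k \<otimes> Q (m - k))"

lemma mpoly_ring_simps:
  "carrier (mpoly_ring R I) = indexed_pset I (carrier R)"
  "monoid.mult (mpoly_ring R I) = conv" "one (mpoly_ring R I) = indexed_const \<one>"
  "ring.zero (mpoly_ring R I) = indexed_const \<zero>" "add (mpoly_ring R I) = indexed_padd"
  by (simp_all add: mpoly_ring_def conv_def fun_eq_iff)

lemma coeff_closed: "P \<in> indexed_pset I (carrier R) \<Longrightarrow> P m \<in> carrier R"
  using indexed_pset_in_carrier[of "carrier R" P I] by (simp add: carrier_coeff_def)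

lemma conv_closed_coeff:
  assumes "\<And>m. P m \<in> carrier R" "\<And>m. Q m \<in> carrier R"
  shows "conv P Q m \<in> carrier R"
  unfolding conv_def using assms by (intro finsum_closed) auto

text \<open>k \<mapsto> m - k is an involution of the submultisets of m.\<close>

lemma conv_comm:
  fixes P Q :: "'c multiset \<Rightarrow> 'a"
  assumes P: "\<And>m. P m \<in> carrier R" and Q: "\<And>m. Q m \<in> carrier R"
  shows "conv P Q = conv Q P"
proof
  fix m :: "'c multiset"
  have im: "(\<lambda>k. m - k) ` {k. k \<subseteq># m} = {k. k \<subseteq># m}"
  proof (intro equalityI subsetI)
    fix k assume "k \<in> {k. k \<subseteq># m}"
    hence "k = m - (m - k)" "m - k \<subseteq># m"
      by (auto simp: multiset_eq_iff subseteq_mset_def)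
    thus "k \<in> (\<lambda>k. m - k) ` {k. k \<subseteq># m}" by blast
  qed (auto simp: subseteq_mset_def)
  have inj: "inj_on (\<lambda>k. m - k) {k. k \<subseteq># m}"
  proof (rule inj_onI)
    fix k l assume "k \<in> {k. k \<subseteq># m}" "l \<in> {k. k \<subseteq># m}" "m - k = m - l"
    thus "k = l" by (metis mem_Collect_eq subset_mset.diff_diff_right subset_mset.add_diff_inverse
          add_diff_cancel_left' diff_subset_eq_self)
  qed
  have "conv P Q m = (\<Oplus>k\<in>(\<lambda>k. m - k) ` {k. k \<subseteq># m}. P k \<otimes> Q (m - k))"
    by (simp add: conv_def im)
  also have "\<dots> = (\<Oplus>k\<in>{k. k \<subseteq># m}. P (m - k) \<otimes> Q (m - (m - k)))"
    using P Q inj by (intro finsum_reindex) auto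
  also have "\<dots> = (\<Oplus>k\<in>{k. k \<subseteq># m}. Q k \<otimes> P (m - k))"
  proof (rule finsum_cong')
    fix k assume "k \<in> {k. k \<subseteq># m}"
    hence "m - (m - k) = k" by (auto simp: multiset_eq_iff subseteq_mset_def)
    thus "P (m - k) \<otimes> Q (m - (m - k)) = Q k \<otimes> P (m - k)" using P Q by (simp add: m_comm)
  qed (use P Q in auto)
  finally show "conv P Q m = conv Q P m" by (simp add: conv_def)
qed

lemma conv_const:
  assumes "c \<in> carrier R" and Q: "\<And>m. Q m \<in> carrier R"
  shows "conv (indexed_const c) Q = (\<lambda>m. c \<otimes> Q m)"
proof
  fix m
  have "conv (indexed_const c) Q m =
      (\<Oplus>k\<in>{k. k \<subseteq># m}. if {#} = k then c \<otimes> Q (m - k) else \<zero>)"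
    unfolding conv_def using assms by (intro finsum_cong') (auto simp: indexed_const_def)
  also have "\<dots> = c \<otimes> Q (m - {#})"
    by (rule finsum_singleton) (use assms finite_sub_multisets in auto)
  finally show "conv (indexed_const c) Q m = c \<otimes> Q m" by simp
qed

lemma conv_add_left:
  assumes "\<And>m. P m \<in> carrier R" "\<And>m. P' m \<in> carrier R" "\<And>m. Q m \<in> carrier R"
  shows "conv (indexed_padd P P') Q = indexed_padd (conv P Q) (conv P' Q)"
proof
  fix m
  have "conv (indexed_padd P P') Q m =
      (\<Oplus>k\<in>{k. k \<subseteq># m}. P k \<otimes> Q (m - k) \<oplus> P' k \<otimes> Q (m - k))"
    unfolding conv_def indexed_padd_def using assms by (intro finsum_cong') (auto simp: l_distr)
  also have "\<dots> = (\<Oplus>k\<in>{k. k \<subseteq># m}. P k \<otimes> Q (m - k)) \<oplus> (\<Oplus>k\<in>{k. k \<subseteq># m}. P' k \<otimes> Q (m - k))"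
    using assms by (intro finsum_addf) auto
  finally show "conv (indexed_padd P P') Q m = indexed_padd (conv P Q) (conv P' Q) m"
    by (simp add: conv_def indexed_padd_def)
qed

text \<open>The submultisets of m that contain i correspond to those of m with one i removed; all
  others contribute zero. Together with the rules for constants and sums this reduces ring laws to
  induction on one factor.\<close>

lemma conv_pmult_left:
  assumes P: "\<And>m. P m \<in> carrier R" and Q: "\<And>m. Q m \<in> carrier R"
  shows "conv (indexed_pmult P i) Q = indexed_pmult (conv P Q) i"
proof
  fix m
  have cl: "indexed_pmult P i k \<in> carrier R" for k using P by (simp add: indexed_pmult_def)
  show "conv (indexed_pmult P i) Q m = indexed_pmult (conv P Q) i m"
  proof (cases "i \<in># m")
    case False
    hence "indexed_pmult P i k = \<zero>" if "k \<subseteq># m" for k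
      using that by (auto simp: indexed_pmult_def dest: mset_subset_eqD)
    hence "conv (indexed_pmult P i) Q m = (\<Oplus>k\<in>{k. k \<subseteq># m}. \<zero>)"
      unfolding conv_def using Q by (intro finsum_cong') auto
    thus ?thesis using False by (simp add: indexed_pmult_def finsum_zero)
  next
    case True
    then obtain m' where m: "m = add_mset i m'" by (metis multi_member_split)
    have inj: "inj_on (add_mset i) {k. k \<subseteq># m'}" by (auto intro: inj_onI)
    have sub: "add_mset i ` {k. k \<subseteq># m'} \<subseteq> {k. k \<subseteq># m}" by (auto simp: m)
    have zero: "indexed_pmult P i k \<otimes> Q (m - k) = \<zero>"
      if "k \<in> {k. k \<subseteq># m} - add_mset i ` {k. k \<subseteq># m'}" for k
    proof (cases "i \<in># k")
      case True
      then obtain k' where "k = add_mset i k'" by (metis multi_member_split)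
      thus ?thesis using that by (auto simp: m)
    qed (use Q in \<open>simp add: indexed_pmult_def\<close>)
    have "conv (indexed_pmult P i) Q m =
        (\<Oplus>k\<in>add_mset i ` {k. k \<subseteq># m'}. indexed_pmult P i k \<otimes> Q (m - k))"
      unfolding conv_def
      by (rule add.finprod_mono_neutral_cong_right)
        (use sub zero cl Q finite_sub_multisets in auto)
    also have "\<dots> = (\<Oplus>k\<in>{k. k \<subseteq># m'}. indexed_pmult P i (add_mset i k) \<otimes> Q (m - add_mset i k))"
      using cl Q inj by (intro finsum_reindex) auto
    also have "\<dots> = (\<Oplus>k\<in>{k. k \<subseteq># m'}. P k \<otimes> Q (m' - k))"
      using P Q by (intro finsum_cong') (auto simp: indexed_pmult_def m)
    finally show ?thesis by (simp add: conv_def indexed_pmult_def m)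
  qed
qed

lemma conv_assoc:
  assumes "P \<in> indexed_pset I (carrier R)" and Q: "\<And>m. Q m \<in> carrier R" and S: "\<And>m. S m \<in> carrier R"
  shows "conv (conv P Q) S = conv P (conv Q S)"
  using assms(1)
proof (induction P)
  case (indexed_const c)
  show ?case
  proof
    fix m
    have "conv (conv (indexed_const c) Q) S m = (\<Oplus>k\<in>{k. k \<subseteq># m}. c \<otimes> (Q k \<otimes> S (m - k)))"
      unfolding conv_const[OF indexed_const Q] unfolding conv_def
      using indexed_const Q S by (intro finsum_cong') (auto simp: m_assoc)
    also have "\<dots> = c \<otimes> conv Q S m"
      unfolding conv_def using indexed_const Q S finite_sub_multisets
      by (subst finsum_rdistr) auto
    finally show "conv (conv (indexed_const c) Q) S m = conv (indexed_const c) (conv Q S) m"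
      using indexed_const Q S by (simp add: conv_const conv_closed_coeff)
  qed
next
  case (indexed_padd P P')
  note cl = coeff_closed[OF indexed_padd(1)] coeff_closed[OF indexed_padd(2)]
  show ?case
    by (simp add: conv_add_left cl Q S conv_closed_coeff indexed_padd.IH)
next
  case (indexed_pmult P i)
  note cl = coeff_closed[OF indexed_pmult(1)]
  show ?case
    by (simp add: conv_pmult_left cl Q S conv_closed_coeff indexed_pmult.IH)
qed

lemma conv_closed:
  fixes P Q :: "'c multiset \<Rightarrow> 'a"
  assumes "P \<in> indexed_pset I (carrier R)" "Q \<in> indexed_pset I (carrier R)"
  shows "conv P Q \<in> indexed_pset I (carrier R)"
  using assms(1)
proof (induction P)
  case (indexed_const c)
  from assms(2) show ?case
  proof (induction Q)
    case (indexed_const d)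
    have "conv (indexed_const c) (indexed_const d) = (indexed_const (c \<otimes> d) :: 'c multiset \<Rightarrow> 'a)"
      using indexed_const \<open>c \<in> carrier R\<close>
      by (subst conv_const) (auto simp: indexed_const_def fun_eq_iff)
    thus ?case using indexed_const \<open>c \<in> carrier R\<close> by (auto intro: indexed_pset.indexed_const)
  next
    case (indexed_padd P Q)
    have "conv (indexed_const c) (indexed_padd P Q) =
        indexed_padd (conv (indexed_const c) P) (conv (indexed_const c) Q)"
      using coeff_closed[OF indexed_padd(1)] coeff_closed[OF indexed_padd(2)] \<open>c \<in> carrier R\<close>
      by (simp add: conv_const indexed_padd_def fun_eq_iff r_distr)
    thus ?case using indexed_padd.IH by (simp add: indexed_pset.indexed_padd)
  next
    case (indexed_pmult P i)
    have "conv (indexed_const c) (indexed_pmult P i) = indexed_pmult (conv (indexed_const c) P) i"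
      using coeff_closed[OF indexed_pmult(1)] \<open>c \<in> carrier R\<close>
      by (subst (1 2) conv_const) (auto simp: indexed_pmult_def fun_eq_iff)
    thus ?case using indexed_pmult by (simp add: indexed_pset.indexed_pmult)
  qed
next
  case (indexed_padd P P')
  thus ?case
    by (subst conv_add_left)
      (auto intro: indexed_pset.indexed_padd coeff_closed[OF indexed_padd(1)]
        coeff_closed[OF indexed_padd(2)] coeff_closed[OF assms(2)])
next
  case (indexed_pmult P i)
  thus ?case
    by (subst conv_pmult_left)
      (auto intro: indexed_pset.indexed_pmult coeff_closed[OF indexed_pmult(1)]
        coeff_closed[OF assms(2)])
qed

lemma cring_mpoly_ring: "cring (mpoly_ring R I)"
proof (rule cringI)
  let ?M = "mpoly_ring R I"
  note simps = mpoly_ring_simps[of I]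
  note cc = coeff_closed[of _ I]
  have zero: "indexed_const \<zero> \<in> indexed_pset I (carrier R)" by (rule indexed_pset.indexed_const) simp
  have neg: "conv (indexed_const (\<ominus> \<one>)) P \<in> indexed_pset I (carrier R)"
    if "P \<in> indexed_pset I (carrier R)" for P
    using that by (intro conv_closed indexed_pset.indexed_const) auto
  show "abelian_group ?M"
  proof (rule abelian_groupI)
    fix P assume "P \<in> carrier ?M"
    hence P: "P \<in> indexed_pset I (carrier R)" by (simp add: simps)
    have "indexed_padd (conv (indexed_const (\<ominus> \<one>)) P) P = indexed_const \<zero>"
      using cc[OF P] by (subst conv_const)
        (auto simp: indexed_padd_def indexed_const_def fun_eq_iff l_minus l_neg)
    thus "\<exists>Q\<in>carrier ?M. Q \<oplus>\<^bsub>?M\<^esub> P = \<zero>\<^bsub>?M\<^esub>" using neg[OF P] by (auto simp: simps)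
  next
    show "P \<oplus>\<^bsub>?M\<^esub> Q \<in> carrier ?M" if "P \<in> carrier ?M" "Q \<in> carrier ?M" for P Q
      using that by (auto simp: simps intro: indexed_pset.indexed_padd)
    show "\<zero>\<^bsub>?M\<^esub> \<in> carrier ?M" using zero by (simp add: simps)
    show "P \<oplus>\<^bsub>?M\<^esub> Q \<oplus>\<^bsub>?M\<^esub> S = P \<oplus>\<^bsub>?M\<^esub> (Q \<oplus>\<^bsub>?M\<^esub> S)"
      if "P \<in> carrier ?M" "Q \<in> carrier ?M" "S \<in> carrier ?M" for P Q S
      using that cc by (auto simp: simps indexed_padd_def fun_eq_iff a_assoc)
    show "P \<oplus>\<^bsub>?M\<^esub> Q = Q \<oplus>\<^bsub>?M\<^esub> P" if "P \<in> carrier ?M" "Q \<in> carrier ?M" for P Q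
      using that cc by (auto simp: simps indexed_padd_def fun_eq_iff a_comm)
    show "\<zero>\<^bsub>?M\<^esub> \<oplus>\<^bsub>?M\<^esub> P = P" if "P \<in> carrier ?M" for P
      using that cc by (auto simp: simps indexed_padd_def indexed_const_def fun_eq_iff)
  qed
  show "comm_monoid ?M"
  proof (rule comm_monoidI)
    show "P \<otimes>\<^bsub>?M\<^esub> Q \<in> carrier ?M" if "P \<in> carrier ?M" "Q \<in> carrier ?M" for P Q
      using that by (auto simp: simps intro: conv_closed)
    show "\<one>\<^bsub>?M\<^esub> \<in> carrier ?M" by (auto simp: simps intro: indexed_pset.indexed_const)
    show "P \<otimes>\<^bsub>?M\<^esub> Q \<otimes>\<^bsub>?M\<^esub> S = P \<otimes>\<^bsub>?M\<^esub> (Q \<otimes>\<^bsub>?M\<^esub> S)"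
      if "P \<in> carrier ?M" "Q \<in> carrier ?M" "S \<in> carrier ?M" for P Q S
      using that cc by (auto simp: simps intro!: conv_assoc)
    show "\<one>\<^bsub>?M\<^esub> \<otimes>\<^bsub>?M\<^esub> P = P" if "P \<in> carrier ?M" for P
      using that cc by (auto simp: simps conv_const)
    show "P \<otimes>\<^bsub>?M\<^esub> Q = Q \<otimes>\<^bsub>?M\<^esub> P" if "P \<in> carrier ?M" "Q \<in> carrier ?M" for P Q
      using that cc by (auto simp: simps intro!: conv_comm)
  qed
  show "(P \<oplus>\<^bsub>?M\<^esub> Q) \<otimes>\<^bsub>?M\<^esub> S = P \<otimes>\<^bsub>?M\<^esub> S \<oplus>\<^bsub>?M\<^esub> Q \<otimes>\<^bsub>?M\<^esub> S"
    if "P \<in> carrier ?M" "Q \<in> carrier ?M" "S \<in> carrier ?M" for P Q S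
    using that cc by (auto simp: simps intro!: conv_add_left)
qed

lemma mpoly_ring_uminus:
  assumes "P \<in> carrier (mpoly_ring R I)"
  shows "\<ominus>\<^bsub>mpoly_ring R I\<^esub> P = (\<lambda>m. \<ominus> P m)"
proof -
  interpret M: cring "mpoly_ring R I" by (rule cring_mpoly_ring)
  have P: "P \<in> indexed_pset I (carrier R)" using assms by (simp add: mpoly_ring_simps)
  note cc = coeff_closed[OF P]
  have eq: "conv (indexed_const (\<ominus> \<one>)) P = (\<lambda>m. \<ominus> P m)"
    using cc by (subst conv_const) (auto simp: l_minus)
  have "conv (indexed_const (\<ominus> \<one>)) P \<in> indexed_pset I (carrier R)"
    using P by (intro conv_closed indexed_pset.indexed_const) auto
  hence "(\<lambda>m. \<ominus> P m) \<in> carrier (mpoly_ring R I)" by (simp add: eq mpoly_ring_simps)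
  moreover have "(\<lambda>m. \<ominus> P m) \<oplus>\<^bsub>mpoly_ring R I\<^esub> P = \<zero>\<^bsub>mpoly_ring R I\<^esub>"
    using cc by (auto simp: mpoly_ring_simps indexed_padd_def indexed_const_def fun_eq_iff l_neg)
  ultimately show ?thesis using assms M.minus_equality by blast
qed

lemma indexed_var_closed: "i \<in> I \<Longrightarrow> indexed_var i \<in> carrier (mpoly_ring R I)"
  unfolding indexed_var_def mpoly_ring_simps
  by (intro indexed_pset.indexed_pmult indexed_pset.indexed_const) auto

lemma conv_var:
  assumes "\<And>m. Q m \<in> carrier R"
  shows "conv (indexed_var i) Q = indexed_pmult Q i"
proof -
  have "conv (indexed_const \<one>) Q = Q" using assms by (simp add: conv_const)
  thus ?thesis unfolding indexed_var_def using assms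
    by (subst conv_pmult_left) (auto simp: indexed_const_def)
qed

end

section \<open>Values of polynomial expressions\<close>

primrec term_val :: "('w, 'z) ring_scheme \<Rightarrow> ('v \<Rightarrow> 'w) \<Rightarrow> 'v ring_term \<Rightarrow> 'w" where
  "term_val G f (TVar v) = f v"
| "term_val G f TZero = \<zero>\<^bsub>G\<^esub>"
| "term_val G f TOne = \<one>\<^bsub>G\<^esub>"
| "term_val G f (TNeg s) = \<ominus>\<^bsub>G\<^esub> term_val G f s"
| "term_val G f (TAdd s t) = term_val G f s \<oplus>\<^bsub>G\<^esub> term_val G f t"
| "term_val G f (TMult s t) = term_val G f s \<otimes>\<^bsub>G\<^esub> term_val G f t"

text \<open>The counterpart of \<open>feval\<close> for rings given by a record, whose laws hold on
  a carrier only. It goes through a representing term; \<open>term_val_cong\<close> makes the choice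
  immaterial when \<open>f\<close> takes values in the carrier of a commutative ring.\<close>

definition fval :: "('w, 'z) ring_scheme \<Rightarrow> ('v \<Rightarrow> 'w) \<Rightarrow> 'v free_ring \<Rightarrow> 'w" where
  "fval G f q = term_val G f (rep_free_ring q)"

context cring
begin

lemma term_val_closed: "range f \<subseteq> carrier R \<Longrightarrow> term_val R f t \<in> carrier R"
  by (induction t) auto

lemma term_val_cong:
  assumes f: "range f \<subseteq> carrier R"
  shows "ring_term_eq s t \<Longrightarrow> term_val R f s = term_val R f t"
proof (induction rule: ring_term_eq.induct)
  case (distrib s t u)
  thus ?case using term_val_closed[OF f] by (simp add: l_distr)
qed (use term_val_closed[OF f] in \<open>auto simp: a_ac m_ac r_neg\<close>)

lemma fval_abs:
  assumes "range f \<subseteq> carrier R"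
  shows "fval R f (abs_free_ring t) = term_val R f t"
proof -
  have "abs_free_ring (rep_free_ring (abs_free_ring t)) = abs_free_ring t"
    by (rule Quotient_abs_rep[OF Quotient_free_ring])
  hence "ring_term_eq (rep_free_ring (abs_free_ring t)) t" by (simp add: free_ring.abs_eq_iff)
  thus ?thesis unfolding fval_def by (rule term_val_cong[OF assms])
qed

lemma fval_hom:
  assumes f: "range f \<subseteq> carrier R"
  shows "fval R f q \<in> carrier R" "fval R f (fvar v) = f v" "fval R f 0 = \<zero>" "fval R f 1 = \<one>"
    "fval R f (- p) = \<ominus> fval R f p" "fval R f (p + q) = fval R f p \<oplus> fval R f q"
    "fval R f (p * q) = fval R f p \<otimes> fval R f q"
proof -
  obtain s t where p: "p = abs_free_ring s" and q: "q = abs_free_ring t"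
    by (rule that[of "rep_free_ring p" "rep_free_ring q"])
      (simp_all add: Quotient_abs_rep[OF Quotient_free_ring])
  show "fval R f q \<in> carrier R" unfolding fval_def by (rule term_val_closed[OF f])
  show "fval R f (fvar v) = f v" by (simp add: fvar.abs_eq fval_abs[OF f])
  show "fval R f 0 = \<zero>" by (simp add: zero_free_ring.abs_eq fval_abs[OF f])
  show "fval R f 1 = \<one>" by (simp add: one_free_ring.abs_eq fval_abs[OF f])
  show "fval R f (- p) = \<ominus> fval R f p" by (simp add: p uminus_free_ring.abs_eq fval_abs[OF f])
  show "fval R f (p + q) = fval R f p \<oplus> fval R f q"
    by (simp add: p q plus_free_ring.abs_eq fval_abs[OF f])
  show "fval R f (p * q) = fval R f p \<otimes> fval R f q"
    by (simp add: p q times_free_ring.abs_eq fval_abs[OF f])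
qed

text \<open>Symbols for elements outside the carrier are read as zero.\<close>

definition pval :: "'a pexp \<Rightarrow> nat multiset \<Rightarrow> 'a" where
  "pval = fval (mpoly_ring R UNIV)
     (case_sum (\<lambda>a. indexed_const (if a \<in> carrier R then a else \<zero>)) indexed_var)"

lemma pval_closed: "pval q \<in> carrier (mpoly_ring R UNIV)"
  and pval_cst: "pval (cst a) = indexed_const (if a \<in> carrier R then a else \<zero>)"
  and pval_pX: "pval (pX i) = indexed_var i"
  and pval_0: "pval 0 = indexed_const \<zero>"
  and pval_1: "pval 1 = indexed_const \<one>"
  and pval_uminus_ring: "pval (- p) = \<ominus>\<^bsub>mpoly_ring R UNIV\<^esub> pval p"
  and pval_add_ring: "pval (p + q) = pval p \<oplus>\<^bsub>mpoly_ring R UNIV\<^esub> pval q"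
  and pval_mult_ring: "pval (p * q) = pval p \<otimes>\<^bsub>mpoly_ring R UNIV\<^esub> pval q"
proof -
  interpret M: cring "mpoly_ring R UNIV :: (nat multiset \<Rightarrow> 'a) ring" by (rule cring_mpoly_ring)
  have "case_sum (\<lambda>a. indexed_const (if a \<in> carrier R then a else \<zero>)) indexed_var v
      \<in> carrier (mpoly_ring R (UNIV :: nat set))" for v
  proof (cases v)
    case (Inl a)
    thus ?thesis by (simp add: mpoly_ring_simps indexed_pset.indexed_const)
  next
    case (Inr i)
    thus ?thesis by (simp add: indexed_var_closed)
  qed
  hence "range (case_sum (\<lambda>a. indexed_const (if a \<in> carrier R then a else \<zero>)) indexed_var)
      \<subseteq> carrier (mpoly_ring R (UNIV :: nat set))"
    by blast
  note hom = M.fval_hom[OF this]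
  show "pval q \<in> carrier (mpoly_ring R UNIV)" unfolding pval_def by (rule hom(1))
  show "pval (cst a) = indexed_const (if a \<in> carrier R then a else \<zero>)"
    "pval (pX i) = indexed_var i" "pval 0 = indexed_const \<zero>" "pval 1 = indexed_const \<one>"
    "pval (- p) = \<ominus>\<^bsub>mpoly_ring R UNIV\<^esub> pval p"
    "pval (p + q) = pval p \<oplus>\<^bsub>mpoly_ring R UNIV\<^esub> pval q"
    "pval (p * q) = pval p \<otimes>\<^bsub>mpoly_ring R UNIV\<^esub> pval q"
    unfolding pval_def cst_def pX_def by (simp_all add: hom mpoly_ring_simps)
qed

lemma pval_coeff [simp]: "pval q m \<in> carrier R"
  using pval_closed[of q] coeff_closed by (simp add: mpoly_ring_simps)

lemma pval_zero_coeff [simp]: "pval 0 m = \<zero>"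
  by (simp add: pval_0 indexed_const_def)

lemma pval_add: "pval (p + q) m = pval p m \<oplus> pval q m"
  by (simp add: pval_add_ring mpoly_ring_simps indexed_padd_def)

lemma pval_uminus: "pval (- p) m = \<ominus> pval p m"
  by (simp add: pval_uminus_ring mpoly_ring_uminus pval_closed)

lemma pval_diff: "pval (p - q) m = pval p m \<ominus> pval q m"
  using pval_add[of p "- q" m] by (simp add: pval_uminus a_minus_def)

lemma pval_mult: "pval (p * q) = conv (pval p) (pval q)"
  by (simp add: pval_mult_ring mpoly_ring_simps)

lemma pval_cst_mult: "pval (cst a * q) m = (if a \<in> carrier R then a else \<zero>) \<otimes> pval q m"
  unfolding pval_mult pval_cst by (subst conv_const) auto

lemma pval_pX_mult: "pval (pX i * q) = indexed_pmult (pval q) i"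
  unfolding pval_mult pval_pX by (rule conv_var) simp

lemma pval_pX_mult_coeff: "pval (pX i * q) (add_mset i m) = pval q m"
  by (simp add: pval_pX_mult indexed_pmult_def)

lemma pval_cst_coeff: "pval (cst a) m = (if m = {#} \<and> a \<in> carrier R then a else \<zero>)"
  by (simp add: pval_cst indexed_const_def)


section \<open>Extension of ideals to polynomials\<close>

text \<open>The ideal I R[X], pulled back along \<open>pval\<close> to expressions. For I = 0 it is
  the kernel of \<open>pval\<close>, so congruence modulo \<open>ext {\<zero>}\<close> is equality
  of polynomials.\<close>

definition ext :: "'a set \<Rightarrow> 'a pexp set" where
  "ext I = {q. \<forall>m. pval q m \<in> I}"

lemma ext_mono: "I \<subseteq> I' \<Longrightarrow> ext I \<subseteq> ext I'"
  by (auto simp: ext_def)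

lemma cst_mem_ext:
  assumes "ideal I R" "a \<in> carrier R"
  shows "cst a \<in> ext I \<longleftrightarrow> a \<in> I"
  using assms additive_subgroup.zero_closed[OF ideal.axioms(1)[OF assms(1)]]
  by (auto simp: ext_def pval_cst_coeff)

lemma ext_mod_ideal:
  assumes "ideal I R"
  shows "mod_ideal (ext I)"
proof -
  interpret I: ideal I R by fact
  have add: "p + q \<in> ext I" if "p \<in> ext I" "q \<in> ext I" for p q
    using that by (auto simp: ext_def pval_add)
  have neg: "- p \<in> ext I" if "p \<in> ext I" for p
    using that by (auto simp: ext_def pval_uminus)
  have "q * p \<in> ext I" if "p \<in> ext I" for p q
    using that
  proof (induction q arbitrary: p rule: pexp_induct)
    case (cst a)
    thus ?case by (auto simp: ext_def pval_cst_mult I.I_l_closed)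
  next
    case (pX i)
    thus ?case by (auto simp: ext_def pval_pX_mult indexed_pmult_def)
  next
    case zero
    show ?case by (auto simp: ext_def)
  next
    case (add q q')
    thus ?case using \<open>\<And>p q. p \<in> ext I \<Longrightarrow> q \<in> ext I \<Longrightarrow> p + q \<in> ext I\<close>
      by (auto simp: distrib_right)
  qed (auto simp: mult.assoc neg)
  thus ?thesis using add by unfold_locales (auto simp: ext_def)
qed

section \<open>Expansion of expressions into monomials, and stability of extended ideals under
  substitution\<close>

definition monomial :: "nat multiset \<Rightarrow> 'a pexp" where
  "monomial m = (\<Prod>i\<in>#m. pX i)"

definition expansion :: "nat multiset set \<Rightarrow> 'a pexp \<Rightarrow> 'a pexp" where
  "expansion F q = (\<Sum>m\<in>F. cst (pval q m) * monomial m)"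

text \<open>That \<open>subst\<close> respects equality of the polynomials denoted is known only
  after \<open>subst_mem_ext\<close>. Quantifying over all substitutions builds this stability in;
  the relations between coefficient symbols satisfy it because \<open>subst\<close> fixes those
  symbols.\<close>

definition invariant_zero :: "'a pexp set" where
  "invariant_zero = {p. \<forall>x. subst x p \<in> ext {\<zero>}}"

lemma invariant_zero_mod_ideal: "mod_ideal invariant_zero"
proof -
  interpret Z: mod_ideal "ext {\<zero>}" by (rule ext_mod_ideal[OF zeroideal])
  show ?thesis by unfold_locales (auto simp: invariant_zero_def Z.zero_mem Z.add_mem Z.mult_mem)
qed

lemma invariant_zero_cst:
  "a \<in> carrier R \<Longrightarrow> b \<in> carrier R \<Longrightarrow> cst (a \<oplus> b) - (cst a + cst b) \<in> invariant_zero"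
  "a \<in> carrier R \<Longrightarrow> b \<in> carrier R \<Longrightarrow> cst (a \<otimes> b) - cst a * cst b \<in> invariant_zero"
  "a \<in> carrier R \<Longrightarrow> cst (\<ominus> a) - (- cst a) \<in> invariant_zero"
  "cst \<one> - 1 \<in> invariant_zero" "cst \<zero> \<in> invariant_zero" "a \<notin> carrier R \<Longrightarrow> cst a \<in> invariant_zero"
  by (auto simp: invariant_zero_def ext_def pval_diff pval_add pval_uminus pval_cst_mult
      pval_cst_coeff pval_1 indexed_const_def a_minus_def r_neg l_neg)

lemma invariant_zero_subset_ext:
  assumes "ideal I R" "p \<in> invariant_zero"
  shows "p \<in> ext I"
proof -
  have "subst pX p \<in> ext {\<zero>}" using assms(2) unfolding invariant_zero_def by blast
  thus ?thesis
    using ext_mono[of "{\<zero>}" I] additive_subgroup.zero_closed[OF ideal.axioms(1)[OF assms(1)]] by auto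
qed

lemma exists_expansion:
  "\<exists>F. finite F \<and> (\<forall>m. m \<notin> F \<longrightarrow> pval q m = \<zero>) \<and> q - expansion F q \<in> invariant_zero"
proof -
  interpret K: mod_ideal invariant_zero by (rule invariant_zero_mod_ideal)
  define G where "G q \<longleftrightarrow> (\<exists>F. finite F \<and> (\<forall>m. m \<notin> F \<longrightarrow> pval q m = \<zero>) \<and> K.cong q (expansion F q))" for q
  have enlarge: "K.cong (expansion F' q) (expansion F q)"
    if "finite F'" "F \<subseteq> F'" "\<forall>m. m \<notin> F \<longrightarrow> pval q m = \<zero>" for F F' q
  proof -
    have "expansion F' q = (\<Sum>m\<in>F' - F. cst (pval q m) * monomial m) + expansion F q"
      unfolding expansion_def using that by (intro sum.subset_diff) auto
    moreover have "K.cong (\<Sum>m\<in>F' - F. cst (pval q m) * monomial m) (\<Sum>m\<in>F' - F. 0)"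
      using that invariant_zero_cst(5)
      by (intro K.cong_sum) (auto simp: K.cong_0_iff intro: K.mult_mem')
    ultimately show ?thesis using K.cong_add[of _ 0, OF _ K.cong_refl] by simp
  qed
  have G_add: "G (p + q)" if pq: "G p" "G q" for p q
  proof -
    obtain F where F: "finite F" "\<forall>m. m \<notin> F \<longrightarrow> pval p m = \<zero>" "K.cong p (expansion F p)"
      using pq(1) unfolding G_def by auto
    obtain F' where F': "finite F'" "\<forall>m. m \<notin> F' \<longrightarrow> pval q m = \<zero>" "K.cong q (expansion F' q)"
      using pq(2) unfolding G_def by auto
    have "K.cong (p + q) (expansion (F \<union> F') p + expansion (F \<union> F') q)"
      using F F' by (intro K.cong_add K.cong_trans[OF F(3)] K.cong_trans[OF F'(3)] K.cong_sym[OF enlarge]) auto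
    also have "expansion (F \<union> F') p + expansion (F \<union> F') q =
        (\<Sum>m\<in>F \<union> F'. (cst (pval p m) + cst (pval q m)) * monomial m)"
      by (simp add: expansion_def sum.distrib ring_distribs)
    also have "K.cong \<dots> (expansion (F \<union> F') (p + q))"
      unfolding expansion_def pval_add
      by (intro K.cong_sum K.cong_mult K.cong_refl K.cong_sym[of "cst (_ \<oplus> _)"])
        (simp add: K.cong_def invariant_zero_cst)
    finally show ?thesis
      using F(1,2) F'(1,2) unfolding G_def by (intro exI[of _ "F \<union> F'"]) (auto simp: pval_add)
  qed
  have G_neg: "G (- q)" if Gq: "G q" for q
  proof -
    obtain F where F: "finite F" "\<forall>m. m \<notin> F \<longrightarrow> pval q m = \<zero>" "K.cong q (expansion F q)"
      using Gq unfolding G_def by auto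
    have "K.cong (- q) (- expansion F q)" by (intro K.cong_uminus F)
    also have "- expansion F q = (\<Sum>m\<in>F. (- cst (pval q m)) * monomial m)"
      by (simp add: expansion_def sum_negf)
    also have "K.cong \<dots> (expansion F (- q))"
      unfolding expansion_def pval_uminus
      by (intro K.cong_sum K.cong_mult K.cong_refl K.cong_sym[of "cst (\<ominus> _)"])
        (simp add: K.cong_def invariant_zero_cst del: diff_minus_eq_add)
    finally show ?thesis
      using F(1,2) unfolding G_def by (intro exI[of _ F]) (auto simp: pval_uminus)
  qed
  have G_cst: "G (cst a * q)" if Gq: "G q" for a q
  proof (cases "a \<in> carrier R")
    case True
    obtain F where F: "finite F" "\<forall>m. m \<notin> F \<longrightarrow> pval q m = \<zero>" "K.cong q (expansion F q)"
      using Gq unfolding G_def by auto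
    have "K.cong (cst a * q) (cst a * expansion F q)" by (intro K.cong_mult_left F)
    also have "cst a * expansion F q = (\<Sum>m\<in>F. (cst a * cst (pval q m)) * monomial m)"
      by (simp add: expansion_def sum_distrib_left mult.assoc)
    also have "K.cong \<dots> (expansion F (cst a * q))"
      unfolding expansion_def pval_cst_mult using True
      by (intro K.cong_sum K.cong_mult K.cong_refl K.cong_sym[of "cst (_ \<otimes> _)"])
        (simp add: K.cong_def invariant_zero_cst)
    finally show ?thesis
      using F(1,2) True unfolding G_def by (intro exI[of _ F]) (auto simp: pval_cst_mult)
  next
    case False
    hence "K.cong (cst a * q) (expansion {} (cst a * q))"
      using invariant_zero_cst(6) by (auto simp: expansion_def K.cong_0_iff intro: K.mult_mem')
    thus ?thesis using False unfolding G_def by (intro exI[of _ "{}"]) (auto simp: pval_cst_mult)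
  qed
  have G_pX: "G (pX i * q)" if Gq: "G q" for i q
  proof -
    obtain F where F: "finite F" "\<forall>m. m \<notin> F \<longrightarrow> pval q m = \<zero>" "K.cong q (expansion F q)"
      using Gq unfolding G_def by auto
    have "expansion (add_mset i ` F) (pX i * q) = pX i * expansion F q"
      unfolding expansion_def
      by (subst sum.reindex)
        (auto simp: pval_pX_mult_coeff monomial_def sum_distrib_left mult.left_commute intro: inj_onI)
    moreover have "pval (pX i * q) m = \<zero>" if "m \<notin> add_mset i ` F" for m
    proof (cases "i \<in># m")
      case True
      then obtain m' where m: "m = add_mset i m'" by (metis multi_member_split)
      thus ?thesis using F(2) that by (auto simp: pval_pX_mult_coeff)
    qed (simp add: pval_pX_mult indexed_pmult_def)
    moreover have "K.cong (pX i * q) (pX i * expansion F q)" by (intro K.cong_mult_left F)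
    ultimately show ?thesis using F(1) unfolding G_def by (intro exI[of _ "add_mset i ` F"]) auto
  qed
  have G_0: "G 0"
    unfolding G_def by (intro exI[of _ "{}"]) (auto simp: expansion_def)
  have G_1: "G 1"
  proof -
    have "K.cong (expansion {{#}} 1) 1"
      using invariant_zero_cst(4)
      by (simp add: expansion_def pval_1 indexed_const_def monomial_def K.cong_def)
    from K.cong_sym[OF this] show ?thesis
      unfolding G_def by (intro exI[of _ "{{#}}"]) (auto simp: pval_1 indexed_const_def)
  qed
  \<comment> \<open>Stating the claim for multiplication by \<open>p\<close> avoids the product of
    two expansions: at the leaves only a coefficient symbol or a single variable has to be
    multiplied.\<close>
  have "\<forall>g. G g \<longrightarrow> G (p * g)" for p
    by (induction p rule: pexp_induct) (auto simp: G_cst G_pX G_0 G_neg G_add distrib_right mult.assoc)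
  from this[of q] G_1 have "G q" by auto
  thus ?thesis unfolding G_def K.cong_def .
qed

text \<open>This is the universal property of the polynomial ring.\<close>

lemma subst_mem_ext:
  assumes I: "ideal I R" and q: "q \<in> ext I"
  shows "subst x q \<in> ext I"
proof -
  interpret E: mod_ideal "ext I" by (rule ext_mod_ideal[OF I])
  obtain F where F: "q - expansion F q \<in> invariant_zero" using exists_expansion by blast
  have "ext {\<zero>} \<subseteq> ext I"
    using additive_subgroup.zero_closed[OF ideal.axioms(1)[OF I]] by (intro ext_mono) auto
  hence 1: "E.cong (subst x q) (subst x (expansion F q))"
    using F by (auto simp: invariant_zero_def E.cong_def)
  have "cst (pval q m) \<in> ext I" for m using q cst_mem_ext[OF I] by (simp add: ext_def)
  hence "E.cong (\<Sum>m\<in>F. cst (pval q m) * subst x (monomial m)) (\<Sum>m\<in>F. 0)"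
    by (intro E.cong_sum) (auto simp: E.cong_0_iff intro: E.mult_mem')
  hence "E.cong (subst x (expansion F q)) 0" by (simp add: expansion_def)
  from E.cong_trans[OF 1 this] show ?thesis by (simp add: E.cong_0_iff)
qed

lemma pval_pX_power:
  assumes "count m l < r"
  shows "pval (pX l ^ r * w) m = \<zero>"
  using assms
proof (induction r arbitrary: m)
  case (Suc r)
  show ?case
  proof (cases "l \<in># m")
    case True
    then obtain m' where m: "m = add_mset l m'" by (metis multi_member_split)
    thus ?thesis using Suc by (simp add: mult.assoc pval_pX_mult_coeff)
  qed (simp add: mult.assoc pval_pX_mult indexed_pmult_def)
qed simp

lemma ext_poly_ideal:
  assumes I: "ideal I R"
  shows "poly_ideal (ext I)"
proof -
  interpret E: mod_ideal "ext I" by (rule ext_mod_ideal[OF I])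
  interpret I: ideal I R by fact
  show ?thesis
  proof
    show "subst x p \<in> ext I" if "p \<in> ext I" for x p using subst_mem_ext[OF I that] .
    show "p \<in> ext I" if "pX l * p \<in> ext I" for l p
      unfolding ext_def
    proof (intro CollectI allI)
      fix m
      have "pval (pX l * p) (add_mset l m) \<in> I" using that unfolding ext_def by blast
      thus "pval p m \<in> I" by (simp only: pval_pX_mult_coeff)
    qed
    show "p \<in> ext I" if p: "\<And>r. \<exists>w. p - pX l ^ r * w \<in> ext I" for l p
      unfolding ext_def
    proof (intro CollectI allI)
      fix m
      \<comment> \<open>An exponent one above that of X_l in m, so that the product has no
        coefficient at m.\<close>
      obtain w where "p - pX l ^ Suc (count m l) * w \<in> ext I" using p by blast
      hence "pval (p - pX l ^ Suc (count m l) * w) m \<in> I" unfolding ext_def by blast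
      moreover have "pval (pX l ^ Suc (count m l) * w) m = \<zero>" by (rule pval_pX_power) simp
      ultimately show "pval p m \<in> I" by (simp add: pval_diff a_minus_def)
    qed
  qed
qed

text \<open>Each coefficient is i + a r with i in I; the r are the coefficients of \<open>w\<close>.
  This allows a congruence modulo I + (a) to be divided by a.\<close>

lemma ext_add_principal:
  assumes I: "ideal I R" and a: "a \<in> carrier R"
    and I': "\<And>c. c \<in> I' \<Longrightarrow> \<exists>i\<in>I. \<exists>r\<in>carrier R. c = i \<oplus> a \<otimes> r"
    and q: "q \<in> ext I'"
  shows "\<exists>w. q - cst a * w \<in> ext I"
proof -
  interpret E: mod_ideal "ext I" by (rule ext_mod_ideal[OF I])
  interpret I: ideal I R by fact
  obtain F where F: "q - expansion F q \<in> invariant_zero" using exists_expansion by blast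
  have zero: "invariant_zero \<subseteq> ext I" using invariant_zero_subset_ext[OF I] by blast
  have "\<forall>m. \<exists>r. r \<in> carrier R \<and> (\<exists>i\<in>I. pval q m = i \<oplus> a \<otimes> r)"
    using q I' unfolding ext_def by blast
  from choice[OF this] obtain r where r: "\<And>m. r m \<in> carrier R"
    "\<And>m. \<exists>i\<in>I. pval q m = i \<oplus> a \<otimes> r m" by blast
  have term_cong: "E.cong (cst (pval q m)) (cst a * cst (r m))" for m
  proof -
    obtain i where i: "i \<in> I" "pval q m = i \<oplus> a \<otimes> r m" using r(2) by blast
    have "E.cong (cst (i \<oplus> a \<otimes> r m)) (cst i + cst (a \<otimes> r m))"
      using zero invariant_zero_cst(1) i(1) a r(1) unfolding E.cong_def by auto
    also have "E.cong \<dots> (0 + cst a * cst (r m))"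
    proof (rule E.cong_add)
      show "E.cong (cst i) 0" using cst_mem_ext[OF I] i(1) by (simp add: E.cong_0_iff)
      show "E.cong (cst (a \<otimes> r m)) (cst a * cst (r m))"
        using zero invariant_zero_cst(2) a r(1) unfolding E.cong_def by auto
    qed
    finally show ?thesis by (simp add: i(2))
  qed
  have "E.cong q (expansion F q)" using F zero by (auto simp: E.cong_def)
  also have "E.cong (expansion F q) (\<Sum>m\<in>F. (cst a * cst (r m)) * monomial m)"
    unfolding expansion_def by (intro E.cong_sum E.cong_mult E.cong_refl term_cong)
  also have "\<dots> = cst a * (\<Sum>m\<in>F. cst (r m) * monomial m)"
    by (simp add: sum_distrib_left mult.assoc)
  finally show ?thesis unfolding E.cong_def by blast
qed

lemma cst_cancel_ext:
  assumes "a \<in> carrier R" "\<And>b. b \<in> carrier R \<Longrightarrow> a \<otimes> b \<in> I \<Longrightarrow> b \<in> I" "cst a * q \<in> ext I"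
  shows "q \<in> ext I"
  using assms by (auto simp: ext_def pval_cst_mult)

end

section \<open>Prime ideals of a Noetherian ring\<close>

lemma (in noetherian_ring) ideal_noetherian_induct:
  assumes "ideal I R"
    and step: "\<And>I. ideal I R \<Longrightarrow> (\<And>K. ideal K R \<Longrightarrow> I \<subset> K \<Longrightarrow> Q K) \<Longrightarrow> Q I"
  shows "Q I"
proof (rule ccontr)
  assume "\<not> Q I"
  define C where "C = {I. ideal I R \<and> \<not> Q I}"
  have "\<exists>M\<in>C. \<forall>K\<in>C. M \<subseteq> K \<longrightarrow> K = M"
  proof (rule subset_Zorn)
    fix D assume D: "subset.chain C D"
    show "\<exists>U\<in>C. \<forall>K\<in>D. K \<subseteq> U"
    proof (cases "D = {}")
      case True
      thus ?thesis using assms(1) \<open>\<not> Q I\<close> by (auto simp: C_def)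
    next
      case False
      have "subset.chain {I. ideal I R} D" using D by (auto simp: subset.chain_def C_def)
      hence "\<Union>D \<in> D" by (rule ideal_chain_is_trivial[OF False])
      thus ?thesis using D by (auto simp: subset.chain_def)
    qed
  qed
  then obtain M where "ideal M R" "\<not> Q M" "\<And>K. ideal K R \<Longrightarrow> \<not> Q K \<Longrightarrow> M \<subseteq> K \<Longrightarrow> K = M"
    unfolding C_def by blast
  thus False using step[of M] by blast
qed

context cring
begin

definition adjoin :: "'a set \<Rightarrow> 'a \<Rightarrow> 'a set" where
  "adjoin I a = I <+> PIdl a"

lemma mem_adjoin:
  assumes "a \<in> carrier R"
  shows "c \<in> adjoin I a \<longleftrightarrow> (\<exists>i\<in>I. \<exists>r\<in>carrier R. c = i \<oplus> a \<otimes> r)"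
  using assms unfolding adjoin_def set_add_def' cgenideal_def by (auto simp: m_comm)

lemma adjoin_ideal: "ideal I R \<Longrightarrow> a \<in> carrier R \<Longrightarrow> ideal (adjoin I a) R"
  unfolding adjoin_def by (intro add_ideals cgenideal_ideal)

lemma adjoin_superset:
  assumes "ideal I R" "a \<in> carrier R"
  shows "I \<subseteq> adjoin I a" "a \<in> adjoin I a"
proof -
  interpret ideal I R by fact
  show "I \<subseteq> adjoin I a"
  proof
    fix i assume "i \<in> I"
    thus "i \<in> adjoin I a" using assms(2) unfolding mem_adjoin[OF assms(2)]
      by (intro bexI[of _ i] bexI[of _ \<zero>]) auto
  qed
  show "a \<in> adjoin I a" using assms(2) unfolding mem_adjoin[OF assms(2)]
    by (intro bexI[of _ \<zero>] bexI[of _ \<one>]) auto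
qed

lemma adjoin_least:
  assumes "ideal K R" "I \<subseteq> K" "a \<in> K"
  shows "adjoin I a \<subseteq> K"
proof -
  interpret ideal K R by fact
  have a: "a \<in> carrier R" using assms(3) by (rule a_Hcarr)
  show ?thesis
  proof
    fix c assume "c \<in> adjoin I a"
    then obtain i r where "i \<in> I" "r \<in> carrier R" "c = i \<oplus> a \<otimes> r" using mem_adjoin[OF a] by blast
    thus "c \<in> K" using assms(2,3) by (auto intro: additive_subgroup.a_closed[OF additive_subgroup_axioms] I_r_closed)
  qed
qed

text \<open>An ideal that is neither prime nor the whole ring contains a product of two elements
  outside it, and adjoining either of them gives a strictly larger ideal.\<close>

lemma prime_noetherian_induct:
  assumes noeth: "noetherian_ring R" and "ideal I R"
    and whole: "Q (carrier R)"
    and prime: "\<And>P. primeideal P R \<Longrightarrow> Q P"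
    and split: "\<And>I a b. ideal I R \<Longrightarrow> a \<in> carrier R \<Longrightarrow> b \<in> carrier R \<Longrightarrow> a \<notin> I \<Longrightarrow> b \<notin> I \<Longrightarrow>
      a \<otimes> b \<in> I \<Longrightarrow> Q (adjoin I a) \<Longrightarrow> Q (adjoin I b) \<Longrightarrow> Q I"
  shows "Q I"
  using assms(2)
proof (rule noetherian_ring.ideal_noetherian_induct[OF noeth])
  fix I assume I: "ideal I R" and IH: "\<And>K. ideal K R \<Longrightarrow> I \<subset> K \<Longrightarrow> Q K"
  show "Q I"
  proof (cases "I = carrier R \<or> primeideal I R")
    case True thus ?thesis using whole prime by blast
  next
    case False
    hence "\<not> (\<forall>a\<in>carrier R. \<forall>b\<in>carrier R. a \<otimes> b \<in> I \<longrightarrow> a \<in> I \<or> b \<in> I)"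
      using primeidealI[OF I is_cring] by blast
    then obtain a b where ab: "a \<in> carrier R" "b \<in> carrier R" "a \<otimes> b \<in> I" "a \<notin> I" "b \<notin> I" by blast
    have "Q (adjoin I a)" "Q (adjoin I b)"
      using adjoin_superset[OF I ab(1)] adjoin_superset[OF I ab(2)] ab
      by (auto intro!: IH adjoin_ideal I)
    thus ?thesis using split[OF I] ab by blast
  qed
qed

lemma exists_prime_superset:
  assumes "noetherian_ring R" "ideal I R" "I \<noteq> carrier R"
  shows "\<exists>P. primeideal P R \<and> I \<subseteq> P"
proof -
  have "I = carrier R \<or> (\<exists>P. primeideal P R \<and> I \<subseteq> P)"
    using assms(1,2)
  proof (rule prime_noetherian_induct)
    fix I a b
    assume I: "ideal I R" and ab: "a \<in> carrier R" "b \<in> carrier R" "a \<notin> I" "b \<notin> I" "a \<otimes> b \<in> I"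
      and IH: "adjoin I a = carrier R \<or> (\<exists>P. primeideal P R \<and> adjoin I a \<subseteq> P)"
    interpret ideal I R by fact
    have "adjoin I a \<noteq> carrier R"
    proof
      assume "adjoin I a = carrier R"
      then obtain i r where ir: "i \<in> I" "r \<in> carrier R" "\<one> = i \<oplus> a \<otimes> r"
        using mem_adjoin[OF ab(1), of \<one> I] by auto
      have "b = \<one> \<otimes> b" using ab by simp
      also have "\<dots> = (i \<oplus> a \<otimes> r) \<otimes> b" by (simp only: ir(3))
      also have "\<dots> = i \<otimes> b \<oplus> (a \<otimes> b) \<otimes> r" using ab ir(2) a_Hcarr[OF ir(1)]
        by (simp add: l_distr m_assoc m_comm[of r b])
      also have "\<dots> \<in> I"
        by (rule additive_subgroup.a_closed[OF additive_subgroup_axioms I_r_closed[OF ir(1) ab(2)]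
              I_r_closed[OF ab(5) ir(2)]])
      finally show False using ab by blast
    qed
    then obtain P where "primeideal P R" "adjoin I a \<subseteq> P" using IH by blast
    thus "I = carrier R \<or> (\<exists>P. primeideal P R \<and> I \<subseteq> P)"
      using adjoin_superset(1)[OF I ab(1)] by blast
  qed auto
  thus ?thesis using assms(3) by blast
qed

definition prime_cover :: "'a set \<Rightarrow> 'a set set \<Rightarrow> bool" where
  "prime_cover I Ps \<longleftrightarrow> finite Ps \<and> (\<forall>p\<in>Ps. primeideal p R \<and> I \<subseteq> p) \<and>
    (\<forall>P. primeideal P R \<longrightarrow> I \<subseteq> P \<longrightarrow> (\<exists>p\<in>Ps. p \<subseteq> P))"

text \<open>A prime over I contains a b, hence a or b, so covers of I + (a) and of I + (b) together
  cover I.\<close>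

lemma exists_prime_cover:
  assumes "noetherian_ring R" "ideal I R"
  shows "\<exists>Ps. prime_cover I Ps"
  using assms
proof (rule prime_noetherian_induct)
  have "\<not> carrier R \<subseteq> P" if P: "primeideal P R" for P
    using primeideal.I_notcarr[OF P] additive_subgroup.a_subset[OF ideal.axioms(1)[OF primeideal.axioms(1)[OF P]]]
    by blast
  thus "\<exists>Ps. prime_cover (carrier R) Ps"
    by (intro exI[of _ "{}"]) (auto simp: prime_cover_def)
next
  show "\<exists>Ps. prime_cover P Ps" if "primeideal P R" for P
    using that by (intro exI[of _ "{P}"]) (auto simp: prime_cover_def)
next
  fix I a b
  assume I: "ideal I R" and ab: "a \<in> carrier R" "b \<in> carrier R" "a \<otimes> b \<in> I"
    and IH: "\<exists>Ps. prime_cover (adjoin I a) Ps" "\<exists>Ps. prime_cover (adjoin I b) Ps"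
  obtain Ps where Ps: "finite Ps" "\<forall>p\<in>Ps. primeideal p R \<and> adjoin I a \<subseteq> p"
    "\<And>P. primeideal P R \<Longrightarrow> adjoin I a \<subseteq> P \<Longrightarrow> \<exists>p\<in>Ps. p \<subseteq> P"
    using IH(1) unfolding prime_cover_def by blast
  obtain Ps' where Ps': "finite Ps'" "\<forall>p\<in>Ps'. primeideal p R \<and> adjoin I b \<subseteq> p"
    "\<And>P. primeideal P R \<Longrightarrow> adjoin I b \<subseteq> P \<Longrightarrow> \<exists>p\<in>Ps'. p \<subseteq> P"
    using IH(2) unfolding prime_cover_def by blast
  have cover: "\<exists>p\<in>Ps \<union> Ps'. p \<subseteq> P" if P: "primeideal P R" "I \<subseteq> P" for P
  proof -
    interpret primeideal P R by fact
    have "a \<in> P \<or> b \<in> P" using ab P(2) I_prime by blast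
    thus ?thesis
      using Ps(3)[OF P(1)] Ps'(3)[OF P(1)] adjoin_least[OF is_ideal P(2)] by blast
  qed
  show "\<exists>Ps. prime_cover I Ps"
    unfolding prime_cover_def
  proof (intro exI[of _ "Ps \<union> Ps'"] conjI ballI allI impI)
    show "finite (Ps \<union> Ps')" using Ps(1) Ps'(1) by simp
    fix p assume p: "p \<in> Ps \<union> Ps'"
    show "primeideal p R" using p Ps(2) Ps'(2) by auto
    have "adjoin I a \<subseteq> p \<or> adjoin I b \<subseteq> p" using p Ps(2) Ps'(2) by auto
    thus "I \<subseteq> p" using adjoin_superset(1)[OF I ab(1)] adjoin_superset(1)[OF I ab(2)] by auto
  qed (rule cover)
qed

lemma finite_minimal_primes:
  assumes "noetherian_ring R" "ideal I R"
  obtains Ps where "finite Ps" "\<And>p. p \<in> Ps \<Longrightarrow> primeideal p R" "\<And>p. p \<in> Ps \<Longrightarrow> I \<subseteq> p"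
    "\<And>P. primeideal P R \<Longrightarrow> I \<subseteq> P \<Longrightarrow> \<exists>p\<in>Ps. p \<subseteq> P"
    "\<And>p q. p \<in> Ps \<Longrightarrow> q \<in> Ps \<Longrightarrow> p \<subseteq> q \<Longrightarrow> p = q"
proof -
  obtain Ps where Ps: "finite Ps" "\<And>p. p \<in> Ps \<Longrightarrow> primeideal p R \<and> I \<subseteq> p"
    "\<And>P. primeideal P R \<Longrightarrow> I \<subseteq> P \<Longrightarrow> \<exists>p\<in>Ps. p \<subseteq> P"
    using exists_prime_cover[OF assms] unfolding prime_cover_def by blast
  define Ms where "Ms = {p \<in> Ps. \<forall>q\<in>Ps. q \<subseteq> p \<longrightarrow> q = p}"
  show ?thesis
  proof
    show "\<exists>p\<in>Ms. p \<subseteq> P" if P: "primeideal P R" "I \<subseteq> P" for P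
    proof -
      obtain p where p: "p \<in> Ps" "p \<subseteq> P" using Ps(3)[OF P] by blast
      obtain m where "m \<in> Ps" "m \<subseteq> p" "\<forall>q\<in>Ps. q \<subseteq> m \<longrightarrow> m = q"
        using finite_has_minimal2[OF Ps(1) p(1)] by blast
      thus ?thesis using p(2) unfolding Ms_def by blast
    qed
  qed (use Ps(1,2) in \<open>auto simp: Ms_def\<close>)
qed

text \<open>A product with one factor taken from each q outside p; it stays outside p by
  primality.\<close>

lemma prime_avoidance_witness:
  assumes "finite Qs" and p: "primeideal p R"
    and "\<And>q. q \<in> Qs \<Longrightarrow> ideal q R \<and> \<not> q \<subseteq> p"
  shows "\<exists>e\<in>carrier R. e \<notin> p \<and> (\<forall>q\<in>Qs. e \<in> q)"
  using assms(1,3)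
proof (induction Qs)
  case empty
  interpret primeideal p R by fact
  have "\<one> \<notin> p" using primeideal.I_notcarr[OF p] one_imp_carrier by blast
  thus ?case by blast
next
  case (insert q Qs)
  then obtain e where e: "e \<in> carrier R" "e \<notin> p" "\<forall>q\<in>Qs. e \<in> q" by blast
  have q: "ideal q R" using insert.prems by blast
  obtain a where a: "a \<in> q" "a \<notin> p" using insert.prems by blast
  have ac: "a \<in> carrier R" using ideal.Icarr[OF q a(1)] .
  have "e \<otimes> a \<notin> p" using primeideal.I_prime[OF p e(1) ac] e(2) a(2) by blast
  moreover have "e \<otimes> a \<in> q'" if "q' \<in> insert q Qs" for q'
  proof (cases "q' = q")
    case True thus ?thesis using ideal.I_l_closed[OF q a(1) e(1)] by simp
  next
    case False
    hence "q' \<in> Qs" using that by blast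
    thus ?thesis using ideal.I_r_closed[of q' R e a] insert.prems e(3) ac by blast
  qed
  ultimately show ?case using e(1) ac by (intro bexI[of _ "e \<otimes> a"]) auto
qed


section \<open>Generation modulo prime ideals\<close>

text \<open>If \<open>b\<close> generates modulo two ideals, then it generates modulo their product.\<close>

lemma generates_mod_primes:
  assumes "noetherian_ring R" "ideal I R"
    and b: "\<And>i. subst (vcut N pX) (b i) = b i"
    and "\<And>P. primeideal P R \<Longrightarrow> I \<subseteq> P \<Longrightarrow> \<forall>i<N. \<exists>q. pX i - subst b q \<in> ext P"
  shows "\<forall>i<N. \<exists>q. pX i - subst b q \<in> ext I"
proof -
  have "(\<forall>P. primeideal P R \<longrightarrow> I \<subseteq> P \<longrightarrow> (\<forall>i<N. \<exists>q. pX i - subst b q \<in> ext P)) \<longrightarrow>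
      (\<forall>i<N. \<exists>q. pX i - subst b q \<in> ext I)"
    using assms(1,2)
  proof (rule prime_noetherian_induct)
    show "(\<forall>P. primeideal P R \<longrightarrow> carrier R \<subseteq> P \<longrightarrow> (\<forall>i<N. \<exists>q. pX i - subst b q \<in> ext P)) \<longrightarrow>
      (\<forall>i<N. \<exists>q. pX i - subst b q \<in> ext (carrier R))"
      by (simp add: ext_def)
  next
    fix I r s
    let ?hyp = "\<lambda>I. \<forall>P. primeideal P R \<longrightarrow> I \<subseteq> P \<longrightarrow> (\<forall>i<N. \<exists>q. pX i - subst b q \<in> ext P)"
    let ?gen = "\<lambda>I. \<forall>i<N. \<exists>q. pX i - subst b q \<in> ext I"
    assume I: "ideal I R" and rs: "r \<in> carrier R" "s \<in> carrier R" "r \<otimes> s \<in> I"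
      and IH: "?hyp (adjoin I r) \<longrightarrow> ?gen (adjoin I r)" "?hyp (adjoin I s) \<longrightarrow> ?gen (adjoin I s)"
    show "?hyp I \<longrightarrow> ?gen I"
    proof (intro impI allI)
      fix i assume hyp: "?hyp I" and i: "i < N"
      have "?hyp (adjoin I r)" "?hyp (adjoin I s)"
        using hyp adjoin_superset(1)[OF I rs(1)] adjoin_superset(1)[OF I rs(2)] by (meson order_trans)+
      hence gen: "?gen (adjoin I r)" "?gen (adjoin I s)" using IH by blast+
      interpret E: poly_ideal "ext I" by (rule ext_poly_ideal[OF I])
      interpret E': poly_ideal "ext (adjoin I s)" by (rule ext_poly_ideal[OF adjoin_ideal[OF I rs(2)]])
      obtain q where q: "pX i - subst b q \<in> ext (adjoin I r)" using gen(1) i by blast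
      obtain w where w: "pX i - subst b q - cst r * w \<in> ext I"
        using ext_add_principal[OF I rs(1) _ q] mem_adjoin[OF rs(1)] by blast
      \<comment> \<open>Only variables below N are generated by \<open>b\<close> modulo I + (s), so
        \<open>w\<close> is cut down to these before it is rewritten through
        \<open>b\<close>.\<close>
      define w' where "w' = subst (vcut N pX) w"
      have w': "pX i - subst b q - cst r * w' \<in> ext I"
        using E.subst_mem[OF w, of "vcut N pX"] i by (simp add: subst_subst b w'_def)
      have "\<forall>j. \<exists>v. j < N \<longrightarrow> pX j - subst b v \<in> ext (adjoin I s)" using gen(2) by blast
      from choice[OF this] obtain v where v: "\<And>j. j < N \<Longrightarrow> pX j - subst b (v j) \<in> ext (adjoin I s)"
        by blast
      have "E'.cong (subst (vcut N pX) w) (subst (\<lambda>j. subst b (vcut N v j)) w)"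
      proof (rule E'.subst_cong_mod)
        fix j
        show "E'.cong (vcut N pX j) (subst b (vcut N v j))"
          using v[of j] by (cases "j < N") (simp_all add: E'.cong_def E'.zero_mem)
      qed
      hence "w' - subst b (subst (vcut N v) w) \<in> ext (adjoin I s)"
        by (simp add: w'_def E'.cong_def subst_subst)
      then obtain u where u: "w' - subst b (subst (vcut N v) w) - cst s * u \<in> ext I"
        using ext_add_principal[OF I rs(2)] mem_adjoin[OF rs(2)] by blast
      have "cst (r \<otimes> s) \<in> ext I" using cst_mem_ext[OF I] rs by simp
      moreover have "cst (r \<otimes> s) - cst r * cst s \<in> ext I"
        using invariant_zero_subset_ext[OF I invariant_zero_cst(2)] rs by blast
      ultimately have rs_mem: "cst r * cst s \<in> ext I" using E.diff_mem by fastforce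
      \<comment> \<open>q(b) is off by r w', and w' in turn by s u after the correction; what
        remains is r s u, and r s lies in I.\<close>
      have "pX i - subst b (q + cst r * subst (vcut N v) w) =
          (pX i - subst b q - cst r * w') + cst r * (w' - subst b (subst (vcut N v) w) - cst s * u)
          + cst r * cst s * u"
        by (simp add: algebra_simps)
      also have "\<dots> \<in> ext I" by (intro E.add_mem E.mult_mem E.mult_mem' w' u rs_mem)
      finally show "\<exists>q. pX i - subst b q \<in> ext I" by blast
    qed
  qed blast
  thus ?thesis using assms(4) by blast
qed

end

lemma vcut_fixed_mono:
  assumes "subst (vcut n pX) f = f" "n \<le> N"
  shows "subst (vcut N pX) f = f"
proof -
  have "(\<lambda>i. subst (vcut N pX) (vcut n pX i)) = vcut n (pX :: nat \<Rightarrow> 'a pexp)"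
    using assms(2) by (auto simp: vcut_def)
  hence "subst (vcut N pX) (subst (vcut n pX) f) = subst (vcut n pX) f" by (simp only: subst_subst)
  thus ?thesis by (simp only: assms(1))
qed

context cring
begin

section \<open>Clearing denominators, and gluing over the minimal primes\<close>

lemma cst_power: "e \<in> carrier R \<Longrightarrow> cst (e [^] (D::nat)) - cst e ^ D \<in> invariant_zero"
proof (induction D)
  case 0
  show ?case using invariant_zero_cst(4) by simp
next
  case (Suc D)
  interpret K: mod_ideal invariant_zero by (rule invariant_zero_mod_ideal)
  have "K.cong (cst (e [^] D \<otimes> e)) (cst (e [^] D) * cst e)"
    using invariant_zero_cst(2) Suc.prems unfolding K.cong_def by blast
  also have "K.cong \<dots> (cst e ^ D * cst e)"
    using Suc by (intro K.cong_mult K.cong_refl) (simp add: K.cong_def)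
  finally show ?case by (simp add: K.cong_def mult.commute)
qed

text \<open>\<open>f\<close> is a coordinate over the residue field of \<open>p\<close>, after clearing denominators.\<close>

definition coordinate_at :: "'a set \<Rightarrow> nat \<Rightarrow> 'a pexp \<Rightarrow> bool" where
  "coordinate_at p n f \<longleftrightarrow> (\<exists>\<phi>. \<phi> 0 = f \<and>
     (\<forall>i<n. \<exists>s\<in>carrier R - p. \<exists>q. cst s * pX i - subst (vcut n \<phi>) q \<in> ext p))"

text \<open>Multiplying every generator except the zeroth by e changes the denominator by a power of
  e only, which is again outside p. This is exactly what gluing does to the system at p, where f
  itself must not be multiplied.\<close>

lemma scale_denominator:
  assumes p: "primeideal p R" and n: "n \<ge> 1" and e: "e \<in> carrier R - p"
    and s: "s \<in> carrier R - p" and q: "cst s * pX i - subst (vcut n \<phi>) q \<in> ext p"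
    and \<tau>: "\<tau> 0 - \<phi> 0 \<in> ext p" "\<And>j. 0 < j \<Longrightarrow> j < n \<Longrightarrow> \<tau> j - cst e * \<phi> j \<in> ext p"
  shows "\<exists>s\<in>carrier R - p. \<exists>q. cst s * pX i - subst (vcut n \<tau>) q \<in> ext p"
proof -
  interpret p: primeideal p R by fact
  interpret E: poly_ideal "ext p" by (rule ext_poly_ideal[OF p.is_ideal])
  obtain D q' where q': "\<And>x. cst e ^ D * subst x q = subst (\<lambda>i. if i = 0 then x 0 else cst e * x i) q'"
    using subst_homogenize[of e q] by blast
  have eD: "e [^] D \<in> carrier R - p"
  proof (induction D)
    case 0
    have "\<one> \<notin> p" using p.I_notcarr p.one_imp_carrier by blast
    thus ?case by simp
  next
    case (Suc D)
    thus ?case using e p.I_prime[of "e [^] D" e] by auto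
  qed
  have s': "e [^] D \<otimes> s \<in> carrier R - p" using eD s p.I_prime[of "e [^] D" s] by auto
  have "E.cong (cst (e [^] D \<otimes> s)) (cst (e [^] D) * cst s)"
    using invariant_zero_subset_ext[OF p.is_ideal invariant_zero_cst(2)] eD s by (simp add: E.cong_def)
  also have "E.cong \<dots> (cst e ^ D * cst s)"
    using invariant_zero_subset_ext[OF p.is_ideal cst_power] e
    by (intro E.cong_mult E.cong_refl) (simp add: E.cong_def)
  finally have "E.cong (cst (e [^] D \<otimes> s) * pX i) ((cst e ^ D * cst s) * pX i)"
    by (intro E.cong_mult E.cong_refl)
  also have "(cst e ^ D * cst s) * pX i = cst e ^ D * (cst s * pX i)" by (simp add: mult.assoc)
  also have "E.cong \<dots> (cst e ^ D * subst (vcut n \<phi>) q)"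
    using q by (intro E.cong_mult_left) (simp add: E.cong_def)
  also have "cst e ^ D * subst (vcut n \<phi>) q =
      subst (\<lambda>i. if i = 0 then vcut n \<phi> 0 else cst e * vcut n \<phi> i) q'" by (rule q')
  also have "E.cong \<dots> (subst (vcut n \<tau>) q')"
  proof (rule E.subst_cong_mod, rule E.cong_sym)
    fix j
    show "E.cong (vcut n \<tau> j) (if j = 0 then vcut n \<phi> 0 else cst e * vcut n \<phi> j)"
      using \<tau>(1) \<tau>(2)[of j] n by (cases "j < n") (auto simp: E.cong_def E.zero_mem)
  qed
  finally have "cst (e [^] D \<otimes> s) * pX i - subst (vcut n \<tau>) q' \<in> ext p" by (simp add: E.cong_def)
  thus ?thesis using s' by blast
qed

lemma common_denominator:
  assumes p: "primeideal p R"
    and "\<And>i. i < n \<Longrightarrow> \<exists>s\<in>carrier R - p. \<exists>q. cst s * pX i - subst \<tau> q \<in> ext p"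
  shows "\<exists>s\<in>carrier R - p. \<forall>i<n. \<exists>q. cst s * pX i - subst \<tau> q \<in> ext p"
  using assms(2)
proof (induction n)
  case 0
  interpret p: primeideal p R by fact
  have "\<one> \<notin> p" using p.I_notcarr p.one_imp_carrier by blast
  thus ?case by auto
next
  case (Suc n)
  interpret p: primeideal p R by fact
  interpret E: poly_ideal "ext p" by (rule ext_poly_ideal[OF p.is_ideal])
  obtain s where s: "s \<in> carrier R - p" "\<And>i. i < n \<Longrightarrow> \<exists>q. cst s * pX i - subst \<tau> q \<in> ext p"
    using Suc.IH Suc.prems less_SucI by blast
  obtain t where t: "t \<in> carrier R - p" "\<exists>q. cst t * pX n - subst \<tau> q \<in> ext p"
    using Suc.prems by blast
  have st: "s \<otimes> t \<in> carrier R - p" using s(1) t(1) p.I_prime[of s t] by auto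
  have prod: "cst (s \<otimes> t) * x - cst s * cst t * x \<in> ext p" for x
    using E.mult_mem'[OF invariant_zero_subset_ext[OF p.is_ideal invariant_zero_cst(2)], of s t x] s(1) t(1)
    by (simp add: algebra_simps)
  have "\<exists>q. cst (s \<otimes> t) * pX i - subst \<tau> q \<in> ext p" if i: "i < Suc n" for i
  proof (cases "i = n")
    case True
    obtain q where q: "cst t * pX n - subst \<tau> q \<in> ext p" using t(2) by blast
    have "cst (s \<otimes> t) * pX n - subst \<tau> (cst s * q) =
        (cst (s \<otimes> t) * pX n - cst s * cst t * pX n) + cst s * (cst t * pX n - subst \<tau> q)"
      by (simp add: algebra_simps)
    also have "\<dots> \<in> ext p" by (intro E.add_mem E.mult_mem q prod)
    finally show ?thesis using True by blast
  next
    case False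
    hence "i < n" using i by simp
    then obtain q where q: "cst s * pX i - subst \<tau> q \<in> ext p" using s(2) by blast
    have "cst (s \<otimes> t) * pX i - subst \<tau> (cst t * q) =
        (cst (s \<otimes> t) * pX i - cst s * cst t * pX i) + cst t * (cst s * pX i - subst \<tau> q)"
      by (simp add: algebra_simps)
    also have "\<dots> \<in> ext p" by (intro E.add_mem E.mult_mem q prod)
    finally show ?thesis by blast
  qed
  thus ?case using st by blast
qed

text \<open>The common denominator arises as an expression in coefficient symbols, but has to be an
  actual element of R.\<close>

lemma sum_of_products_is_cst:
  assumes "finite A" "\<And>p. p \<in> A \<Longrightarrow> e p \<in> carrier R" "\<And>p. p \<in> A \<Longrightarrow> s p \<in> carrier R"
  shows "\<exists>c\<in>carrier R. cst c - (\<Sum>p\<in>A. cst (e p) * cst (s p)) \<in> invariant_zero"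
  using assms
proof (induction A)
  case empty
  show ?case using invariant_zero_cst(5) by auto
next
  case (insert p A)
  interpret K: mod_ideal invariant_zero by (rule invariant_zero_mod_ideal)
  obtain c where c: "c \<in> carrier R" "K.cong (cst c) (\<Sum>p\<in>A. cst (e p) * cst (s p))"
    using insert unfolding K.cong_def by auto
  have es: "e p \<in> carrier R" "s p \<in> carrier R" using insert.prems by auto
  have "K.cong (cst (e p \<otimes> s p \<oplus> c)) (cst (e p \<otimes> s p) + cst c)"
    using es c(1) invariant_zero_cst(1) by (simp add: K.cong_def)
  also have "K.cong \<dots> (cst (e p) * cst (s p) + (\<Sum>p\<in>A. cst (e p) * cst (s p)))"
    using es invariant_zero_cst(2) by (intro K.cong_add c(2)) (simp add: K.cong_def)
  finally show ?case
    using insert.hyps es c(1) by (intro bexI[of _ "e p \<otimes> s p \<oplus> c"]) (auto simp: K.cong_def)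
qed

text \<open>The coordinates over the residue fields of the minimal primes over \<open>I\<close> are glued by means
  of elements \<open>e\<^sub>p\<close> lying in all minimal primes other than \<open>p\<close>.\<close>

lemma exists_generic_coordinate:
  assumes noeth: "noetherian_ring R" and I: "ideal I R" and n: "n \<ge> 1"
    and coord: "\<And>p. primeideal p R \<Longrightarrow> coordinate_at p n f"
  obtains J c \<phi> P where "ideal J R" "I \<subseteq> J" "\<And>P. primeideal P R \<Longrightarrow> I \<subseteq> P \<Longrightarrow> J \<subseteq> P"
    "c \<in> carrier R" "\<And>b. b \<in> carrier R \<Longrightarrow> c \<otimes> b \<in> J \<Longrightarrow> b \<in> J"
    "\<And>P. primeideal P R \<Longrightarrow> I \<subseteq> P \<Longrightarrow> c \<in> P \<Longrightarrow> \<exists>p. primeideal p R \<and> I \<subseteq> p \<and> p \<subset> P"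
    "\<phi> 0 = f" "\<And>i. i < n \<Longrightarrow> cst c * pX i - subst (vcut n \<phi>) (P i) \<in> ext J"
proof -
  obtain Ps where Ps: "finite Ps" "\<And>p. p \<in> Ps \<Longrightarrow> primeideal p R" "\<And>p. p \<in> Ps \<Longrightarrow> I \<subseteq> p"
    "\<And>P. primeideal P R \<Longrightarrow> I \<subseteq> P \<Longrightarrow> \<exists>p\<in>Ps. p \<subseteq> P"
    "\<And>p q. p \<in> Ps \<Longrightarrow> q \<in> Ps \<Longrightarrow> p \<subseteq> q \<Longrightarrow> p = q"
    using finite_minimal_primes[OF noeth I] by blast
  have Ps_ideal: "ideal p R" if "p \<in> Ps" for p using Ps(2)[OF that] by (rule primeideal.axioms(1))
  have "\<exists>e. e \<in> carrier R \<and> e \<notin> p \<and> (\<forall>q\<in>Ps - {p}. e \<in> q)" if p: "p \<in> Ps" for p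
    using prime_avoidance_witness[of "Ps - {p}" p] Ps(1) Ps(2)[OF p] Ps_ideal Ps(5)[OF _ p] by blast
  hence "\<forall>p. \<exists>e. p \<in> Ps \<longrightarrow> e \<in> carrier R \<and> e \<notin> p \<and> (\<forall>q\<in>Ps - {p}. e \<in> q)" by blast
  from choice[OF this] obtain e where e: "\<And>p. p \<in> Ps \<Longrightarrow> e p \<in> carrier R" "\<And>p. p \<in> Ps \<Longrightarrow> e p \<notin> p"
    "\<And>p q. p \<in> Ps \<Longrightarrow> q \<in> Ps \<Longrightarrow> q \<noteq> p \<Longrightarrow> e p \<in> q" by blast
  have "\<forall>p. \<exists>\<phi>. p \<in> Ps \<longrightarrow> \<phi> 0 = f \<and>
     (\<forall>i<n. \<exists>s\<in>carrier R - p. \<exists>q. cst s * pX i - subst (vcut n \<phi>) q \<in> ext p)"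
    using coord Ps(2) unfolding coordinate_at_def by blast
  from choice[OF this] obtain S where S: "\<And>p. p \<in> Ps \<Longrightarrow> S p 0 = f"
    "\<And>p i. p \<in> Ps \<Longrightarrow> i < n \<Longrightarrow> \<exists>s\<in>carrier R - p. \<exists>q. cst s * pX i - subst (vcut n (S p)) q \<in> ext p"
    by blast
  \<comment> \<open>Modulo p only the summand of p survives, since the other multipliers lie in p.
    So \<tau> is there the system at p with all components but f multiplied by
    \<open>e p\<close>.\<close>
  define \<tau> where "\<tau> i = (if i = 0 then f else \<Sum>p\<in>Ps. cst (e p) * S p i)" for i
  have e_mem: "cst (e p) \<in> ext q" if "p \<in> Ps" "q \<in> Ps" "q \<noteq> p" for p q
    using cst_mem_ext[OF Ps_ideal[OF that(2)] e(1)[OF that(1)]] e(3)[OF that] by simp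
  have sum_cong: "(\<Sum>p'\<in>Ps. cst (e p') * x p') - cst (e p) * x p \<in> ext p" if p: "p \<in> Ps" for p x
  proof -
    interpret E: poly_ideal "ext p" by (rule ext_poly_ideal[OF Ps_ideal[OF p]])
    have "E.cong (\<Sum>p'\<in>Ps - {p}. cst (e p') * x p') (\<Sum>p'\<in>Ps - {p}. 0)"
      using e_mem p by (intro E.cong_sum) (auto simp: E.cong_0_iff intro: E.mult_mem')
    thus ?thesis using Ps(1) p by (simp add: sum.remove[OF Ps(1) p] E.cong_0_iff)
  qed
  have "\<exists>s\<in>carrier R - p. \<forall>i<n. \<exists>q. cst s * pX i - subst (vcut n \<tau>) q \<in> ext p" if p: "p \<in> Ps" for p
  proof (rule common_denominator[OF Ps(2)[OF p]])
    fix i assume i: "i < n"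
    obtain s q where sq: "s \<in> carrier R - p" "cst s * pX i - subst (vcut n (S p)) q \<in> ext p"
      using S(2)[OF p i] by blast
    have ep: "e p \<in> carrier R - p" using e(1,2)[OF p] by simp
    have "\<tau> 0 - S p 0 \<in> ext p"
      using mod_ideal.zero_mem[OF ext_mod_ideal[OF Ps_ideal[OF p]]] by (simp add: \<tau>_def S(1)[OF p])
    moreover have "\<tau> j - cst (e p) * S p j \<in> ext p" if "0 < j" for j
      using sum_cong[OF p, of "\<lambda>p. S p j"] that by (simp add: \<tau>_def)
    ultimately show "\<exists>s\<in>carrier R - p. \<exists>q. cst s * pX i - subst (vcut n \<tau>) q \<in> ext p"
      by (intro scale_denominator[OF Ps(2)[OF p] n ep sq])
  qed
  hence "\<forall>p. \<exists>s. p \<in> Ps \<longrightarrow> s \<in> carrier R - p \<and> (\<forall>i<n. \<exists>q. cst s * pX i - subst (vcut n \<tau>) q \<in> ext p)"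
    by blast
  from choice[OF this] obtain s where s: "\<And>p. p \<in> Ps \<Longrightarrow> s p \<in> carrier R" "\<And>p. p \<in> Ps \<Longrightarrow> s p \<notin> p"
    "\<And>p i. p \<in> Ps \<Longrightarrow> i < n \<Longrightarrow> \<exists>q. cst (s p) * pX i - subst (vcut n \<tau>) q \<in> ext p" by blast
  have "\<forall>y. \<exists>q. fst y \<in> Ps \<longrightarrow> snd y < n \<longrightarrow> cst (s (fst y)) * pX (snd y) - subst (vcut n \<tau>) q \<in> ext (fst y)"
    using s(3) by blast
  from choice[OF this] obtain Q where Q: "\<forall>y. fst y \<in> Ps \<longrightarrow> snd y < n \<longrightarrow>
      cst (s (fst y)) * pX (snd y) - subst (vcut n \<tau>) (Q y) \<in> ext (fst y)" by blast
  obtain c where c: "c \<in> carrier R" "cst c - (\<Sum>p\<in>Ps. cst (e p) * cst (s p)) \<in> invariant_zero"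
    using sum_of_products_is_cst[OF Ps(1), of e s] e(1) s(1) by blast
  \<comment> \<open>Modulo p the sum reduces to the product of \<open>e p\<close> and
    \<open>s p\<close>, both outside the prime p.\<close>
  have c_notin: "c \<notin> p" if p: "p \<in> Ps" for p
  proof
    assume "c \<in> p"
    interpret p: primeideal p R by (rule Ps(2)[OF p])
    interpret E: poly_ideal "ext p" by (rule ext_poly_ideal[OF p.is_ideal])
    have "E.cong (cst (e p \<otimes> s p)) (cst (e p) * cst (s p))"
      using invariant_zero_subset_ext[OF p.is_ideal invariant_zero_cst(2)] e(1)[OF p] s(1)[OF p]
      by (simp add: E.cong_def)
    also have "E.cong \<dots> (\<Sum>p\<in>Ps. cst (e p) * cst (s p))"
      using E.cong_sym sum_cong[OF p, of "\<lambda>p. cst (s p)"] by (simp add: E.cong_def)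
    also have "E.cong \<dots> (cst c)"
      using E.cong_sym invariant_zero_subset_ext[OF p.is_ideal c(2)] by (simp add: E.cong_def)
    also have "E.cong (cst c) 0" using \<open>c \<in> p\<close> cst_mem_ext[OF p.is_ideal c(1)] by (simp add: E.cong_0_iff)
    finally have "e p \<otimes> s p \<in> p"
      using cst_mem_ext[OF p.is_ideal, of "e p \<otimes> s p"] e(1)[OF p] s(1)[OF p] by (simp add: E.cong_0_iff)
    thus False using p.I_prime[OF e(1)[OF p] s(1)[OF p]] e(2)[OF p] s(2)[OF p] by blast
  qed
  \<comment> \<open>The radical of I. As \<open>c\<close> lies in no minimal prime, it is
    cancellable modulo \<open>J\<close>, and a prime over I that contains \<open>c\<close> is not
    minimal.\<close>
  define J where "J = {a \<in> carrier R. \<forall>p\<in>Ps. a \<in> p}"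
  have J: "ideal J R"
  proof (rule idealI[OF ring_axioms])
    show "subgroup J (add_monoid R)"
    proof (rule subgroup.intro)
      show "J \<subseteq> carrier (add_monoid R)" by (auto simp: J_def)
      show "x \<otimes>\<^bsub>add_monoid R\<^esub> y \<in> J" if "x \<in> J" "y \<in> J" for x y
        using that additive_subgroup.a_closed[OF ideal.axioms(1)[OF Ps_ideal]] by (auto simp: J_def)
      show "\<one>\<^bsub>add_monoid R\<^esub> \<in> J"
        using additive_subgroup.zero_closed[OF ideal.axioms(1)[OF Ps_ideal]] by (auto simp: J_def)
      show "inv\<^bsub>add_monoid R\<^esub> x \<in> J" if "x \<in> J" for x
        using that additive_subgroup.a_inv_closed[OF ideal.axioms(1)[OF Ps_ideal]]
        by (auto simp: J_def a_inv_def[symmetric])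
    qed
    show "x \<otimes> a \<in> J" "a \<otimes> x \<in> J" if "a \<in> J" "x \<in> carrier R" for a x
      using that ideal.I_l_closed[OF Ps_ideal] ideal.I_r_closed[OF Ps_ideal] by (auto simp: J_def)
  qed
  interpret EJ: poly_ideal "ext J" by (rule ext_poly_ideal[OF J])
  have mem_ext_J: "q \<in> ext J" if "\<And>p. p \<in> Ps \<Longrightarrow> q \<in> ext p" for q
    using that by (auto simp: ext_def J_def)
  define P where "P i = (\<Sum>p\<in>Ps. cst (e p) * Q (p, i))" for i
  show ?thesis
  proof
    show "ideal J R" by (rule J)
    show "I \<subseteq> J" using Ps(3) ideal.Icarr[OF I] by (auto simp: J_def)
    show "J \<subseteq> P" if "primeideal P R" "I \<subseteq> P" for P using Ps(4)[OF that] by (auto simp: J_def)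
    show "c \<in> carrier R" by (rule c)
    show "b \<in> J" if "b \<in> carrier R" "c \<otimes> b \<in> J" for b
      using that c_notin primeideal.I_prime[OF Ps(2) c(1)] by (auto simp: J_def)
    show "\<exists>p. primeideal p R \<and> I \<subseteq> p \<and> p \<subset> P" if P: "primeideal P R" "I \<subseteq> P" "c \<in> P" for P
      using Ps(4)[OF P(1,2)] Ps(2,3) c_notin P(3) by blast
    show "\<tau> 0 = f" by (simp add: \<tau>_def)
    fix i assume i: "i < n"
    have 1: "cst c * pX i - (\<Sum>p\<in>Ps. cst (e p) * cst (s p)) * pX i \<in> ext J"
      using EJ.mult_mem'[OF invariant_zero_subset_ext[OF J c(2)], of "pX i"]
      by (simp add: left_diff_distrib)
    \<comment> \<open>At p the bracket vanishes by the choice of \<open>Q\<close>; at every other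
      minimal prime the factor \<open>e p\<close> does.\<close>
    have 2: "cst (e p) * (cst (s p) * pX i - subst (vcut n \<tau>) (Q (p, i))) \<in> ext J" if p: "p \<in> Ps" for p
    proof (rule mem_ext_J)
      fix p' assume p': "p' \<in> Ps"
      interpret E: poly_ideal "ext p'" by (rule ext_poly_ideal[OF Ps_ideal[OF p']])
      show "cst (e p) * (cst (s p) * pX i - subst (vcut n \<tau>) (Q (p, i))) \<in> ext p'"
      proof (cases "p' = p")
        case True
        thus ?thesis using Q[rule_format, of "(p, i)"] p i by (intro E.mult_mem) simp
      next
        case False
        thus ?thesis by (intro E.mult_mem' e_mem p p')
      qed
    qed
    have "EJ.cong (\<Sum>p\<in>Ps. cst (e p) * (cst (s p) * pX i - subst (vcut n \<tau>) (Q (p, i)))) (\<Sum>p\<in>Ps. 0)"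
      using 2 by (intro EJ.cong_sum) (simp add: EJ.cong_0_iff)
    hence 3: "(\<Sum>p\<in>Ps. cst (e p) * (cst (s p) * pX i - subst (vcut n \<tau>) (Q (p, i)))) \<in> ext J"
      by (simp add: EJ.cong_0_iff)
    have "(\<Sum>p\<in>Ps. cst (e p) * (cst (s p) * pX i - subst (vcut n \<tau>) (Q (p, i)))) =
        (\<Sum>p\<in>Ps. cst (e p) * cst (s p)) * pX i - subst (vcut n \<tau>) (P i)"
      by (simp add: P_def right_diff_distrib sum_subtractf sum_distrib_right mult.assoc)
    with EJ.add_mem[OF 1 3] show "cst c * pX i - subst (vcut n \<tau>) (P i) \<in> ext J" by simp
  qed
qed

text \<open>Since J lies in every prime over I, generators modulo J generate modulo all these
  primes, and \<open>generates_mod_primes\<close> descends to I with the same generators. So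
  nilpotents cost no variables.\<close>

lemma gen_coordinate_lift:
  assumes noeth: "noetherian_ring R" and I: "ideal I R" and J: "ideal J R"
    and JP: "\<And>P. primeideal P R \<Longrightarrow> I \<subseteq> P \<Longrightarrow> J \<subseteq> P"
    and gen: "gen_coordinate (ext J) N f" and f: "subst (vcut N pX) f = f" and N: "N \<ge> 1"
  shows "gen_coordinate (ext I) N f"
proof -
  interpret EJ: poly_ideal "ext J" by (rule ext_poly_ideal[OF J])
  obtain b a where b: "b 0 = f" "\<And>i. subst (vcut N pX) (b i) = b i" "\<And>i. N \<le> i \<Longrightarrow> b i = 0"
    and a: "\<And>i. i < N \<Longrightarrow> EJ.cong (subst b (a i)) (pX i)"
    using EJ.gen_coordinate_reduced[OF gen f N] by blast
  have "\<forall>i<N. \<exists>q. pX i - subst b q \<in> ext I"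
  proof (rule generates_mod_primes[OF noeth I b(2)])
    fix P assume "primeideal P R" "I \<subseteq> P"
    hence "ext J \<subseteq> ext P" by (intro ext_mono JP)
    thus "\<forall>i<N. \<exists>q. pX i - subst b q \<in> ext P" using EJ.cong_sym[OF a] unfolding EJ.cong_def by blast
  qed
  thus ?thesis using b(1) vcut_id[OF b(3)] unfolding gen_coordinate_def by (intro exI[of _ b]) simp
qed

section \<open>Induction on the length of chains of primes\<close>

lemma prime_chain_Cons:
  assumes "prime_chain R l P" "primeideal p R" "p \<subset> P 0"
  shows "prime_chain R (Suc l) (case_nat p P)"
  using assms unfolding prime_chain_def by (auto split: nat.splits)

text \<open>Bounding the chains over I, instead of the dimension of a quotient, keeps the whole
  induction inside R. A chain over J + (c) can be prolonged at its bottom, because its first prime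
  contains c and so is not minimal over I.\<close>

lemma residual_gen_coordinate:
  assumes noeth: "noetherian_ring R" and n: "n \<ge> 1"
    and f: "subst (vcut n pX) f = f"
    and coord: "\<And>p. primeideal p R \<Longrightarrow> coordinate_at p n f"
  shows "ideal I R \<Longrightarrow> (\<And>l P. prime_chain R l P \<Longrightarrow> I \<subseteq> P 0 \<Longrightarrow> l \<le> d) \<Longrightarrow>
    gen_coordinate (ext I) (2 ^ d * n) f"
proof (induction d arbitrary: I)
  case 0
  note I = 0(1) and chain = 0(2)
  obtain J c \<phi> P where J: "ideal J R" "I \<subseteq> J" "\<And>P. primeideal P R \<Longrightarrow> I \<subseteq> P \<Longrightarrow> J \<subseteq> P"
    and c: "c \<in> carrier R" "\<And>b. b \<in> carrier R \<Longrightarrow> c \<otimes> b \<in> J \<Longrightarrow> b \<in> J"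
      "\<And>P. primeideal P R \<Longrightarrow> I \<subseteq> P \<Longrightarrow> c \<in> P \<Longrightarrow> \<exists>p. primeideal p R \<and> I \<subseteq> p \<and> p \<subset> P"
    and \<phi>: "\<phi> 0 = f" "\<And>i. i < n \<Longrightarrow> cst c * pX i - subst (vcut n \<phi>) (P i) \<in> ext J"
    by (rule exists_generic_coordinate[OF noeth I n coord]) (assumption | rule that | blast)+
  interpret EJ: poly_ideal "ext J" by (rule ext_poly_ideal[OF J(1)])
  \<comment> \<open>c is a unit modulo J: a prime over J + (c) would strictly contain another prime
    over I, a chain of length 1.\<close>
  have "adjoin J c = carrier R"
  proof (rule ccontr)
    assume "adjoin J c \<noteq> carrier R"
    from exists_prime_superset[OF noeth adjoin_ideal[OF J(1) c(1)] this]
    obtain P where P: "primeideal P R" "adjoin J c \<subseteq> P" by (elim exE conjE)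
    have IP: "I \<subseteq> P" using order_trans[OF J(2) order_trans[OF adjoin_superset(1)[OF J(1) c(1)] P(2)]] .
    have cP: "c \<in> P" using subsetD[OF P(2) adjoin_superset(2)[OF J(1) c(1)]] .
    from c(3)[OF P(1) IP cP] obtain p where p: "primeideal p R" "I \<subseteq> p" "p \<subset> P"
      by (elim exE conjE)
    have "prime_chain R 0 (\<lambda>_. P)" using P(1) by (simp add: prime_chain_def)
    from chain[OF prime_chain_Cons[OF this p(1)]] p show False by auto
  qed
  then obtain j r where jr: "j \<in> J" "r \<in> carrier R" "\<one> = j \<oplus> c \<otimes> r"
    using mem_adjoin[OF c(1), of \<one> J] by auto
  have jc: "j \<in> carrier R" using ideal.Icarr[OF J(1) jr(1)] .
  have "EJ.cong 1 (cst \<one>)"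
    using EJ.cong_sym invariant_zero_subset_ext[OF J(1) invariant_zero_cst(4)] by (simp add: EJ.cong_def)
  also have "cst \<one> = cst (j \<oplus> c \<otimes> r)" by (simp only: jr(3))
  also have "EJ.cong \<dots> (cst j + cst (c \<otimes> r))"
    using invariant_zero_subset_ext[OF J(1) invariant_zero_cst(1)] jc c(1) jr(2) by (simp add: EJ.cong_def)
  also have "EJ.cong \<dots> (0 + cst c * cst r)"
  proof (rule EJ.cong_add)
    show "EJ.cong (cst j) 0" using cst_mem_ext[OF J(1) jc] jr(1) by (simp add: EJ.cong_0_iff)
    show "EJ.cong (cst (c \<otimes> r)) (cst c * cst r)"
      using invariant_zero_subset_ext[OF J(1) invariant_zero_cst(2)] c(1) jr(2) by (simp add: EJ.cong_def)
  qed
  finally have one: "1 - cst c * cst r \<in> ext J" by (simp add: EJ.cong_def)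
  have "pX i - subst (vcut n \<phi>) (cst r * P i) \<in> ext J" if i: "i < n" for i
  proof -
    have "pX i - subst (vcut n \<phi>) (cst r * P i) =
        (1 - cst c * cst r) * pX i + cst r * (cst c * pX i - subst (vcut n \<phi>) (P i))"
      by (simp add: algebra_simps)
    also have "\<dots> \<in> ext J" by (intro EJ.add_mem EJ.mult_mem EJ.mult_mem' one \<phi> i)
    finally show ?thesis .
  qed
  hence "gen_coordinate (ext J) n f" unfolding gen_coordinate_def using \<phi>(1) by blast
  from gen_coordinate_lift[OF noeth I J(1,3) this f n] show ?case by simp
next
  case (Suc d)
  note I = Suc.prems(1) and chain = Suc.prems(2)
  obtain J c \<phi> P where J: "ideal J R" "I \<subseteq> J" "\<And>P. primeideal P R \<Longrightarrow> I \<subseteq> P \<Longrightarrow> J \<subseteq> P"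
    and c: "c \<in> carrier R" "\<And>b. b \<in> carrier R \<Longrightarrow> c \<otimes> b \<in> J \<Longrightarrow> b \<in> J"
      "\<And>P. primeideal P R \<Longrightarrow> I \<subseteq> P \<Longrightarrow> c \<in> P \<Longrightarrow> \<exists>p. primeideal p R \<and> I \<subseteq> p \<and> p \<subset> P"
    and \<phi>: "\<phi> 0 = f" "\<And>i. i < n \<Longrightarrow> cst c * pX i - subst (vcut n \<phi>) (P i) \<in> ext J"
    by (rule exists_generic_coordinate[OF noeth I n coord]) (assumption | rule that | blast)+
  interpret EJ: poly_ideal "ext J" by (rule ext_poly_ideal[OF J(1)])
  have J': "ideal (adjoin J c) R" by (rule adjoin_ideal[OF J(1) c(1)])
  interpret E': poly_ideal "ext (adjoin J c)" by (rule ext_poly_ideal[OF J'])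
  have gen: "gen_coordinate (ext (adjoin J c)) (2 ^ d * n) f"
  proof (rule Suc.IH[OF J'])
    fix l Q assume Q: "prime_chain R l Q" "adjoin J c \<subseteq> Q 0"
    have "primeideal (Q 0) R" using Q(1) by (simp add: prime_chain_def)
    moreover have "I \<subseteq> Q 0"
      using order_trans[OF J(2) order_trans[OF adjoin_superset(1)[OF J(1) c(1)] Q(2)]] .
    moreover have "c \<in> Q 0" using subsetD[OF Q(2) adjoin_superset(2)[OF J(1) c(1)]] .
    ultimately have "\<exists>p. primeideal p R \<and> I \<subseteq> p \<and> p \<subset> Q 0" by (rule c(3))
    then obtain p where p: "primeideal p R" "I \<subseteq> p" "p \<subset> Q 0" by (elim exE conjE)
    from chain[OF prime_chain_Cons[OF Q(1) p(1,3)]] p(2) show "l \<le> d" by simp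
  qed
  define N where "N = 2 ^ d * n"
  have nN: "n \<le> N" unfolding N_def using mult_le_mono1[of 1 "2 ^ d" n] by simp
  have N: "N \<ge> 1" using n nN by simp
  have fN: "subst (vcut N pX) f = f" by (rule vcut_fixed_mono[OF f nN])
  \<comment> \<open>Padding from n to N variables: the variables from n on are adjoined as they
    stand, with numerators c X_i. In \<open>P'\<close> the old numerators are cut, as their
    variables from n on used to be replaced by 0 and would now be replaced by variables.\<close>
  define \<phi>' where "\<phi>' i = (if i < n then \<phi> i else pX i)" for i
  define P' where "P' i = (if i < n then subst (vcut n pX) (P i) else cst c * pX i)" for i
  have "gen_coordinate (ext J) (2 * N) f"
  proof (rule EJ.gen_coordinate_patch)
    show "p \<in> ext J" if "cst c * p \<in> ext J" for p by (rule cst_cancel_ext[OF c(1,2) that])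
    show "N \<ge> 1" by (rule N)
    show "poly_ideal (ext (adjoin J c))" ..
    show "p \<in> ext (adjoin J c) \<longleftrightarrow> (\<exists>w. p - cst c * w \<in> ext J)" for p
    proof
      assume "p \<in> ext (adjoin J c)"
      thus "\<exists>w. p - cst c * w \<in> ext J"
        using ext_add_principal[OF J(1) c(1), of "adjoin J c" p] mem_adjoin[OF c(1)] by blast
    next
      assume "\<exists>w. p - cst c * w \<in> ext J"
      then obtain w where w: "p - cst c * w \<in> ext J" by blast
      have "cst c \<in> ext (adjoin J c)"
        using cst_mem_ext[OF J' c(1)] adjoin_superset[OF J(1) c(1)] by simp
      moreover have "p - cst c * w \<in> ext (adjoin J c)"
        using w ext_mono[OF adjoin_superset(1)[OF J(1) c(1)]] by blast
      ultimately have "(p - cst c * w) + cst c * w \<in> ext (adjoin J c)"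
        by (intro E'.add_mem E'.mult_mem')
      thus "p \<in> ext (adjoin J c)" by simp
    qed
    show "subst (vcut N pX) f = f" by (rule fN)
    show "\<phi>' 0 = f" using n by (simp add: \<phi>'_def \<phi>(1))
    show "gen_coordinate (ext (adjoin J c)) N f" using gen by (simp add: N_def)
    fix i assume i: "i < N"
    show "EJ.cong (subst (vcut N \<phi>') (P' i)) (cst c * pX i)"
    proof (cases "i < n")
      case True
      have "(\<lambda>j. subst (vcut N \<phi>') (vcut n pX j)) = vcut n \<phi>"
        using nN by (auto simp: vcut_def \<phi>'_def)
      hence "subst (vcut N \<phi>') (P' i) = subst (vcut n \<phi>) (P i)"
        using True by (simp add: P'_def subst_subst)
      moreover have "EJ.cong (cst c * pX i) (subst (vcut n \<phi>) (P i))"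
        using \<phi>(2)[OF True] by (simp add: EJ.cong_def)
      ultimately show ?thesis using EJ.cong_sym by simp
    next
      case False
      thus ?thesis using i by (simp add: P'_def \<phi>'_def)
    qed
  qed
  hence "gen_coordinate (ext I) (2 * N) f"
    using N nN by (intro gen_coordinate_lift[OF noeth I J(1,3)] vcut_fixed_mono[OF f]) auto
  thus ?case by (simp add: N_def mult.assoc)
qed

end

section \<open>Rings of fractions and residue fields\<close>

locale mult_subset = cring R for R :: "('a, 'b) ring_scheme" (structure) +
  fixes S :: "'a set"
  assumes S_subset: "S \<subseteq> carrier R" and S_one: "\<one> \<in> S"
    and S_mult: "s \<in> S \<Longrightarrow> t \<in> S \<Longrightarrow> s \<otimes> t \<in> S"
begin

abbreviation "L \<equiv> frac_ring R S"
abbreviation "fr \<equiv> frac_class R S"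

lemma S_carrier [simp]: "s \<in> S \<Longrightarrow> s \<in> carrier R"
  using S_subset by blast

lemma frac_rel_iff:
  "((a, s), (b, t)) \<in> frac_rel R S \<longleftrightarrow> a \<in> carrier R \<and> s \<in> S \<and> b \<in> carrier R \<and> t \<in> S \<and>
     (\<exists>u\<in>S. u \<otimes> (a \<otimes> t) = u \<otimes> (b \<otimes> s))"
proof -
  have "u \<otimes> (x \<ominus> y) = \<zero> \<longleftrightarrow> u \<otimes> x = u \<otimes> y"
    if "u \<in> carrier R" "x \<in> carrier R" "y \<in> carrier R" for u x y
  proof -
    have "u \<otimes> (x \<ominus> y) = u \<otimes> x \<ominus> u \<otimes> y" using that by (simp add: a_minus_def r_distr r_minus)
    thus ?thesis using that by simp
  qed
  thus ?thesis unfolding frac_rel_def by auto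
qed

lemma frac_rel_equiv: "equiv (carrier R \<times> S) (frac_rel R S)"
proof (rule equivI)
  show "frac_rel R S \<subseteq> (carrier R \<times> S) \<times> (carrier R \<times> S)" by (auto simp: frac_rel_def)
  show "refl_on (carrier R \<times> S) (frac_rel R S)"
    using S_one by (auto simp: refl_on_def frac_rel_iff)
  show "sym (frac_rel R S)"
    by (rule symI) (auto simp: frac_rel_iff, metis)
  show "trans (frac_rel R S)"
  proof (rule transI)
    fix x y z assume xy: "(x, y) \<in> frac_rel R S" and yz: "(y, z) \<in> frac_rel R S"
    obtain a s b t c r where e: "x = (a, s)" "y = (b, t)" "z = (c, r)" by (cases x, cases y, cases z)
    obtain u where u: "u \<in> S" "u \<otimes> (a \<otimes> t) = u \<otimes> (b \<otimes> s)" using xy by (auto simp: e frac_rel_iff)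
    obtain v where v: "v \<in> S" "v \<otimes> (b \<otimes> r) = v \<otimes> (c \<otimes> t)" using yz by (auto simp: e frac_rel_iff)
    have cl: "a \<in> carrier R" "s \<in> S" "b \<in> carrier R" "t \<in> S" "c \<in> carrier R" "r \<in> S"
      using xy yz by (auto simp: e frac_rel_iff)
    have "(u \<otimes> v \<otimes> t) \<otimes> (a \<otimes> r) = (v \<otimes> r) \<otimes> (u \<otimes> (a \<otimes> t))" using cl u(1) v(1) by (simp add: m_ac)
    also have "\<dots> = (u \<otimes> s) \<otimes> (v \<otimes> (b \<otimes> r))" unfolding u(2) using cl u(1) v(1) by (simp add: m_ac)
    also have "\<dots> = (u \<otimes> v \<otimes> t) \<otimes> (c \<otimes> s)" unfolding v(2) using cl u(1) v(1) by (simp add: m_ac)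
    finally show "(x, z) \<in> frac_rel R S"
      using cl u(1) v(1) S_mult unfolding e frac_rel_iff by blast
  qed
qed

lemma fr_eq_iff:
  assumes "a \<in> carrier R" "s \<in> S" "b \<in> carrier R" "t \<in> S"
  shows "fr a s = fr b t \<longleftrightarrow> (\<exists>u\<in>S. u \<otimes> (a \<otimes> t) = u \<otimes> (b \<otimes> s))"
  unfolding frac_class_def using eq_equiv_class_iff[OF frac_rel_equiv, of "(a, s)" "(b, t)"] assms
  by (auto simp: frac_rel_iff)

lemma fr_eqI:
  assumes "a \<in> carrier R" "s \<in> S" "b \<in> carrier R" "t \<in> S" "a \<otimes> t = b \<otimes> s"
  shows "fr a s = fr b t"
  unfolding fr_eq_iff[OF assms(1-4)] using S_one by (intro bexI[of _ \<one>]) (simp_all only: assms(5))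

lemma mem_fr:
  assumes "a \<in> carrier R" "s \<in> S"
  shows "x \<in> fr a s \<longleftrightarrow> fst x \<in> carrier R \<and> snd x \<in> S \<and> fr (fst x) (snd x) = fr a s"
  using fr_eq_iff[OF _ _ assms, of "fst x" "snd x"] assms
  by (cases x) (auto simp: frac_class_def[of R S a s] frac_rel_iff, metis+)

lemma mem_frE:
  assumes "x \<in> fr a s" "a \<in> carrier R" "s \<in> S"
  obtains u where "fst x \<in> carrier R" "snd x \<in> S" "u \<in> S" "u \<otimes> (fst x \<otimes> s) = u \<otimes> (a \<otimes> snd x)"
  using assms fr_eq_iff[of "fst x" "snd x" a s] mem_fr[OF assms(2,3), of x] by blast

lemma carrier_frac: "carrier L = {fr a s | a s. a \<in> carrier R \<and> s \<in> S}"
  by (auto simp: frac_ring_def quotient_def frac_class_def)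

lemma fr_closed [simp]: "a \<in> carrier R \<Longrightarrow> s \<in> S \<Longrightarrow> fr a s \<in> carrier L"
  by (auto simp: carrier_frac)

text \<open>Both classes are nonempty, so the union of a constant set is that set; well-definedness
  of the operations becomes an equality of classes.\<close>

lemma UN_fr:
  assumes "a \<in> carrier R" "s \<in> S" "b \<in> carrier R" "t \<in> S"
    and "\<And>x y. x \<in> fr a s \<Longrightarrow> y \<in> fr b t \<Longrightarrow> g x y = K"
  shows "(\<Union>x\<in>fr a s. \<Union>y\<in>fr b t. g x y) = K"
proof -
  have "(a, s) \<in> fr a s" "(b, t) \<in> fr b t" using assms(1-4) by (auto simp: mem_fr)
  thus ?thesis using assms(5) by blast
qed

lemma fr_mult:
  assumes "a \<in> carrier R" "s \<in> S" "b \<in> carrier R" "t \<in> S"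
  shows "fr a s \<otimes>\<^bsub>L\<^esub> fr b t = fr (a \<otimes> b) (s \<otimes> t)"
proof -
  have "fr (fst x \<otimes> fst y) (snd x \<otimes> snd y) = fr (a \<otimes> b) (s \<otimes> t)"
    if xy: "x \<in> fr a s" "y \<in> fr b t" for x y
  proof -
    obtain u where x: "fst x \<in> carrier R" "snd x \<in> S"
      and u: "u \<in> S" "u \<otimes> (fst x \<otimes> s) = u \<otimes> (a \<otimes> snd x)"
      by (rule mem_frE[OF xy(1) assms(1,2)])
    obtain v where y: "fst y \<in> carrier R" "snd y \<in> S"
      and v: "v \<in> S" "v \<otimes> (fst y \<otimes> t) = v \<otimes> (b \<otimes> snd y)"
      by (rule mem_frE[OF xy(2) assms(3,4)])
    note cl = x y
    have "(u \<otimes> v) \<otimes> ((fst x \<otimes> fst y) \<otimes> (s \<otimes> t)) = (u \<otimes> (fst x \<otimes> s)) \<otimes> (v \<otimes> (fst y \<otimes> t))"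
      using cl u(1) v(1) assms by (simp add: m_ac)
    also have "\<dots> = (u \<otimes> v) \<otimes> ((a \<otimes> b) \<otimes> (snd x \<otimes> snd y))"
      unfolding u(2) v(2) using cl u(1) v(1) assms by (simp add: m_ac)
    finally show ?thesis
      using cl u(1) v(1) assms S_mult by (subst fr_eq_iff) auto
  qed
  hence "(\<Union>x\<in>fr a s. \<Union>y\<in>fr b t. fr (fst x \<otimes> fst y) (snd x \<otimes> snd y)) = fr (a \<otimes> b) (s \<otimes> t)"
    by (intro UN_fr[OF assms])
  thus ?thesis by (simp add: frac_ring_def)
qed

lemma fr_add:
  assumes "a \<in> carrier R" "s \<in> S" "b \<in> carrier R" "t \<in> S"
  shows "fr a s \<oplus>\<^bsub>L\<^esub> fr b t = fr (a \<otimes> t \<oplus> b \<otimes> s) (s \<otimes> t)"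
proof -
  have "fr (fst x \<otimes> snd y \<oplus> fst y \<otimes> snd x) (snd x \<otimes> snd y) = fr (a \<otimes> t \<oplus> b \<otimes> s) (s \<otimes> t)"
    if xy: "x \<in> fr a s" "y \<in> fr b t" for x y
  proof -
    obtain u where x: "fst x \<in> carrier R" "snd x \<in> S"
      and u: "u \<in> S" "u \<otimes> (fst x \<otimes> s) = u \<otimes> (a \<otimes> snd x)"
      by (rule mem_frE[OF xy(1) assms(1,2)])
    obtain v where y: "fst y \<in> carrier R" "snd y \<in> S"
      and v: "v \<in> S" "v \<otimes> (fst y \<otimes> t) = v \<otimes> (b \<otimes> snd y)"
      by (rule mem_frE[OF xy(2) assms(3,4)])
    note cl = x y
    have "(u \<otimes> v) \<otimes> ((fst x \<otimes> snd y \<oplus> fst y \<otimes> snd x) \<otimes> (s \<otimes> t)) =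
        (v \<otimes> snd y \<otimes> t) \<otimes> (u \<otimes> (fst x \<otimes> s)) \<oplus> (u \<otimes> snd x \<otimes> s) \<otimes> (v \<otimes> (fst y \<otimes> t))"
      using cl u(1) v(1) assms by (simp add: l_distr r_distr m_ac)
    also have "\<dots> = (u \<otimes> v) \<otimes> ((a \<otimes> t \<oplus> b \<otimes> s) \<otimes> (snd x \<otimes> snd y))"
      unfolding u(2) v(2) using cl u(1) v(1) assms by (simp add: l_distr r_distr m_ac)
    finally show ?thesis
      using cl u(1) v(1) assms S_mult by (subst fr_eq_iff) auto
  qed
  hence "(\<Union>x\<in>fr a s. \<Union>y\<in>fr b t. fr (fst x \<otimes> snd y \<oplus> fst y \<otimes> snd x) (snd x \<otimes> snd y)) = fr (a \<otimes> t \<oplus> b \<otimes> s) (s \<otimes> t)"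
    by (intro UN_fr[OF assms])
  thus ?thesis by (simp add: frac_ring_def)
qed

lemma fr_one_zero: "\<one>\<^bsub>L\<^esub> = fr \<one> \<one>" "\<zero>\<^bsub>L\<^esub> = fr \<zero> \<one>"
  by (simp_all add: frac_ring_def)

lemma carrier_fracE:
  assumes "x \<in> carrier L"
  obtains a s where "a \<in> carrier R" "s \<in> S" "x = fr a s"
  using assms by (auto simp: carrier_frac)

lemma cring_frac: "cring L"
proof (rule cringI)
  show "abelian_group L"
  proof (rule abelian_groupI)
    fix x assume "x \<in> carrier L"
    then obtain a s where x: "a \<in> carrier R" "s \<in> S" "x = fr a s" by (rule carrier_fracE)
    show "\<zero>\<^bsub>L\<^esub> \<oplus>\<^bsub>L\<^esub> x = x" using x S_one by (simp add: fr_one_zero fr_add)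
    have "fr (\<ominus> a) s \<oplus>\<^bsub>L\<^esub> x = fr (\<ominus> a \<otimes> s \<oplus> a \<otimes> s) (s \<otimes> s)" using x by (simp add: fr_add)
    also have "\<dots> = fr \<zero> \<one>"
      using x S_one S_mult by (intro fr_eqI) (auto simp: l_minus l_neg)
    finally show "\<exists>y\<in>carrier L. y \<oplus>\<^bsub>L\<^esub> x = \<zero>\<^bsub>L\<^esub>"
      using x by (intro bexI[of _ "fr (\<ominus> a) s"]) (simp_all add: fr_one_zero)
    fix y assume "y \<in> carrier L"
    then obtain b t where y: "b \<in> carrier R" "t \<in> S" "y = fr b t" by (rule carrier_fracE)
    show "x \<oplus>\<^bsub>L\<^esub> y \<in> carrier L" using x y S_mult by (simp add: fr_add)
    show "x \<oplus>\<^bsub>L\<^esub> y = y \<oplus>\<^bsub>L\<^esub> x" using x y by (simp add: fr_add a_comm m_comm)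
    fix z assume "z \<in> carrier L"
    then obtain c r where z: "c \<in> carrier R" "r \<in> S" "z = fr c r" by (rule carrier_fracE)
    show "x \<oplus>\<^bsub>L\<^esub> y \<oplus>\<^bsub>L\<^esub> z = x \<oplus>\<^bsub>L\<^esub> (y \<oplus>\<^bsub>L\<^esub> z)"
      using x y z S_mult by (simp add: fr_add l_distr r_distr m_ac a_ac)
  next
    show "\<zero>\<^bsub>L\<^esub> \<in> carrier L" using S_one by (simp add: fr_one_zero)
  qed
  show "comm_monoid L"
  proof (rule comm_monoidI)
    fix x assume "x \<in> carrier L"
    then obtain a s where x: "a \<in> carrier R" "s \<in> S" "x = fr a s" by (rule carrier_fracE)
    show "\<one>\<^bsub>L\<^esub> \<otimes>\<^bsub>L\<^esub> x = x" using x S_one by (simp add: fr_one_zero fr_mult)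
    fix y assume "y \<in> carrier L"
    then obtain b t where y: "b \<in> carrier R" "t \<in> S" "y = fr b t" by (rule carrier_fracE)
    show "x \<otimes>\<^bsub>L\<^esub> y \<in> carrier L" using x y S_mult by (simp add: fr_mult)
    show "x \<otimes>\<^bsub>L\<^esub> y = y \<otimes>\<^bsub>L\<^esub> x" using x y by (simp add: fr_mult m_comm)
    fix z assume "z \<in> carrier L"
    then obtain c r where z: "c \<in> carrier R" "r \<in> S" "z = fr c r" by (rule carrier_fracE)
    show "x \<otimes>\<^bsub>L\<^esub> y \<otimes>\<^bsub>L\<^esub> z = x \<otimes>\<^bsub>L\<^esub> (y \<otimes>\<^bsub>L\<^esub> z)"
      using x y z S_mult by (simp add: fr_mult m_assoc)
  next
    show "\<one>\<^bsub>L\<^esub> \<in> carrier L" using S_one by (simp add: fr_one_zero)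
  qed
  fix x y z assume "x \<in> carrier L" "y \<in> carrier L" "z \<in> carrier L"
  then obtain a s b t c r where x: "a \<in> carrier R" "s \<in> S" "x = fr a s"
    and y: "b \<in> carrier R" "t \<in> S" "y = fr b t" and z: "c \<in> carrier R" "r \<in> S" "z = fr c r"
    by (elim carrier_fracE) blast
  have "(x \<oplus>\<^bsub>L\<^esub> y) \<otimes>\<^bsub>L\<^esub> z = fr ((a \<otimes> t \<oplus> b \<otimes> s) \<otimes> c) (s \<otimes> t \<otimes> r)"
    using x y z S_mult by (simp add: fr_add fr_mult)
  also have "\<dots> = fr (a \<otimes> c \<otimes> (t \<otimes> r) \<oplus> b \<otimes> c \<otimes> (s \<otimes> r)) (s \<otimes> r \<otimes> (t \<otimes> r))"
    using x y z S_mult by (intro fr_eqI) (auto simp: l_distr r_distr m_ac)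
  also have "\<dots> = x \<otimes>\<^bsub>L\<^esub> z \<oplus>\<^bsub>L\<^esub> y \<otimes>\<^bsub>L\<^esub> z"
    using x y z S_mult by (simp add: fr_add fr_mult)
  finally show "(x \<oplus>\<^bsub>L\<^esub> y) \<otimes>\<^bsub>L\<^esub> z = x \<otimes>\<^bsub>L\<^esub> z \<oplus>\<^bsub>L\<^esub> y \<otimes>\<^bsub>L\<^esub> z" .
qed

end

text \<open>All that the proof uses of k(p): it is a commutative ring under R, the kernel of R
  \<rightarrow> k(p) lies in p, and every element is a fraction of images with denominator outside
  p.\<close>

lemma (in cring) residue_field_properties:
  assumes p: "primeideal p R"
  shows "cring (residue_field R p)" "to_residue_field R p \<in> Ring.ring_hom R (residue_field R p)"
    "\<And>a. a \<in> carrier R \<Longrightarrow> to_residue_field R p a = \<zero>\<^bsub>residue_field R p\<^esub> \<Longrightarrow> a \<in> p"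
    "\<And>y. y \<in> carrier (residue_field R p) \<Longrightarrow> \<exists>a\<in>carrier R. \<exists>s\<in>carrier R - p.
       to_residue_field R p s \<otimes>\<^bsub>residue_field R p\<^esub> y = to_residue_field R p a"
proof -
  interpret p: primeideal p R by fact
  have one: "\<one> \<notin> p" using p.I_notcarr p.one_imp_carrier by blast
  interpret S: mult_subset R "carrier R - p"
    by unfold_locales (use one p.I_prime in auto)
  have L: "localization_at R p = S.L" by (simp add: localization_at_def)
  have toL: "to_localization R p a = S.fr a \<one>" for a by (simp add: to_localization_def)
  interpret L: cring S.L by (rule S.cring_frac)
  define E where "E = extended_prime R p"
  have E_def': "E = genideal S.L ((\<lambda>a. S.fr a \<one>) ` p)"
    by (simp add: E_def extended_prime_def L toL[abs_def])
  have sub: "(\<lambda>a. S.fr a \<one>) ` p \<subseteq> carrier S.L" using S.S_one p.a_Hcarr by auto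
  interpret E: ideal E S.L unfolding E_def' by (rule L.genideal_ideal[OF sub])
  have res: "residue_field R p = S.L Quot E" "to_residue_field R p a = E +>\<^bsub>S.L\<^esub> S.fr a \<one>" for a
    by (simp_all add: residue_field_def to_residue_field_def L toL E_def)
  show cr: "cring (residue_field R p)" unfolding res by (rule E.quotient_is_cring[OF L.is_cring])
  have hom1: "(\<lambda>a. S.fr a \<one>) \<in> Ring.ring_hom R S.L"
    using S.S_one by (intro ring_hom_memI) (auto simp: S.fr_mult S.fr_add S.fr_one_zero)
  have "(+>\<^bsub>S.L\<^esub>) E \<circ> (\<lambda>a. S.fr a \<one>) \<in> Ring.ring_hom R (S.L Quot E)"
    by (rule ring_hom_trans[OF hom1 E.rcos_ring_hom])
  thus "to_residue_field R p \<in> Ring.ring_hom R (residue_field R p)"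
    by (simp add: res[abs_def] comp_def)
  \<comment> \<open>pR_p as a set of fractions. The generated ideal \<open>E\<close> lies in it, so
    a/1 in \<open>E\<close> means u a s = u b with b in p and u, s outside p, whence a is in
    p.\<close>
  define M where "M = {S.fr a s | a s. a \<in> p \<and> s \<in> carrier R - p}"
  have M: "ideal M S.L"
  proof (rule idealI[OF L.ring_axioms])
    show "subgroup M (add_monoid S.L)"
    proof (rule group.subgroupI[OF L.a_group])
      show "M \<subseteq> carrier (add_monoid S.L)" using p.a_Hcarr by (auto simp: M_def)
      show "M \<noteq> {}" using S.S_one additive_subgroup.zero_closed[OF p.additive_subgroup_axioms] unfolding M_def by blast
      show "inv\<^bsub>add_monoid S.L\<^esub> x \<in> M" if "x \<in> M" for x
      proof -
        obtain a s where x: "a \<in> p" "s \<in> carrier R - p" "x = S.fr a s" using \<open>x \<in> M\<close> by (auto simp: M_def)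
        have a: "a \<in> carrier R" using x(1) by (rule p.a_Hcarr)
        have "S.fr (\<ominus> a) s \<oplus>\<^bsub>S.L\<^esub> x = S.fr (\<ominus> a \<otimes> s \<oplus> a \<otimes> s) (s \<otimes> s)"
          using x(2,3) a by (simp add: S.fr_add)
        also have "\<dots> = \<zero>\<^bsub>S.L\<^esub>"
          unfolding S.fr_one_zero using x(2) a S.S_one S.S_mult by (intro S.fr_eqI) (auto simp: l_minus l_neg)
        finally have "\<ominus>\<^bsub>S.L\<^esub> x = S.fr (\<ominus> a) s"
          using x a by (intro L.minus_equality) auto
        hence "\<ominus>\<^bsub>S.L\<^esub> x \<in> M"
          using x(1,2) additive_subgroup.a_inv_closed[OF p.additive_subgroup_axioms] unfolding M_def by blast
        thus ?thesis by (simp add: a_inv_def)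
      qed
      show "x \<otimes>\<^bsub>add_monoid S.L\<^esub> y \<in> M" if xy: "x \<in> M" "y \<in> M" for x y
      proof -
        obtain a s where x: "a \<in> p" "s \<in> carrier R - p" "x = S.fr a s" using xy(1) by (auto simp: M_def)
        obtain b t where y: "b \<in> p" "t \<in> carrier R - p" "y = S.fr b t" using xy(2) by (auto simp: M_def)
        have "x \<oplus>\<^bsub>S.L\<^esub> y = S.fr (a \<otimes> t \<oplus> b \<otimes> s) (s \<otimes> t)"
          using x y p.a_Hcarr by (simp add: S.fr_add)
        moreover have "a \<otimes> t \<oplus> b \<otimes> s \<in> p"
          using x y by (intro additive_subgroup.a_closed[OF p.additive_subgroup_axioms] p.I_r_closed) auto
        ultimately have "x \<oplus>\<^bsub>S.L\<^esub> y \<in> M" using S.S_mult[OF x(2) y(2)] unfolding M_def by blast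
        thus ?thesis by simp
      qed
    qed
    show "x \<otimes>\<^bsub>S.L\<^esub> y \<in> M" "y \<otimes>\<^bsub>S.L\<^esub> x \<in> M" if xy: "y \<in> M" "x \<in> carrier S.L" for x y
    proof -
      obtain b t where y: "b \<in> p" "t \<in> carrier R - p" "y = S.fr b t" using xy(1) by (auto simp: M_def)
      obtain a s where x: "a \<in> carrier R" "s \<in> carrier R - p" "x = S.fr a s"
        using xy(2) by (rule S.carrier_fracE)
      have eq: "x \<otimes>\<^bsub>S.L\<^esub> y = S.fr (a \<otimes> b) (s \<otimes> t)" "y \<otimes>\<^bsub>S.L\<^esub> x = S.fr (a \<otimes> b) (s \<otimes> t)"
        using x y p.a_Hcarr[OF y(1)] by (simp_all add: S.fr_mult m_comm)
      have "a \<otimes> b \<in> p" by (rule p.I_l_closed[OF y(1) x(1)])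
      thus "x \<otimes>\<^bsub>S.L\<^esub> y \<in> M" "y \<otimes>\<^bsub>S.L\<^esub> x \<in> M"
        using S.S_mult[OF x(2) y(2)] unfolding M_def eq by blast+
    qed
  qed
  have "(\<lambda>a. S.fr a \<one>) ` p \<subseteq> M" using S.S_one unfolding M_def by blast
  hence EM: "E \<subseteq> M" unfolding E_def' by (rule L.genideal_minimal[OF M])
  show "a \<in> p" if a: "a \<in> carrier R" "to_residue_field R p a = \<zero>\<^bsub>residue_field R p\<^esub>" for a
  proof -
    have "E +>\<^bsub>S.L\<^esub> S.fr a \<one> = E" using a(2) by (simp add: res FactRing_def)
    hence "S.fr a \<one> \<in> E" using E.a_rcos_self[OF S.fr_closed[OF a(1) S.S_one]] by simp
    hence "S.fr a \<one> \<in> M" using EM by blast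
    then obtain b s where b: "b \<in> p" "s \<in> carrier R - p" "S.fr a \<one> = S.fr b s" by (auto simp: M_def)
    obtain u where u: "u \<in> carrier R - p" "u \<otimes> (a \<otimes> s) = u \<otimes> (b \<otimes> \<one>)"
      using b(2,3) a(1) p.a_Hcarr[OF b(1)] S.S_one S.fr_eq_iff[of a \<one> b s] by blast
    have "u \<otimes> (b \<otimes> \<one>) \<in> p" using b(1) u(1) p.a_Hcarr[OF b(1)] by (simp add: p.I_l_closed)
    hence "u \<otimes> (a \<otimes> s) \<in> p" by (simp only: u(2))
    hence "a \<otimes> s \<in> p" using p.I_prime[of u "a \<otimes> s"] u(1) a(1) b(2) by auto
    thus "a \<in> p" using p.I_prime[of a s] a(1) b(2) by auto
  qed
  show "\<exists>a\<in>carrier R. \<exists>s\<in>carrier R - p.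
       to_residue_field R p s \<otimes>\<^bsub>residue_field R p\<^esub> y = to_residue_field R p a"
    if y: "y \<in> carrier (residue_field R p)" for y
  proof -
    obtain x where x: "x \<in> carrier S.L" "y = E +>\<^bsub>S.L\<^esub> x"
      using y unfolding res FactRing_def A_RCOSETS_def' by auto
    obtain a s where as: "a \<in> carrier R" "s \<in> carrier R - p" "x = S.fr a s"
      using x(1) by (rule S.carrier_fracE)
    have "to_residue_field R p s \<otimes>\<^bsub>residue_field R p\<^esub> y = E +>\<^bsub>S.L\<^esub> (S.fr s \<one> \<otimes>\<^bsub>S.L\<^esub> x)"
      using ring_hom_mult[OF E.rcos_ring_hom, of "S.fr s \<one>" x] as(2) x S.S_one by (simp add: res)
    also have "S.fr s \<one> \<otimes>\<^bsub>S.L\<^esub> x = S.fr (s \<otimes> a) (\<one> \<otimes> s)" using as S.S_one by (simp add: S.fr_mult)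
    also have "\<dots> = S.fr a \<one>" using as S.S_one by (intro S.fr_eqI) (auto simp: m_comm)
    finally show ?thesis using as by (auto simp: res)
  qed
qed

section \<open>From residual coordinates to stable coordinates\<close>

context cring
begin

lemma pval_surj:
  assumes "P \<in> carrier (poly_ring_n R n)"
  shows "\<exists>q. subst (vcut n pX) q = q \<and> pval q = P"
proof -
  have "P \<in> indexed_pset {..<n} (carrier R)" using assms by (simp add: mpoly_ring_simps)
  thus ?thesis
  proof (induction P)
    case (indexed_const c)
    thus ?case by (intro exI[of _ "cst c"]) (simp add: pval_cst)
  next
    case (indexed_padd P Q)
    then obtain p q where "subst (vcut n pX) p = p" "pval p = P" "subst (vcut n pX) q = q" "pval q = Q"
      by blast
    thus ?case by (intro exI[of _ "p + q"]) (simp add: pval_add_ring mpoly_ring_simps)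
  next
    case (indexed_pmult P i)
    then obtain p where "subst (vcut n pX) p = p" "pval p = P" by blast
    thus ?case using indexed_pmult(2) by (intro exI[of _ "pX i * p"]) (simp add: pval_pX_mult)
  qed
qed

lemma pval_vcut_closed: "pval (subst (vcut n pX) q) \<in> carrier (poly_ring_n R n)"
proof -
  interpret M: cring "poly_ring_n R n" by (rule cring_mpoly_ring)
  have neg: "pval (- p) = \<ominus>\<^bsub>poly_ring_n R n\<^esub> pval p" if "pval p \<in> carrier (poly_ring_n R n)" for p
    using that by (simp add: mpoly_ring_uminus fun_eq_iff pval_uminus)
  have const: "indexed_const c \<in> carrier (poly_ring_n R n)" if "c \<in> carrier R" for c
    using that by (simp add: mpoly_ring_simps indexed_pset.indexed_const)
  show ?thesis
  proof (induction q rule: pexp_induct)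
    case (pX i)
    thus ?case by (cases "i < n") (simp_all add: pval_pX pval_0 const indexed_var_closed)
  next
    case (add p q)
    thus ?case using M.add.m_closed[of "pval (subst (vcut n pX) p)" "pval (subst (vcut n pX) q)"]
      by (simp add: pval_add_ring mpoly_ring_simps)
  next
    case (mult p q)
    thus ?case using M.m_closed[of "pval (subst (vcut n pX) p)" "pval (subst (vcut n pX) q)"]
      by (simp add: pval_mult_ring mpoly_ring_simps)
  qed (simp_all add: pval_cst pval_0 pval_1 const neg)
qed

text \<open>The further generators over K are replaced by numerators that lift to R. Every
  polynomial over K is then, up to a denominator, the image of a polynomial in the lifted system;
  applied to the variables, this is pulled back by the hypothesis on the kernel.\<close>

lemma coordinate_at_residue_field:
  assumes p: "primeideal p R" and n: "n \<ge> 1"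
    and K: "cring K" and \<iota>: "\<iota> \<in> Ring.ring_hom R K"
    and ker: "\<And>a. a \<in> carrier R \<Longrightarrow> \<iota> a = \<zero>\<^bsub>K\<^esub> \<Longrightarrow> a \<in> p"
    and fractions: "\<And>y. y \<in> carrier K \<Longrightarrow> \<exists>a\<in>carrier R. \<exists>s\<in>carrier R - p. \<iota> s \<otimes>\<^bsub>K\<^esub> y = \<iota> a"
    and coord: "coordinate K n (\<iota> \<circ> pval f)"
  shows "coordinate_at p n f"
proof -
  interpret p: primeideal p R by fact
  interpret K: cring K by fact
  interpret \<iota>: ring_hom_cring R K \<iota>
    using \<iota> by (intro ring_hom_cring.intro ring_hom_cring_axioms.intro is_cring K) auto
  let ?c = K.indexed_const
  define M where "M = poly_ring_n K n"
  interpret M: cring M unfolding M_def by (rule K.cring_mpoly_ring)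
  note M_simps = K.mpoly_ring_simps[of "{..<n}", folded M_def]
  have S_mult: "s \<otimes> t \<in> carrier R - p" if "s \<in> carrier R - p" "t \<in> carrier R - p" for s t
    using that p.I_prime[of s t] by auto
  have S_one: "\<one> \<in> carrier R - p" using p.I_notcarr p.one_imp_carrier by blast
  have push_add: "\<iota> \<circ> pval (q + q') = (\<iota> \<circ> pval q) \<oplus>\<^bsub>M\<^esub> (\<iota> \<circ> pval q')" for q q'
    by (simp add: M_simps fun_eq_iff K.indexed_padd_def pval_add)
  have push_mult: "\<iota> \<circ> pval (q * q') = (\<iota> \<circ> pval q) \<otimes>\<^bsub>M\<^esub> (\<iota> \<circ> pval q')" for q q'
  proof
    fix m
    show "(\<iota> \<circ> pval (q * q')) m = ((\<iota> \<circ> pval q) \<otimes>\<^bsub>M\<^esub> (\<iota> \<circ> pval q')) m"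
      unfolding M_simps K.conv_def pval_mult conv_def comp_def
      by (subst \<iota>.hom_finsum) (auto intro!: K.finsum_cong')
  qed
  have push_uminus: "\<iota> \<circ> pval (- q) = (\<lambda>m. \<ominus>\<^bsub>K\<^esub> \<iota> (pval q m))" for q
    by (simp add: fun_eq_iff pval_uminus)
  have push_cst: "\<iota> \<circ> pval (cst a) = ?c (\<iota> a)" if "a \<in> carrier R" for a
    using that by (auto simp: fun_eq_iff pval_cst indexed_const_def K.indexed_const_def)
  have const_closed: "?c c \<in> carrier M" if "c \<in> carrier K" for c
    using that by (simp add: M_simps K.indexed_pset.indexed_const)
  have const_mult: "?c (\<iota> (s \<otimes> t)) = ?c (\<iota> s) \<otimes>\<^bsub>M\<^esub> ?c (\<iota> t)"
    if "s \<in> carrier R" "t \<in> carrier R" for s t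
  proof -
    have "K.conv (?c (\<iota> s)) (?c (\<iota> t)) =
        (\<lambda>m :: nat multiset. \<iota> s \<otimes>\<^bsub>K\<^esub> ?c (\<iota> t) m)"
      using that by (intro K.conv_const) (auto simp: K.indexed_const_def)
    thus ?thesis using that by (auto simp: M_simps fun_eq_iff K.indexed_const_def)
  qed
  \<comment> \<open>\<open>q\<close> lifts a numerator of \<open>y\<close> for the denominator
    \<open>s\<close>. Sums and products of fractions are then computed on numerators in the usual
    way.\<close>
  define num where "num s y q \<longleftrightarrow> ?c (\<iota> s) \<otimes>\<^bsub>M\<^esub> y = \<iota> \<circ> pval q" for s y q
  have num_mult: "num (s \<otimes> t) (y \<otimes>\<^bsub>M\<^esub> z) (q * q')"
    if st: "s \<in> carrier R" "t \<in> carrier R" and yz: "y \<in> carrier M" "z \<in> carrier M"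
      and q: "num s y q" "num t z q'" for s t y z q q'
  proof -
    have cl: "?c (\<iota> s) \<in> carrier M" "?c (\<iota> t) \<in> carrier M"
      using st by (auto intro: const_closed)
    have "?c (\<iota> (s \<otimes> t)) \<otimes>\<^bsub>M\<^esub> (y \<otimes>\<^bsub>M\<^esub> z) =
        (?c (\<iota> s) \<otimes>\<^bsub>M\<^esub> y) \<otimes>\<^bsub>M\<^esub> (?c (\<iota> t) \<otimes>\<^bsub>M\<^esub> z)"
      unfolding const_mult[OF st] using cl yz by (simp add: M.m_ac)
    thus ?thesis using q by (simp only: num_def push_mult)
  qed
  have num_add: "num (s \<otimes> t) (y \<oplus>\<^bsub>M\<^esub> z) (cst t * q + cst s * q')"
    if st: "s \<in> carrier R" "t \<in> carrier R" and yz: "y \<in> carrier M" "z \<in> carrier M"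
      and q: "num s y q" "num t z q'" for s t y z q q'
  proof -
    have cl: "?c (\<iota> s) \<in> carrier M" "?c (\<iota> t) \<in> carrier M"
      using st by (auto intro: const_closed)
    have "?c (\<iota> (s \<otimes> t)) \<otimes>\<^bsub>M\<^esub> (y \<oplus>\<^bsub>M\<^esub> z) =
        ?c (\<iota> t) \<otimes>\<^bsub>M\<^esub> (?c (\<iota> s) \<otimes>\<^bsub>M\<^esub> y) \<oplus>\<^bsub>M\<^esub>
        ?c (\<iota> s) \<otimes>\<^bsub>M\<^esub> (?c (\<iota> t) \<otimes>\<^bsub>M\<^esub> z)"
      unfolding const_mult[OF st] using cl yz by (simp add: M.r_distr M.m_ac)
    thus ?thesis using q st by (simp only: num_def push_add push_mult push_cst)
  qed
  have num_const: "\<exists>s\<in>carrier R - p. \<exists>a. num s (?c k) (cst a)" if k: "k \<in> carrier K" for k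
  proof -
    obtain a s where as: "a \<in> carrier R" "s \<in> carrier R - p" "\<iota> s \<otimes>\<^bsub>K\<^esub> k = \<iota> a"
      using fractions[OF k] by blast
    have "K.conv (?c (\<iota> s)) (?c k) =
        (\<lambda>m :: nat multiset. \<iota> s \<otimes>\<^bsub>K\<^esub> ?c k m)"
      using k as(2) by (intro K.conv_const) (auto simp: K.indexed_const_def)
    hence "K.conv (?c (\<iota> s)) (?c k) =
        (?c (\<iota> a) :: nat multiset \<Rightarrow> _)"
      using as by (auto simp: fun_eq_iff K.indexed_const_def)
    hence "num s (?c k) (cst a)"
      using as(1) by (simp add: num_def push_cst M_simps)
    thus ?thesis using as(2) by blast
  qed
  have num_one: "num \<one> (\<iota> \<circ> pval q) q" if "\<iota> \<circ> pval q \<in> carrier M" for q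
    using that by (simp add: num_def M_simps K.conv_const comp_def)
  have push_pX: "\<iota> \<circ> pval (pX i) = K.indexed_var i" for i
    by (auto simp: fun_eq_iff pval_pX indexed_var_def indexed_pmult_def indexed_const_def
        K.indexed_var_def K.indexed_pmult_def K.indexed_const_def)
  have num_exists: "\<exists>s\<in>carrier R - p. \<exists>q. num s y q" if "y \<in> carrier M" for y
    using that unfolding M_simps
  proof (induction y)
    case (indexed_const k)
    thus ?case using num_const by blast
  next
    case (indexed_padd P Q)
    then obtain s q t q' where st: "s \<in> carrier R - p" "num s P q" "t \<in> carrier R - p" "num t Q q'"
      by blast
    have "num (s \<otimes> t) (P \<oplus>\<^bsub>M\<^esub> Q) (cst t * q + cst s * q')"
      using st indexed_padd(1,2) by (intro num_add) (auto simp: M_simps)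
    hence "num (s \<otimes> t) (K.indexed_padd P Q) (cst t * q + cst s * q')" by (simp add: M_simps)
    thus ?case using S_mult[OF st(1,3)] by blast
  next
    case (indexed_pmult P i)
    then obtain s q where s: "s \<in> carrier R - p" "num s P q" by blast
    have var: "K.indexed_var i \<in> carrier M"
      using indexed_pmult(2) unfolding M_def by (intro K.indexed_var_closed) simp
    have "num (\<one> \<otimes> s) ((\<iota> \<circ> pval (pX i)) \<otimes>\<^bsub>M\<^esub> P) (pX i * q)"
      using s indexed_pmult(1) var by (intro num_mult num_one) (auto simp: M_simps push_pX)
    moreover have "(\<iota> \<circ> pval (pX i)) \<otimes>\<^bsub>M\<^esub> P = K.indexed_pmult P i"
      unfolding push_pX M_simps using K.coeff_closed[OF indexed_pmult(1)] by (intro K.conv_var)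
    ultimately show ?case using s(1) by auto
  qed
  obtain Fs where Fs: "length ((\<iota> \<circ> pval f) # Fs) = n" "set ((\<iota> \<circ> pval f) # Fs) \<subseteq> carrier M"
    "carrier M = generate_ring M (?c ` carrier K \<union> set ((\<iota> \<circ> pval f) # Fs))"
    using coord unfolding coordinate_def M_def by blast
  have "\<forall>y. \<exists>q. y \<in> carrier M \<longrightarrow> (\<exists>s\<in>carrier R - p. num s y q)" using num_exists by blast
  from choice[OF this] obtain g where g: "\<And>y. y \<in> carrier M \<Longrightarrow> \<exists>s\<in>carrier R - p. num s y (g y)" by blast
  \<comment> \<open>Position 0 belongs to f, so the list of further generators is shifted by
    one.\<close>
  define \<phi> where "\<phi> i = (if i = 0 then f else g (Fs ! (i - 1)))" for i
  \<comment> \<open>The elements with a numerator that is a polynomial in \<phi>. A further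
    generator qualifies because its chosen numerator is itself a component of \<phi>.\<close>
  define B where "B y \<longleftrightarrow> y \<in> carrier M \<and> (\<exists>s\<in>carrier R - p. \<exists>q. num s y (subst (vcut n \<phi>) q))" for y
  have "B y" if "y \<in> generate_ring M (?c ` carrier K \<union> set ((\<iota> \<circ> pval f) # Fs))" for y
    using that
  proof (induction y)
    case one
    have "\<one>\<^bsub>M\<^esub> = ?c \<one>\<^bsub>K\<^esub>" by (simp add: M_simps)
    then obtain s a where "s \<in> carrier R - p" "num s \<one>\<^bsub>M\<^esub> (subst (vcut n \<phi>) (cst a))"
      using num_const[of "\<one>\<^bsub>K\<^esub>"] by auto
    thus ?case unfolding B_def by blast
  next
    case (incl y)
    have y: "y \<in> carrier M" using incl Fs(2) const_closed by auto
    consider k where "k \<in> carrier K" "y = ?c k" | "y = \<iota> \<circ> pval f" | "y \<in> set Fs"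
      using incl by auto
    thus ?case
    proof cases
      case 1
      then obtain s a where "s \<in> carrier R - p" "num s y (subst (vcut n \<phi>) (cst a))"
        using num_const[of k] by auto
      thus ?thesis using y unfolding B_def by blast
    next
      case 2
      have "num \<one> y (subst (vcut n \<phi>) (pX 0))"
        using num_one[of f] y n by (simp add: 2 \<phi>_def)
      thus ?thesis using y S_one unfolding B_def by blast
    next
      case 3
      then obtain j where j: "j < length Fs" "y = Fs ! j" by (auto simp: in_set_conv_nth)
      have "subst (vcut n \<phi>) (pX (Suc j)) = g y" using j Fs(1) by (simp add: \<phi>_def)
      then obtain s where "s \<in> carrier R - p" "num s y (subst (vcut n \<phi>) (pX (Suc j)))"
        using g[OF y] by auto
      thus ?thesis using y unfolding B_def by blast
    qed
  next
    case (a_inv y)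
    then obtain s q where y: "y \<in> carrier M" and s: "s \<in> carrier R - p" "num s y (subst (vcut n \<phi>) q)"
      unfolding B_def by blast
    have cl: "?c (\<iota> s) \<in> carrier M" using s(1) by (auto intro: const_closed)
    have "?c (\<iota> s) \<otimes>\<^bsub>M\<^esub> (\<ominus>\<^bsub>M\<^esub> y) = \<ominus>\<^bsub>M\<^esub> (?c (\<iota> s) \<otimes>\<^bsub>M\<^esub> y)"
      using cl y by (simp add: M.r_minus)
    also have "\<dots> = (\<lambda>m. \<ominus>\<^bsub>K\<^esub> (?c (\<iota> s) \<otimes>\<^bsub>M\<^esub> y) m)"
      using cl y unfolding M_def by (intro K.mpoly_ring_uminus) (simp add: M_def[symmetric])
    finally have "num s (\<ominus>\<^bsub>M\<^esub> y) (subst (vcut n \<phi>) (- q))"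
      using s(2) by (simp add: num_def push_uminus)
    thus ?case using y s(1) unfolding B_def by blast
  next
    case (eng_add y z)
    then obtain s q t q' where yz: "y \<in> carrier M" "z \<in> carrier M"
      and st: "s \<in> carrier R - p" "num s y (subst (vcut n \<phi>) q)"
        "t \<in> carrier R - p" "num t z (subst (vcut n \<phi>) q')"
      unfolding B_def by blast
    have "num (s \<otimes> t) (y \<oplus>\<^bsub>M\<^esub> z) (subst (vcut n \<phi>) (cst t * q + cst s * q'))"
      unfolding subst_simps using st yz by (intro num_add) auto
    thus ?case using S_mult[OF st(1,3)] yz unfolding B_def by blast
  next
    case (eng_mult y z)
    then obtain s q t q' where yz: "y \<in> carrier M" "z \<in> carrier M"
      and st: "s \<in> carrier R - p" "num s y (subst (vcut n \<phi>) q)"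
        "t \<in> carrier R - p" "num t z (subst (vcut n \<phi>) q')"
      unfolding B_def by blast
    have "num (s \<otimes> t) (y \<otimes>\<^bsub>M\<^esub> z) (subst (vcut n \<phi>) (q * q'))"
      unfolding subst_simps using st yz by (intro num_mult) auto
    thus ?case using S_mult[OF st(1,3)] yz unfolding B_def by blast
  qed
  hence B: "\<exists>s\<in>carrier R - p. \<exists>q. num s y (subst (vcut n \<phi>) q)" if "y \<in> carrier M" for y
    using that Fs(3) unfolding B_def by blast
  have "\<exists>s\<in>carrier R - p. \<exists>q. cst s * pX i - subst (vcut n \<phi>) q \<in> ext p" if i: "i < n" for i
  proof -
    have "K.indexed_var i \<in> carrier M" using i unfolding M_def by (intro K.indexed_var_closed) simp
    then obtain s q where s: "s \<in> carrier R - p" "num s (K.indexed_var i) (subst (vcut n \<phi>) q)"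
      using B by blast
    hence eq: "\<iota> \<circ> pval (cst s * pX i) = \<iota> \<circ> pval (subst (vcut n \<phi>) q)"
      by (simp add: num_def push_mult push_cst push_pX)
    have "cst s * pX i - subst (vcut n \<phi>) q \<in> ext p"
      unfolding ext_def
    proof (intro CollectI allI)
      fix m
      have "\<iota> (pval (cst s * pX i) m) = \<iota> (pval (subst (vcut n \<phi>) q) m)"
        using fun_cong[OF eq, of m] by simp
      hence "\<iota> (pval (cst s * pX i - subst (vcut n \<phi>) q) m) = \<zero>\<^bsub>K\<^esub>"
        by (simp add: pval_diff a_minus_def K.r_neg)
      thus "pval (cst s * pX i - subst (vcut n \<phi>) q) m \<in> p" by (intro ker) simp_all
    qed
    thus ?thesis using s(1) by blast
  qed
  moreover have "\<phi> 0 = f" by (simp add: \<phi>_def)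
  ultimately show ?thesis unfolding coordinate_at_def by blast
qed

text \<open>\<open>ext {\<zero>}\<close> is the kernel of \<open>pval\<close>, so the congruences
  turn into equalities that put all variables into the generated subring.\<close>

lemma coordinate_of_gen_coordinate:
  assumes gen: "gen_coordinate (ext {\<zero>}) N f" and f: "subst (vcut N pX) f = f" and N: "N \<ge> 1"
  shows "coordinate R N (pval f)"
proof -
  interpret E: poly_ideal "ext {\<zero>}" by (rule ext_poly_ideal[OF zeroideal])
  obtain b a where b: "b 0 = f" "\<And>i. subst (vcut N pX) (b i) = b i" "\<And>i. N \<le> i \<Longrightarrow> b i = 0"
    and a: "\<And>i. i < N \<Longrightarrow> E.cong (subst b (a i)) (pX i)"
    using E.gen_coordinate_reduced[OF gen f N] by blast
  define M where "M = poly_ring_n R N"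
  interpret M: cring M unfolding M_def by (rule cring_mpoly_ring)
  note M_simps = mpoly_ring_simps[of "{..<N}", folded M_def]
  define Fs where "Fs = map (\<lambda>i. pval (b i)) [1..<N]"
  have set_Fs: "set (pval f # Fs) = (\<lambda>i. pval (b i)) ` {..<N}"
  proof -
    have "{..<N} = insert 0 (set [1..<N])" using N by auto
    thus ?thesis by (simp add: Fs_def b(1))
  qed
  have closed: "pval (b i) \<in> carrier M" for i
    using pval_vcut_closed[of N "b i"] by (simp add: b(2) M_def)
  define G where "G = generate_ring M (indexed_const ` carrier R \<union> set (pval f # Fs))"
  have gens: "indexed_const ` carrier R \<union> set (pval f # Fs) \<subseteq> carrier M"
    unfolding set_Fs using closed by (auto simp: M_simps intro: indexed_pset.indexed_const)
  have G_carrier: "G \<subseteq> carrier M" unfolding G_def using M.generate_ring_in_carrier[OF gens] by blast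
  have const: "indexed_const c \<in> G" if "c \<in> carrier R" for c
    unfolding G_def using that by (intro generate_ring.incl) auto
  have G_pval: "pval (subst b q) \<in> G" for q
  proof (induction q rule: pexp_induct)
    case (pX i)
    show ?case
    proof (cases "i < N")
      case True
      thus ?thesis unfolding G_def set_Fs by (intro generate_ring.incl) auto
    next
      case False
      thus ?thesis using const by (simp add: b(3) pval_0)
    qed
  next
    case (neg p)
    have "pval (- subst b p) = \<ominus>\<^bsub>M\<^esub> pval (subst b p)"
      using neg G_carrier unfolding M_def by (subst mpoly_ring_uminus) (auto simp: fun_eq_iff pval_uminus)
    thus ?case using neg unfolding G_def by (simp add: generate_ring.a_inv)
  next
    case (add p q)
    have "pval (subst b (p + q)) = pval (subst b p) \<oplus>\<^bsub>M\<^esub> pval (subst b q)"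
      by (simp add: pval_add_ring M_simps mpoly_ring_simps)
    thus ?case using add unfolding G_def by (simp only: generate_ring.eng_add)
  next
    case (mult p q)
    have "pval (subst b (p * q)) = pval (subst b p) \<otimes>\<^bsub>M\<^esub> pval (subst b q)"
      by (simp add: pval_mult_ring M_simps mpoly_ring_simps)
    thus ?case using mult unfolding G_def by (simp only: generate_ring.eng_mult)
  qed (simp_all add: const pval_cst pval_0 pval_1)
  have var: "indexed_var i \<in> G" if i: "i < N" for i
  proof -
    have "subst b (a i) - pX i \<in> ext {\<zero>}" using a[OF i] by (simp add: E.cong_def)
    hence "pval (subst b (a i)) m \<ominus> pval (pX i) m = \<zero>" for m
      by (simp add: ext_def pval_diff)
    hence "pval (subst b (a i)) = pval (pX i)" by (simp add: fun_eq_iff)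
    thus ?thesis using G_pval[of "a i"] by (simp add: pval_pX)
  qed
  have "P \<in> G" if "P \<in> carrier M" for P
    using that unfolding M_simps
  proof (induction P)
    case (indexed_const c)
    thus ?case by (rule const)
  next
    case (indexed_padd P Q)
    hence "P \<oplus>\<^bsub>M\<^esub> Q \<in> G" unfolding G_def by (intro generate_ring.eng_add)
    thus ?case by (simp add: M_simps)
  next
    case (indexed_pmult P i)
    hence "indexed_var i \<otimes>\<^bsub>M\<^esub> P \<in> G" using var unfolding G_def by (intro generate_ring.eng_mult) auto
    thus ?case using coeff_closed[OF indexed_pmult(1)] by (simp add: M_simps conv_var)
  qed
  hence "carrier M = G" using G_carrier by blast
  moreover have "length (pval f # Fs) = N" using N by (simp add: Fs_def)
  moreover have "set (pval f # Fs) \<subseteq> carrier M" using gens by blast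
  ultimately show ?thesis
    unfolding coordinate_def G_def M_def by blast
qed

end

theorem theorem3p6:
  fixes R :: "('a, 'b) ring_scheme" and n d :: nat and F :: "nat multiset \<Rightarrow> 'a"
  assumes "cring R" and "noetherian_ring R"
    and "has_krull_dim R d"
    and "n \<ge> 1"
    and "residual_coordinate R n F"
  shows "stable_coordinate R n ((2 ^ d - 1) * n) F"
proof -
  interpret cring R by fact
  have F: "F \<in> carrier (poly_ring_n R n)" using assms(5) by (simp add: residual_coordinate_def)
  then obtain f where f: "subst (vcut n pX) f = f" "pval f = F" using pval_surj by blast
  have coord: "coordinate_at p n f" if p: "primeideal p R" for p
    using residue_field_properties[OF p] assms(5) p
    by (intro coordinate_at_residue_field[OF p assms(4), of "residue_field R p" "to_residue_field R p"])
      (auto simp: residual_coordinate_def f(2))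
  \<comment> \<open>For I = 0 the chains over I are among all chains of primes, whose length the
    Krull dimension bounds by d.\<close>
  have "gen_coordinate (ext {\<zero>\<^bsub>R\<^esub>}) (2 ^ d * n) f"
    using assms(3) unfolding has_krull_dim_def
    by (intro residual_gen_coordinate[OF assms(2,4) f(1) coord zeroideal]) auto
  moreover have "n \<le> 2 ^ d * n" "1 \<le> 2 ^ d * n" using assms(4) by auto
  ultimately have "coordinate R (2 ^ d * n) F"
    using coordinate_of_gen_coordinate vcut_fixed_mono[OF f(1)] f(2) by blast
  moreover have "n + (2 ^ d - 1) * n = 2 ^ d * n" by (simp add: diff_mult_distrib)
  ultimately show ?thesis using F by (simp add: stable_coordinate_def)
qed

end
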